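(* Let $f$ be a probability density on $\mathbb{R}$ with $\int_{\mathbb{R}} v f(v)\,dv=0$, $\int_{\mathbb{R}} v^2f(v)\,dv=1$, $\int_{\mathbb{R}} v^4 f(v)\,dv<+\infty$, and $\int_{\mathbb{R}} f^p<+\infty$ for some $p>1$. Then $Z_N(f,r)$ is well-defined, at least if $N$ is large enough, and $$Z_N(f,r)=\gamma^{(N)}(r)\,\frac{\sqrt2}{\Sigma}\,\frac{\alpha_N(N)}{\alpha_N(r^2)}\left(e^{-\frac{(r^2-N)^2}{2N\Sigma^2}}+\varepsilon(N,f,r)\right),$$ where $\lim_{N\to\infty}\varepsilon(N,f,r)=0$.
   Context: For a probability density $f$ on $\mathbb{R}$ and $r>0$, $f^{\otimes N}(v_1,\dots,v_N)=\prod_{j=1}^N f(v_j)$ and $$Z_N(f,r)=\int_{S^{N-1}(r)}f^{\otimes N}\,d\sigma^N_r ,$$ where $S^{N-1}(r)\subset\mathbb{R}^N$ is the sphere of radius $r$ centred at $0$ and $\sigma_r^N$ is the uniform probability measure on it. "Well-defined" includes that $Z_N(f,r)$ remains unchanged under a modification of $f$ on a set of zero Lebesgue measure. Further, $$\Sigma=\sqrt{\int_{\mathbb{R}}(v^2-1)^2f(v)\,dv},\qquad \gamma^{(N)}(r)=\frac{e^{-r^2/2}}{(2\pi)^{N/2}},\qquad \alpha_N(u)=u^{\frac N2-1}e^{-\frac u2}.$$ Here $\gamma^{(N)}(r)$ is the restriction (a constant) to $S^{N-1}(r)$ of $\gamma^{\otimes N}$, where $\gamma(v)=e^{-v^2/2}/\sqrt{2\pi}$.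 *)

theory Defs
  imports "HOL-Probability.Probability"
begin

text \<open>
  Since the dimension \<open>N\<close> varies, $\mathbb{R}^N$ is the product space over the index set
  \<open>{..<N}\<close>; the coordinates $v_1, \dots, v_N$ are \<open>x 0, \<dots>, x (N - 1)\<close>.
\<close>

definition Rn_norm :: "nat \<Rightarrow> (nat \<Rightarrow> real) \<Rightarrow> real" where
  "Rn_norm N x = sqrt (\<Sum>i<N. (x i)\<^sup>2)"

definition Rn_lborel :: "nat \<Rightarrow> (nat \<Rightarrow> real) measure" where
  "Rn_lborel N = (\<Pi>\<^sub>M i\<in>{..<N}. lborel)"

definition Rn_sphere :: "nat \<Rightarrow> real \<Rightarrow> (nat \<Rightarrow> real) set" where
  "Rn_sphere N r = {x \<in> space (Rn_lborel N). Rn_norm N x = r}"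

definition Rn_unit_ball :: "nat \<Rightarrow> (nat \<Rightarrow> real) set" where
  "Rn_unit_ball N = {x \<in> space (Rn_lborel N). Rn_norm N x \<le> 1}"

definition radial_proj :: "nat \<Rightarrow> real \<Rightarrow> (nat \<Rightarrow> real) \<Rightarrow> (nat \<Rightarrow> real)" where
  "radial_proj N r x = (\<lambda>i\<in>{..<N}. r * x i / Rn_norm N x)"

text \<open>
  The uniform probability measure on the sphere of radius \<open>r\<close>, as normalised surface (cone)
  measure: the mass of \<open>A\<close> is the proportion of the volume of the unit ball taken up by the points
  whose radial projection lies in \<open>A\<close>. It is a measure on all of $\mathbb{R}^N$ concentrated on
  the sphere. It is completed because densities are only assumed to be Lebesgue measurable.
\<close>

definition sphere_measure :: "nat \<Rightarrow> real \<Rightarrow> (nat \<Rightarrow> real) measure" where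
  "sphere_measure N r =
     completion (distr (uniform_measure (Rn_lborel N) (Rn_unit_ball N)) (Rn_lborel N)
       (radial_proj N r))"

definition tensor_power :: "nat \<Rightarrow> (real \<Rightarrow> real) \<Rightarrow> (nat \<Rightarrow> real) \<Rightarrow> real" where
  "tensor_power N f x = (\<Prod>i<N. f (x i))"

definition Z :: "nat \<Rightarrow> (real \<Rightarrow> real) \<Rightarrow> real \<Rightarrow> real" where
  "Z N f r = (\<integral>x. tensor_power N f x \<partial>sphere_measure N r)"

text \<open>
  Taking \<open>g = f\<close>, this contains the convergence of the integral defining \<open>Z N f r\<close>.
\<close>

definition Z_well_defined :: "nat \<Rightarrow> (real \<Rightarrow> real) \<Rightarrow> real \<Rightarrow> bool" where
  "Z_well_defined N f r \<longleftrightarrow>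
     (\<forall>g. (AE v in lebesgue. g v = f v) \<longrightarrow>
        integrable (sphere_measure N r) (tensor_power N g) \<and> Z N g r = Z N f r)"

definition prob_density :: "(real \<Rightarrow> real) \<Rightarrow> bool" where
  "prob_density f \<longleftrightarrow> (AE v in lebesgue. 0 \<le> f v) \<and> has_bochner_integral lebesgue f 1"

definition Sigma_f :: "(real \<Rightarrow> real) \<Rightarrow> real" where
  "Sigma_f f = sqrt (\<integral>v. (v\<^sup>2 - 1)\<^sup>2 * f v \<partial>lebesgue)"

definition gamma_N :: "nat \<Rightarrow> real \<Rightarrow> real" where
  "gamma_N N r = exp (- r\<^sup>2 / 2) / (2 * pi) powr (real N / 2)"

definition alpha :: "nat \<Rightarrow> real \<Rightarrow> real" where
  "alpha N u = u powr (real N / 2 - 1) * exp (- u / 2)"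

lemma Rn_norm_measurable [measurable]: "Rn_norm N \<in> borel_measurable (Rn_lborel N)"
  unfolding Rn_norm_def[abs_def] Rn_lborel_def by measurable

lemma radial_proj_measurable [measurable]: "radial_proj N r \<in> Rn_lborel N \<rightarrow>\<^sub>M Rn_lborel N"
proof -
  have [measurable]: "Rn_norm N \<in> borel_measurable (\<Pi>\<^sub>M i\<in>{..<N}. lborel)"
    using Rn_norm_measurable[of N] by (simp add: Rn_lborel_def)
  show ?thesis
    unfolding radial_proj_def[abs_def] Rn_lborel_def
    by (rule measurable_restrict) (auto intro!: borel_measurable_divide borel_measurable_times)
qed

lemma Rn_unit_ball_sets [measurable]: "Rn_unit_ball N \<in> sets (Rn_lborel N)"
  unfolding Rn_unit_ball_def by measurable

lemma emeasure_Rn_box: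
  assumes "0 \<le> a"
  shows "emeasure (Rn_lborel N) (Pi\<^sub>E {..<N} (\<lambda>_. {-a..a})) = ennreal ((2 * a) ^ N)"
proof -
  interpret product_sigma_finite "\<lambda>_::nat. lborel :: real measure" ..
  show ?thesis
    unfolding Rn_lborel_def using assms
    by (subst emeasure_PiM) (auto simp: ennreal_power prod_ennreal[symmetric])
qed

lemma Rn_box_sets [measurable]: "Pi\<^sub>E {..<N} (\<lambda>_. {-a..a}) \<in> sets (Rn_lborel N)"
  unfolding Rn_lborel_def by (rule sets_PiM_I_finite) auto

lemma emeasure_Rn_unit_ball:
  "emeasure (Rn_lborel N) (Rn_unit_ball N) \<noteq> 0" "emeasure (Rn_lborel N) (Rn_unit_ball N) \<noteq> \<infinity>"
proof -
  have "Rn_unit_ball N \<subseteq> Pi\<^sub>E {..<N} (\<lambda>_. {-1..1})"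
  proof
    fix x assume x: "x \<in> Rn_unit_ball N"
    then have s: "(\<Sum>i<N. (x i)\<^sup>2) \<le> 1"
      by (simp add: Rn_unit_ball_def Rn_norm_def)
    have "x i \<in> {-1..1}" if "i < N" for i
    proof -
      have "(x i)\<^sup>2 \<le> (\<Sum>i<N. (x i)\<^sup>2)"
        using that by (intro member_le_sum) auto
      with s have "(x i)\<^sup>2 \<le> 1" by simp
      then show ?thesis by (simp add: abs_square_le_1 abs_le_iff)
    qed
    with x show "x \<in> Pi\<^sub>E {..<N} (\<lambda>_. {-1..1})"
      by (auto simp: Rn_unit_ball_def Rn_lborel_def space_PiM PiE_def Pi_def)
  qed
  then have "emeasure (Rn_lborel N) (Rn_unit_ball N) \<le> ennreal ((2 * 1) ^ N)"
    by (subst emeasure_Rn_box[symmetric]) (auto intro!: emeasure_mono)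
  then show "emeasure (Rn_lborel N) (Rn_unit_ball N) \<noteq> \<infinity>"
    by (auto simp: top_unique)
  define a where "a = 1 / (1 + real N)"
  have a: "0 < a" "real N * a\<^sup>2 \<le> 1"
  proof -
    show "0 < a" by (simp add: a_def)
    have "real N * 1 \<le> (1 + real N) ^ 2" by (simp add: power2_eq_square algebra_simps)
    then show "real N * a\<^sup>2 \<le> 1" by (simp add: a_def power_divide)
  qed
  have "Pi\<^sub>E {..<N} (\<lambda>_. {-a..a}) \<subseteq> Rn_unit_ball N"
  proof
    fix x assume x: "x \<in> Pi\<^sub>E {..<N} (\<lambda>_. {-a..a})"
    have "(x i)\<^sup>2 \<le> a\<^sup>2" if "i < N" for i
    proof -
      have "x i \<in> {-a..a}" using x that by (auto simp: PiE_def Pi_def)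
      then have "\<bar>x i\<bar> \<le> a" by auto
      then show ?thesis using a(1) by (simp add: abs_le_square_iff[symmetric])
    qed
    then have "(\<Sum>i<N. (x i)\<^sup>2) \<le> (\<Sum>i<N. a\<^sup>2)" by (intro sum_mono) auto
    also have "\<dots> \<le> 1" using a(2) by simp
    finally show "x \<in> Rn_unit_ball N"
      using x by (auto simp: Rn_unit_ball_def Rn_norm_def Rn_lborel_def space_PiM PiE_def)
  qed
  then have "ennreal ((2 * a) ^ N) \<le> emeasure (Rn_lborel N) (Rn_unit_ball N)"
    using a(1) by (subst emeasure_Rn_box[symmetric]) (auto intro!: emeasure_mono)
  moreover have "0 < ennreal ((2 * a) ^ N)" using a(1) by (simp add: ennreal_zero_less_mult_iff)
  ultimately show "emeasure (Rn_lborel N) (Rn_unit_ball N) \<noteq> 0"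
    by (metis not_less)
qed

lemma prob_space_sphere_measure: "prob_space (sphere_measure N r)"
proof -
  interpret U: prob_space "uniform_measure (Rn_lborel N) (Rn_unit_ball N)"
    using emeasure_Rn_unit_ball by (intro prob_space_uniform_measure) auto
  have "radial_proj N r \<in> uniform_measure (Rn_lborel N) (Rn_unit_ball N) \<rightarrow>\<^sub>M Rn_lborel N"
    by simp
  then interpret D: prob_space
    "distr (uniform_measure (Rn_lborel N) (Rn_unit_ball N)) (Rn_lborel N) (radial_proj N r)"
    by (rule U.prob_space_distr)
  show ?thesis
    unfolding sphere_measure_def by (rule D.prob_space_completion)
qed

lemma AE_sphere_measure_in_sphere:
  assumes "N > 0" "r > 0"
  shows "AE x in sphere_measure N r. x \<in> Rn_sphere N r"
proof -
  interpret product_sigma_finite "\<lambda>_::nat. lborel :: real measure" ..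
  let ?U = "uniform_measure (Rn_lborel N) (Rn_unit_ball N)"
  have sphere [measurable]: "Rn_sphere N r \<in> sets (Rn_lborel N)"
    unfolding Rn_sphere_def by measurable
  let ?O = "Pi\<^sub>E {..<N} (\<lambda>_. {-0..0::real})"
  have null: "emeasure (Rn_lborel N) ?O = 0"
    using assms by (subst emeasure_Rn_box) auto
  have proj: "radial_proj N r x \<in> Rn_sphere N r" if x: "x \<in> space (Rn_lborel N)" "x \<notin> ?O" for x
  proof -
    have "\<exists>i<N. x i \<noteq> 0"
    proof (rule ccontr)
      assume 0: "\<not> ?thesis"
      have "x \<in> extensional {..<N}"
        using x(1) by (simp add: Rn_lborel_def space_PiM PiE_def)
      moreover have "x i \<in> {-0..0}" if "i \<in> {..<N}" for i
        using 0 that by simp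
      ultimately have "x \<in> ?O" unfolding PiE_iff by blast
      with x(2) show False by contradiction
    qed
    then obtain k where k: "k < N" "x k \<noteq> 0" by blast
    then have "0 < (x k)\<^sup>2" by simp
    also have "\<dots> \<le> (\<Sum>i<N. (x i)\<^sup>2)"
      using k(1) by (intro member_le_sum) auto
    finally have "(\<Sum>i<N. (x i)\<^sup>2) > 0" .
    moreover have pos2: "(\<Sum>i<N. (x i)\<^sup>2) = (Rn_norm N x)\<^sup>2"
      unfolding Rn_norm_def by (rule real_sqrt_pow2[symmetric]) (intro sum_nonneg, simp)
    ultimately have pos1: "(Rn_norm N x)\<^sup>2 > 0" by simp
    have "(\<Sum>i<N. (radial_proj N r x i)\<^sup>2) = (\<Sum>i<N. r\<^sup>2 / (Rn_norm N x)\<^sup>2 * (x i)\<^sup>2)"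
      by (intro sum.cong) (auto simp: radial_proj_def power_mult_distrib power_divide)
    also have "\<dots> = r\<^sup>2 / (Rn_norm N x)\<^sup>2 * (Rn_norm N x)\<^sup>2"
      by (simp only: sum_distrib_left[symmetric] pos2)
    also have "\<dots> = r\<^sup>2" using pos1 by simp
    finally have "Rn_norm N (radial_proj N r x) = r"
      using assms(2) by (simp add: Rn_norm_def)
    then show ?thesis
      by (simp add: Rn_sphere_def Rn_lborel_def space_PiM radial_proj_def)
  qed
  have "AE x in Rn_lborel N. x \<notin> ?O"
    by (intro AE_not_in null_setsI null Rn_box_sets)
  then have "AE x in Rn_lborel N. radial_proj N r x \<in> Rn_sphere N r"
    by (rule AE_mp) (rule AE_I2, use proj in blast)
  then have "AE x in ?U. radial_proj N r x \<in> Rn_sphere N r"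
    by (intro AE_uniform_measureI[OF Rn_unit_ball_sets]) (erule eventually_mono, blast)
  then have "AE x in distr ?U (Rn_lborel N) (radial_proj N r). x \<in> Rn_sphere N r"
    by (subst AE_distr_iff) simp_all
  then show ?thesis
    unfolding sphere_measure_def by (rule AE_completion)
qed

lemma tensor_power_gaussian_on_sphere:
  assumes "x \<in> Rn_sphere N r"
  shows "tensor_power N std_normal_density x = gamma_N N r"
proof -
  have s: "(\<Sum>i<N. (x i)\<^sup>2) = r\<^sup>2"
    using assms by (auto simp: Rn_sphere_def Rn_norm_def sum_nonneg)
  have "tensor_power N std_normal_density x
      = (\<Prod>i<N. exp (- (x i)\<^sup>2 / 2)) / sqrt (2 * pi) ^ N"
    by (simp add: tensor_power_def std_normal_density_def prod.distrib power_one_over prod_dividef)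
  also have "(\<Prod>i<N. exp (- (x i)\<^sup>2 / 2)) = exp (- r\<^sup>2 / 2)"
    by (simp add: exp_sum[symmetric] sum_negf sum_divide_distrib[symmetric] s)
  also have "sqrt (2 * pi) ^ N = (2 * pi) powr (real N / 2)"
    by (subst powr_realpow[symmetric]) (simp_all add: powr_half_sqrt[symmetric] powr_powr)
  finally show ?thesis by (simp add: gamma_N_def)
qed

end

theory Submission
  imports Defs
begin

text \<open>
  Write \<open>h\<close> for the density of \<open>v\<^sup>2\<close> when \<open>v\<close> has density \<open>f\<close>. In polar coordinates the density of
  \<open>v\<^sub>1\<^sup>2 + \<dots> + v\<^sub>N\<^sup>2\<close> at \<open>u = r\<^sup>2\<close> is \<open>Z\<^sub>N(f, r)\<close> times a factor \<open>a\<^sub>N(u)\<close> that does not involve \<open>f\<close>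
  (\<open>square_norm_density\<close>); on the other hand it is the \<open>N\<close>-fold convolution power of \<open>h\<close>, to which a local limit theorem
  applies: \<open>h\<close> has mean \<open>1\<close> and variance \<open>\<Sigma>\<^sup>2\<close>, so \<open>\<Sigma> \<surd>N h\<^bsup>*N\<^esup>(u)\<close> is uniformly close to the standard
  normal density at \<open>(u - N) / (\<Sigma> \<surd>N)\<close>.

  For the Gaussian density \<open>\<gamma>\<close> one knows \<open>Z\<^sub>N(\<gamma>, r)\<close>, and the same limit theorem applied to it determines
  the factor \<open>a\<^sub>N(N)\<close> asymptotically. The quotient of the two expansions is the claim, so neither the
  volume of the ball nor Stirling's formula has to be computed.

  Three points need care.

  First, the statement is about every \<open>r\<close>, whereas polar coordinates identify densities only almost
  everywhere. The recursion \<open>square_sum_density_Suc\<close> says that the sphere integrals satisfy the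
  convolution equation at every single point: the cone over \<open>S\<^sup>N\<close> is cut by hyperplanes orthogonal to the
  last axis, and each slice is integrated in polar coordinates. For a product of different functions
  the same recursion shows that the coordinates of a uniform point on the sphere are absolutely
  continuous, hence that \<open>Z\<^sub>N(f, r)\<close> does not see null sets (\<open>tensor_power_sphere\<close>).

  Second, the limit theorem needs the characteristic function \<open>\<phi>\<close> of \<open>h\<close> to have an integrable power.
  The bound \<open>\<integral> |f|\<^sup>p < \<infinity>\<close> controls the mass of \<open>h\<close> above a level \<open>M\<close> by a negative power of \<open>M\<close>
  (\<open>square_density_tail\<close>); Plancherel's inequality for the truncations \<open>min h M\<close>, summed over
  \<open>M = 4\<^sup>n\<close>, then gives the integrability (\<open>integrable_power_fourier\<close>). Once \<open>\<phi>\<^sup>N\<close> is integrable,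
  Fourier inversion holds almost everywhere for \<open>h\<^bsup>*N\<^esup>\<close>, and one more convolution with \<open>h\<close> makes it
  hold everywhere (\<open>convolution_power_eq_fourier\<close>).

  Third, the local limit theorem is the \<open>L\<^sup>1\<close> convergence of the normalised powers of \<open>\<phi>\<close> to the
  transform of the normal density (\<open>charfun_power_L1_convergence\<close>): near \<open>0\<close> a Taylor bound dominates
  the powers by a Gaussian, and away from \<open>0\<close> they are exponentially small since \<open>|\<phi>|\<close> stays
  away from \<open>1\<close> there (\<open>fourier_bounded_away\<close>).
\<close>

section \<open>Integration in polar coordinates\<close>

interpretation lborel_product: product_sigma_finite "\<lambda>_::nat. lborel :: real measure" ..

lemma sigma_finite_Rn_lborel: "sigma_finite_measure (Rn_lborel N)"
proof -
  interpret finite_product_sigma_finite "\<lambda>_::nat. lborel :: real measure" "{..<N}"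
    by standard simp
  show ?thesis unfolding Rn_lborel_def by (rule sigma_finite_measure_axioms)
qed

lemma pair_sigma_finite_lborel_Rn: "pair_sigma_finite lborel (Rn_lborel N)"
  by (intro pair_sigma_finite.intro sigma_finite_Rn_lborel lborel.sigma_finite_measure_axioms)

lemma measurable_Rn_component: "i < N \<Longrightarrow> (\<lambda>x. x i) \<in> borel_measurable (Rn_lborel N)"
  unfolding Rn_lborel_def by measurable

context
  notes measurable_Rn_component [measurable]
begin

lemma measurable_Rn_lborelI:
  assumes "\<And>i. i < N \<Longrightarrow> (\<lambda>x. g x i) \<in> borel_measurable M"
    and "\<And>x. x \<in> space M \<Longrightarrow> g x \<in> extensional {..<N}"
  shows "g \<in> M \<rightarrow>\<^sub>M Rn_lborel N"
  unfolding Rn_lborel_def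
  by (rule measurable_PiM_single') (use assms in \<open>auto simp: space_PiM PiE_iff\<close>)

lemma measurable_radial_proj_pair [measurable]:
  "(\<lambda>(r, x). radial_proj N r x) \<in> lborel \<Otimes>\<^sub>M Rn_lborel N \<rightarrow>\<^sub>M Rn_lborel N"
  by (rule measurable_Rn_lborelI) (auto simp: radial_proj_def split_beta)

lemma measurable_Rn_scale_pair [measurable]:
  "(\<lambda>(c, x). \<lambda>i\<in>{..<N}. c * x i) \<in> lborel \<Otimes>\<^sub>M Rn_lborel N \<rightarrow>\<^sub>M Rn_lborel N"
  by (rule measurable_Rn_lborelI) (auto simp: split_beta)

lemma measurable_Rn_snoc:
  "(\<lambda>(z, x). x(N := z)) \<in> lborel \<Otimes>\<^sub>M Rn_lborel N \<rightarrow>\<^sub>M Rn_lborel (Suc N)"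
proof (rule measurable_Rn_lborelI)
  fix i assume "i < Suc N"
  then consider "i = N" | "i < N" by linarith
  then show "(\<lambda>p. (case p of (z, x) \<Rightarrow> x(N := z)) i) \<in> borel_measurable (lborel \<Otimes>\<^sub>M Rn_lborel N)"
    by cases (auto simp: split_beta)
qed (auto simp: space_pair_measure Rn_lborel_def space_PiM extensional_def PiE_def)

lemma nn_integral_Rn_Suc:
  assumes F [measurable]: "F \<in> borel_measurable (Rn_lborel (Suc N))"
  shows "(\<integral>\<^sup>+x. F x \<partial>Rn_lborel (Suc N)) = (\<integral>\<^sup>+z. \<integral>\<^sup>+x. F (x(N := z)) \<partial>Rn_lborel N \<partial>lborel)"
  using lborel_product.product_nn_integral_insert_rev[of "{..<N}" N F] F
  by (simp add: Rn_lborel_def lessThan_Suc)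

lemma nn_integral_Rn_1:
  assumes [measurable]: "F \<in> borel_measurable borel"
  shows "(\<integral>\<^sup>+x. F (x 0) \<partial>Rn_lborel 1) = (\<integral>\<^sup>+z. F z \<partial>lborel)"
  using lborel_product.product_nn_integral_singleton[of F 0]
  by (simp add: Rn_lborel_def lessThan_Suc)

lemma Rn_norm_Suc: "Rn_norm (Suc N) (x(N := z)) = sqrt ((Rn_norm N x)\<^sup>2 + z\<^sup>2)"
  by (simp add: Rn_norm_def sum_nonneg)

lemma Rn_norm_nonneg: "0 \<le> Rn_norm N x"
  by (simp add: Rn_norm_def sum_nonneg)

lemma Rn_norm_scale: "Rn_norm N (\<lambda>i\<in>{..<N}. c * x i) = \<bar>c\<bar> * Rn_norm N x"
proof -
  have "(\<Sum>i<N. ((\<lambda>i\<in>{..<N}. c * x i) i)\<^sup>2) = c\<^sup>2 * (\<Sum>i<N. (x i)\<^sup>2)"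
    by (simp add: power_mult_distrib sum_distrib_left)
  then show ?thesis by (simp add: Rn_norm_def real_sqrt_mult)
qed

lemma Rn_norm_radial_proj:
  assumes "Rn_norm N x \<noteq> 0"
  shows "Rn_norm N (radial_proj N r x) = \<bar>r\<bar>"
  using Rn_norm_scale[of N "r / Rn_norm N x" x] assms Rn_norm_nonneg[of N x]
  by (simp add: radial_proj_def abs_mult)

lemma AE_Rn_norm_pos:
  assumes "N > 0"
  shows "AE x in Rn_lborel N. Rn_norm N x > 0"
proof (rule AE_I')
  show "Pi\<^sub>E {..<N} (\<lambda>_. {-0..0::real}) \<in> null_sets (Rn_lborel N)"
    using emeasure_Rn_box[of 0 N] assms by (intro null_setsI Rn_box_sets) auto
  show "{x \<in> space (Rn_lborel N). \<not> Rn_norm N x > 0} \<subseteq> Pi\<^sub>E {..<N} (\<lambda>_. {-0..0})"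
  proof (intro subsetI, elim CollectE conjE)
    fix x assume x: "x \<in> space (Rn_lborel N)" "\<not> Rn_norm N x > 0"
    then have "(\<Sum>i<N. (x i)\<^sup>2) = 0"
      using Rn_norm_nonneg[of N x] by (simp add: Rn_norm_def)
    then have "\<forall>i<N. x i = 0" by (subst (asm) sum_nonneg_eq_0_iff) auto
    then show "x \<in> Pi\<^sub>E {..<N} (\<lambda>_. {-0..0})"
      using x(1) by (auto simp: Rn_lborel_def space_PiM PiE_iff extensional_def fun_eq_iff)
  qed
qed

lemma nn_integral_Rn_scale:
  assumes "c > 0" "F \<in> borel_measurable (Rn_lborel N)"
  shows "(\<integral>\<^sup>+x. F x \<partial>Rn_lborel N) = ennreal (c ^ N) * (\<integral>\<^sup>+x. F (\<lambda>i\<in>{..<N}. c * x i) \<partial>Rn_lborel N)"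
  using assms(2)
proof (induction N arbitrary: F)
  case 0
  have "x = (\<lambda>i\<in>{..<0}. c * x i)" if "x \<in> space (Rn_lborel 0)" for x
    using that by (auto simp: Rn_lborel_def space_PiM)
  then have "(\<integral>\<^sup>+x. F x \<partial>Rn_lborel 0) = (\<integral>\<^sup>+x. F (\<lambda>i\<in>{..<0}. c * x i) \<partial>Rn_lborel 0)"
    by (intro nn_integral_cong arg_cong[where f = F]) simp
  then show ?case by (simp only: power_0 ennreal_1 mult_1)
next
  case (Suc N)
  note F [measurable] = Suc.prems
  note measurable_Rn_snoc [measurable]
  interpret P: pair_sigma_finite lborel "Rn_lborel N" by (rule pair_sigma_finite_lborel_Rn)
  have meas: "(\<lambda>z. \<integral>\<^sup>+x. G (x(N := z)) \<partial>Rn_lborel N) \<in> borel_measurable borel"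
    if [measurable]: "G \<in> borel_measurable (Rn_lborel (Suc N))" for G
    using P.M2.borel_measurable_nn_integral_fst[of "\<lambda>(z, x). G (x(N := z))" lborel] by simp
  have scale [measurable]: "(\<lambda>x. \<lambda>i\<in>{..<Suc N}. c * x i) \<in> Rn_lborel (Suc N) \<rightarrow>\<^sub>M Rn_lborel (Suc N)"
    by (rule measurable_Rn_lborelI) auto
  have "(\<integral>\<^sup>+x. F x \<partial>Rn_lborel (Suc N)) = (\<integral>\<^sup>+z. \<integral>\<^sup>+x. F (x(N := z)) \<partial>Rn_lborel N \<partial>lborel)"
    by (rule nn_integral_Rn_Suc) fact
  also have "\<dots> = c * (\<integral>\<^sup>+z. \<integral>\<^sup>+x. F (x(N := c * z)) \<partial>Rn_lborel N \<partial>lborel)"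
    using nn_integral_real_affine[OF meas[OF F], of c 0] assms(1) by (simp add: fun_upd_def)
  also have "\<dots> = c * (\<integral>\<^sup>+z. c ^ N * (\<integral>\<^sup>+x. F ((\<lambda>i\<in>{..<N}. c * x i)(N := c * z)) \<partial>Rn_lborel N) \<partial>lborel)"
  proof (intro arg_cong2[where f = "(*)"] nn_integral_cong refl Suc.IH)
    fix z :: real
    show "(\<lambda>x. F (x(N := c * z))) \<in> borel_measurable (Rn_lborel N)"
      using measurable_compose[OF measurable_compose[OF measurable_Pair1'[of "c * z" lborel "Rn_lborel N"]
        measurable_Rn_snoc] F] by simp
  qed
  also have "\<dots> = c * (\<integral>\<^sup>+z. c ^ N * (\<integral>\<^sup>+x. F (\<lambda>i\<in>{..<Suc N}. c * (x(N := z)) i) \<partial>Rn_lborel N) \<partial>lborel)"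
    by (intro arg_cong2[where f = "(*)"] nn_integral_cong refl arg_cong[where f = F]) auto
  also have "\<dots> = ennreal (c ^ Suc N) * (\<integral>\<^sup>+z. \<integral>\<^sup>+x. F (\<lambda>i\<in>{..<Suc N}. c * (x(N := z)) i) \<partial>Rn_lborel N \<partial>lborel)"
    using assms(1) meas[OF measurable_compose[OF scale F]]
    by (subst nn_integral_cmult) (auto simp: ennreal_mult mult.assoc restrict_def)
  also have "(\<integral>\<^sup>+z. \<integral>\<^sup>+x. F (\<lambda>i\<in>{..<Suc N}. c * (x(N := z)) i) \<partial>Rn_lborel N \<partial>lborel)
     = (\<integral>\<^sup>+x. F (\<lambda>i\<in>{..<Suc N}. c * x i) \<partial>Rn_lborel (Suc N))"
    by (subst nn_integral_Rn_Suc) auto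
  finally show ?case .
qed

end

text \<open>
  The sphere integral before normalisation: dividing by the volume of the unit ball gives the mean of
  \<open>F\<close> over the sphere of radius \<open>r\<close>. All the geometry is done with this quantity, so that the volume
  stays an unspecified constant.
\<close>

definition cone_integral :: "nat \<Rightarrow> ((nat \<Rightarrow> real) \<Rightarrow> ennreal) \<Rightarrow> real \<Rightarrow> ennreal" where
  "cone_integral N F r =
     (\<integral>\<^sup>+x. indicator (Rn_unit_ball N) x * F (radial_proj N r x) \<partial>Rn_lborel N)"

lemma measurable_cone_integral [measurable]:
  assumes [measurable]: "F \<in> borel_measurable (Rn_lborel N)"
  shows "cone_integral N F \<in> borel_measurable borel"
proof -
  interpret P: pair_sigma_finite lborel "Rn_lborel N" by (rule pair_sigma_finite_lborel_Rn)
  show ?thesis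
    using P.M2.borel_measurable_nn_integral_fst
      [of "\<lambda>(r, x). indicator (Rn_unit_ball N) x * F (radial_proj N r x)" lborel]
    by (simp add: cone_integral_def[abs_def])
qed

lemma nn_integral_powr_atLeast:
  assumes "a < 0" "0 < b"
  shows "(\<integral>\<^sup>+t. ennreal (- a * t powr (a - 1)) * indicator {b..} t \<partial>lborel) = ennreal (b powr a)"
proof -
  have "(\<integral>\<^sup>+t. ennreal (- a * t powr (a - 1)) * indicator {b..} t \<partial>lborel) = ennreal (0 - (- (b powr a)))"
  proof (rule nn_integral_FTC_atLeast[where F = "\<lambda>t. - (t powr a)"])
    show "((\<lambda>t. - (t powr a)) \<longlongrightarrow> 0) at_top"
      using tendsto_minus[OF tendsto_neg_powr[OF assms(1) filterlim_ident]] by simp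
  qed (use assms in \<open>auto intro!: derivative_eq_intros mult_nonpos_nonneg\<close>)
  then show ?thesis by simp
qed

lemma ennreal_mult_eqI:
  assumes "a * b * c = d * e" "0 \<le> a" "0 \<le> b" "0 \<le> c" "0 \<le> d" "0 \<le> e"
  shows "ennreal a * (ennreal b * ennreal c) = ennreal d * ennreal e"
  using assms by (simp add: ennreal_mult[symmetric] mult.assoc)

lemma power2_powr_half:
  assumes "(x::real) > 0"
  shows "(x\<^sup>2) powr (real N / 2) = x ^ N"
proof -
  have "(x\<^sup>2) powr (real N / 2) = (x powr 2) powr (real N / 2)"
    using assms by simp
  also have "\<dots> = x powr real N"
    by (simp only: powr_powr) simp
  finally show ?thesis
    using assms by (simp add: powr_realpow)
qed

text \<open>
  With \<open>s\<close> the square of the radius. Since spheres are defined through the cone measure, no surface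
  measure is involved: substituting \<open>s = |x|\<^sup>2 t\<close> for a fixed point \<open>x\<close> of the ball turns the integrand
  \<open>F (\<surd>s x / |x|)\<close> into \<open>F (\<surd>t x)\<close>; the dilation \<open>y = \<surd>t x\<close> then moves the constraint \<open>|x| \<le> 1\<close>
  to \<open>t \<ge> |y|\<^sup>2\<close>, and the remaining integral over \<open>t\<close> cancels the powers of \<open>|y|\<close>.
\<close>

lemma nn_integral_polar:
  assumes N: "N > 0" and F [measurable]: "F \<in> borel_measurable (Rn_lborel N)"
  shows "(\<integral>\<^sup>+x. F x \<partial>Rn_lborel N) =
    (\<integral>\<^sup>+s. indicator {0<..} s * ennreal (real N / 2 * s powr (real N / 2 - 1)) *
       cone_integral N F (sqrt s) \<partial>lborel)"
proof -
  interpret P: pair_sigma_finite lborel "Rn_lborel N" by (rule pair_sigma_finite_lborel_Rn)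
  define w where "w t = indicator {0<..} t * ennreal (real N / 2 * t powr (real N / 2 - 1))" for t :: real
  define c where "c t x = (\<lambda>i\<in>{..<N}. t * x i)" for t :: real and x :: "nat \<Rightarrow> real"
  have w [measurable]: "w \<in> borel_measurable borel" by (simp add: w_def[abs_def])
  have c [measurable]: "(\<lambda>(t, x). c t x) \<in> lborel \<Otimes>\<^sub>M Rn_lborel N \<rightarrow>\<^sub>M Rn_lborel N"
    using measurable_Rn_scale_pair by (simp add: c_def)
  have c' [measurable]: "c t \<in> Rn_lborel N \<rightarrow>\<^sub>M Rn_lborel N" for t
    using measurable_compose[OF measurable_Pair1'[of t lborel "Rn_lborel N"] c] by simp
  have c'' [measurable]: "x \<in> space (Rn_lborel N) \<Longrightarrow> (\<lambda>t. c t x) \<in> borel \<rightarrow>\<^sub>M Rn_lborel N" for x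
    using measurable_compose[OF measurable_Pair2'[of x "Rn_lborel N" lborel] c] by simp
  have "(\<integral>\<^sup>+s. w s * cone_integral N F (sqrt s) \<partial>lborel) =
     (\<integral>\<^sup>+s. \<integral>\<^sup>+x. indicator (Rn_unit_ball N) x * (w s * F (radial_proj N (sqrt s) x)) \<partial>Rn_lborel N \<partial>lborel)"
    unfolding cone_integral_def
    by (intro nn_integral_cong, subst nn_integral_cmult[symmetric]) (auto simp: ac_simps)
  also have "\<dots> = (\<integral>\<^sup>+x. \<integral>\<^sup>+s. indicator (Rn_unit_ball N) x * (w s * F (radial_proj N (sqrt s) x)) \<partial>lborel \<partial>Rn_lborel N)"
    by (rule P.Fubini'[symmetric]) measurable
  also have "\<dots> = (\<integral>\<^sup>+x. \<integral>\<^sup>+t. indicator (Rn_unit_ball N) x * (ennreal (Rn_norm N x ^ N) * (w t * F (c (sqrt t) x))) \<partial>lborel \<partial>Rn_lborel N)"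
  proof (rule nn_integral_cong_AE, use AE_Rn_norm_pos[OF N] AE_space in eventually_elim)
    case (elim x)
    note elim [measurable]
    define n where "n = Rn_norm N x"
    have n: "n > 0" using elim by (simp add: n_def)
    have [measurable]: "(\<lambda>s. radial_proj N (sqrt s) x) \<in> borel \<rightarrow>\<^sub>M Rn_lborel N"
      using measurable_compose[of "\<lambda>s. (sqrt s, x)", OF _ measurable_radial_proj_pair] elim by simp
    have eq: "ennreal (n\<^sup>2) * (w (n\<^sup>2 * t) * F (radial_proj N (sqrt (n\<^sup>2 * t)) x)) =
         ennreal (n ^ N) * (w t * F (c (sqrt t) x))" for t
    proof (cases "t > 0")
      case True
      have "radial_proj N (sqrt (n\<^sup>2 * t)) x = c (sqrt t) x"
        using n by (auto simp: radial_proj_def c_def n_def[symmetric] real_sqrt_mult)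
      moreover have "ennreal (n\<^sup>2) * w (n\<^sup>2 * t) = ennreal (n ^ N) * w t"
      proof -
        have "n\<^sup>2 * (real N / 2 * (n\<^sup>2 * t) powr (real N / 2 - 1)) =
            n ^ N * (real N / 2 * t powr (real N / 2 - 1))"
        proof -
          have "(n\<^sup>2) powr (real N / 2) = n ^ N"
            by (rule power2_powr_half) fact
          then have "(n\<^sup>2) powr (real N / 2 - 1) * n\<^sup>2 = n ^ N"
            using n by (simp add: powr_diff)
          then show ?thesis using n True by (simp add: powr_mult algebra_simps)
        qed
        then show ?thesis
          using True n by (simp add: w_def ennreal_mult'[symmetric] zero_less_mult_iff)
      qed
      ultimately show ?thesis by (simp only: mult.assoc[symmetric])
    qed (use n in \<open>simp add: w_def zero_less_mult_iff\<close>)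
    have "(\<integral>\<^sup>+s. w s * F (radial_proj N (sqrt s) x) \<partial>lborel) =
       n\<^sup>2 * (\<integral>\<^sup>+t. w (n\<^sup>2 * t) * F (radial_proj N (sqrt (n\<^sup>2 * t)) x) \<partial>lborel)"
      using n by (subst nn_integral_real_affine[where c = "n\<^sup>2" and t = 0]) auto
    also have "\<dots> = (\<integral>\<^sup>+t. ennreal (n ^ N) * (w t * F (c (sqrt t) x)) \<partial>lborel)"
      by (subst nn_integral_cmult[symmetric]) (auto simp: eq)
    finally show ?case
      by (subst (1 2) nn_integral_cmult) (auto simp: n_def)
  qed
  also have "\<dots> = (\<integral>\<^sup>+t. \<integral>\<^sup>+x. indicator (Rn_unit_ball N) x * (ennreal (Rn_norm N x ^ N) * (w t * F (c (sqrt t) x))) \<partial>Rn_lborel N \<partial>lborel)"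
    by (rule P.Fubini') measurable
  also have "\<dots> = (\<integral>\<^sup>+t. \<integral>\<^sup>+y. indicator {..t} ((Rn_norm N y)\<^sup>2) * ennreal (real N / 2 * t powr (- real N / 2 - 1))
         * ennreal (Rn_norm N y ^ N) * (indicator {0<..} t * F y) \<partial>Rn_lborel N \<partial>lborel)"
  proof (rule nn_integral_cong)
    fix t :: real
    show "(\<integral>\<^sup>+x. indicator (Rn_unit_ball N) x * (ennreal (Rn_norm N x ^ N) * (w t * F (c (sqrt t) x))) \<partial>Rn_lborel N)
      = (\<integral>\<^sup>+y. indicator {..t} ((Rn_norm N y)\<^sup>2) * ennreal (real N / 2 * t powr (- real N / 2 - 1))
         * ennreal (Rn_norm N y ^ N) * (indicator {0<..} t * F y) \<partial>Rn_lborel N)" (is "?L = ?R")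
    proof (cases "t > 0")
      case True
      have norm: "Rn_norm N (c (sqrt t) x) = sqrt t * Rn_norm N x" for x
        unfolding c_def using Rn_norm_scale[of N "sqrt t" x] True by simp
      have ball: "x \<in> Rn_unit_ball N \<longleftrightarrow> (Rn_norm N (c (sqrt t) x))\<^sup>2 \<le> t"
        if "x \<in> space (Rn_lborel N)" for x
      proof -
        have "(Rn_norm N (c (sqrt t) x))\<^sup>2 \<le> t \<longleftrightarrow> (Rn_norm N x)\<^sup>2 \<le> 1"
          using True by (simp add: norm power_mult_distrib)
        then show ?thesis
          using that Rn_norm_nonneg[of N x] by (simp add: Rn_unit_ball_def abs_square_le_1)
      qed
      have sqrtN: "sqrt t ^ N = t powr (real N / 2)"
        using power2_powr_half[of "sqrt t" N] True by simp
      have "?R = ennreal (sqrt t ^ N) * (\<integral>\<^sup>+x. indicator {..t} ((Rn_norm N (c (sqrt t) x))\<^sup>2)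
           * ennreal (real N / 2 * t powr (- real N / 2 - 1))
         * ennreal (Rn_norm N (c (sqrt t) x) ^ N) * (indicator {0<..} t * F (c (sqrt t) x)) \<partial>Rn_lborel N)"
        unfolding c_def using True by (intro nn_integral_Rn_scale) auto
      also have "\<dots> = (\<integral>\<^sup>+x. ennreal (sqrt t ^ N) * (indicator {..t} ((Rn_norm N (c (sqrt t) x))\<^sup>2)
           * ennreal (real N / 2 * t powr (- real N / 2 - 1))
         * ennreal (Rn_norm N (c (sqrt t) x) ^ N) * (indicator {0<..} t * F (c (sqrt t) x))) \<partial>Rn_lborel N)"
        by (subst nn_integral_cmult) auto
      also have "\<dots> = ?L"
      proof (rule nn_integral_cong)
        fix x assume x: "x \<in> space (Rn_lborel N)"
        have "sqrt t ^ N * (real N / 2 * t powr (- real N / 2 - 1)) * (Rn_norm N (c (sqrt t) x) ^ N)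
           = Rn_norm N x ^ N * (real N / 2 * t powr (real N / 2 - 1))"
        proof -
          (* The first factor is the Jacobian of the dilation, the last one comes from the norm. *)
          have "t powr (real N / 2) * t powr (- real N / 2 - 1) * t powr (real N / 2) = t powr (real N / 2 - 1)"
            using True by (simp add: powr_add[symmetric] powr_diff)
          then show ?thesis by (simp add: norm power_mult_distrib sqrtN algebra_simps)
        qed
        then have eq: "ennreal (sqrt t ^ N) * (ennreal (real N / 2 * t powr (- real N / 2 - 1)) * ennreal (Rn_norm N (c (sqrt t) x) ^ N))
           = ennreal (Rn_norm N x ^ N) * ennreal (real N / 2 * t powr (real N / 2 - 1))"
          using True Rn_norm_nonneg[of N x] Rn_norm_nonneg[of N "c (sqrt t) x"]
          by (intro ennreal_mult_eqI) simp_all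
        have "indicator {..t} ((Rn_norm N (c (sqrt t) x))\<^sup>2) = (indicator (Rn_unit_ball N) x :: ennreal)"
          using ball[OF x] by (auto split: split_indicator)
        then show "ennreal (sqrt t ^ N) * (indicator {..t} ((Rn_norm N (c (sqrt t) x))\<^sup>2)
           * ennreal (real N / 2 * t powr (- real N / 2 - 1))
         * ennreal (Rn_norm N (c (sqrt t) x) ^ N) * (indicator {0<..} t * F (c (sqrt t) x)))
         = indicator (Rn_unit_ball N) x * (ennreal (Rn_norm N x ^ N) * (w t * F (c (sqrt t) x)))"
          using True arg_cong[OF eq, of "\<lambda>a. indicator (Rn_unit_ball N) x * (a * F (c (sqrt t) x))"]
          by (simp add: w_def ac_simps)
      qed
      finally show ?thesis ..
    qed (simp add: w_def)
  qed
  also have "\<dots> = (\<integral>\<^sup>+y. \<integral>\<^sup>+t. indicator {..t} ((Rn_norm N y)\<^sup>2) * ennreal (real N / 2 * t powr (- real N / 2 - 1))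
         * ennreal (Rn_norm N y ^ N) * (indicator {0<..} t * F y) \<partial>lborel \<partial>Rn_lborel N)"
    unfolding indicator_def atMost_iff by (rule P.Fubini'[symmetric]) measurable
  also have "\<dots> = (\<integral>\<^sup>+y. F y \<partial>Rn_lborel N)"
  proof (rule nn_integral_cong_AE, use AE_Rn_norm_pos[OF N] in eventually_elim)
    case (elim y)
    define n where "n = Rn_norm N y"
    have n: "n > 0" using elim by (simp add: n_def)
    have "(\<integral>\<^sup>+t. indicator {..t} (n\<^sup>2) * ennreal (real N / 2 * t powr (- real N / 2 - 1)) * ennreal (n ^ N) * (indicator {0<..} t * F y) \<partial>lborel)
      = (\<integral>\<^sup>+t. (ennreal (n ^ N) * F y) * (ennreal (- (- real N / 2) * t powr (- real N / 2 - 1)) * indicator {n\<^sup>2..} t) \<partial>lborel)"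
    proof (rule nn_integral_cong)
      fix t
      have "t > 0" if "n\<^sup>2 \<le> t" using that n by (meson less_le_trans zero_less_power)
      then show "indicator {..t} (n\<^sup>2) * ennreal (real N / 2 * t powr (- real N / 2 - 1)) * ennreal (n ^ N) * (indicator {0<..} t * F y)
        = (ennreal (n ^ N) * F y) * (ennreal (- (- real N / 2) * t powr (- real N / 2 - 1)) * indicator {n\<^sup>2..} t)"
        by (auto simp: ac_simps split: split_indicator)
    qed
    also have "\<dots> = (ennreal (n ^ N) * F y) * ennreal ((n\<^sup>2) powr (- real N / 2))"
      using N n by (subst nn_integral_cmult, simp, subst nn_integral_powr_atLeast) auto
    also have "(n\<^sup>2) powr (- real N / 2) = 1 / n ^ N"
    proof -
      have "(n\<^sup>2) powr (real N / 2) = n ^ N"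
        by (rule power2_powr_half) fact
      then show ?thesis by (simp add: powr_minus_divide)
    qed
    also have "ennreal (n ^ N) * F y * ennreal (1 / n ^ N) = (ennreal (n ^ N) * ennreal (1 / n ^ N)) * F y"
      by (simp add: ac_simps)
    also have "ennreal (n ^ N) * ennreal (1 / n ^ N) = 1"
      using n by (simp add: ennreal_mult'[symmetric])
    finally show ?case by (simp add: n_def)
  qed
  finally show ?thesis by (simp add: w_def)
qed

section \<open>Slicing the sphere\<close>

text \<open>
  The density of \<open>v\<^sup>2\<close> when \<open>v\<close> has density \<open>f\<close>.
\<close>

definition square_density :: "(real \<Rightarrow> ennreal) \<Rightarrow> real \<Rightarrow> ennreal" where
  "square_density f u =
     indicator {0<..} u * ((f (sqrt u) + f (- sqrt u)) * ennreal (1 / (2 * sqrt u)))"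

lemma measurable_square_density [measurable]:
  assumes [measurable]: "f \<in> borel_measurable borel"
  shows "square_density f \<in> borel_measurable borel"
  unfolding square_density_def[abs_def] by measurable

lemma cone_integral_dim_1:
  assumes [measurable]: "f \<in> borel_measurable borel"
  shows "cone_integral 1 (\<lambda>x. f (x 0)) r = f r + f (- r)"
proof -
  have "cone_integral 1 (\<lambda>x. f (x 0)) r =
      (\<integral>\<^sup>+x. (if \<bar>x 0\<bar> \<le> 1 then f (r * x 0 / \<bar>x 0\<bar>) else 0) \<partial>Rn_lborel 1)"
    unfolding cone_integral_def
    by (intro nn_integral_cong) (auto simp: Rn_unit_ball_def radial_proj_def Rn_norm_def split: split_indicator)
  also have "\<dots> = (\<integral>\<^sup>+z. (if \<bar>z\<bar> \<le> 1 then f (r * z / \<bar>z\<bar>) else 0) \<partial>lborel)"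
    by (rule nn_integral_Rn_1) measurable
  also have "\<dots> = (\<integral>\<^sup>+(z::real). f r * indicator {0..1} z + f (- r) * indicator {-1..0} z \<partial>lborel)"
  proof (rule nn_integral_cong_AE)
    show "AE z in lborel. (if \<bar>z\<bar> \<le> 1 then f (r * z / \<bar>z\<bar>) else 0) = f r * indicator {0..1} z + f (- r) * indicator {-1..0} z"
      using AE_lborel_singleton[of "0::real"]
      by eventually_elim (auto split: split_indicator)
  qed
  also have "\<dots> = f r + f (- r)"
    by (subst nn_integral_add) (auto simp: nn_integral_cmult_indicator)
  finally show ?thesis .
qed

text \<open>
  This is polar integration in dimension one, where the sphere consists of two points.
\<close>

lemma nn_integral_square_density:
  assumes [measurable]: "f \<in> borel_measurable borel"
  shows "(\<integral>\<^sup>+u. square_density f u \<partial>lborel) = (\<integral>\<^sup>+v. f v \<partial>lborel)"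
proof -
  have "(\<integral>\<^sup>+v. f v \<partial>lborel) = (\<integral>\<^sup>+x. f (x 0) \<partial>Rn_lborel 1)"
    by (rule nn_integral_Rn_1[symmetric]) simp
  also have "\<dots> = (\<integral>\<^sup>+s. indicator {0<..} s * ennreal (real 1 / 2 * s powr (real 1 / 2 - 1)) *
       cone_integral 1 (\<lambda>x. f (x 0)) (sqrt s) \<partial>lborel)"
    by (rule nn_integral_polar) (auto intro: measurable_compose[OF measurable_Rn_component])
  also have "\<dots> = (\<integral>\<^sup>+u. square_density f u \<partial>lborel)"
  proof (rule nn_integral_cong)
    fix s :: real
    show "indicator {0<..} s * ennreal (real 1 / 2 * s powr (real 1 / 2 - 1)) *
       cone_integral 1 (\<lambda>x. f (x 0)) (sqrt s) = square_density f s"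
    proof (cases "s > 0")
      case True
      then have "real 1 / 2 * s powr (real 1 / 2 - 1) = 1 / (2 * sqrt s)"
        by (simp add: powr_minus_divide powr_half_sqrt)
      then show ?thesis
        by (simp only: cone_integral_dim_1[OF assms] square_density_def) (simp add: ac_simps)
    qed (simp add: square_density_def)
  qed
  finally show ?thesis ..
qed

text \<open>
  The density of the sum of the squares of independent variables with densities \<open>f 0, \<dots>, f (N - 1)\<close>,
  in terms of sphere integrals. Different factors are allowed because the null set argument below puts
  an indicator function into one slot.
\<close>

definition square_sum_density :: "nat \<Rightarrow> (nat \<Rightarrow> real \<Rightarrow> ennreal) \<Rightarrow> real \<Rightarrow> ennreal" where
  "square_sum_density N f u = indicator {0<..} u * ennreal (real N / 2 * u powr (real N / 2 - 1)) *
     cone_integral N (\<lambda>x. \<Prod>i<N. f i (x i)) (sqrt u)"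

lemma measurable_prod_Rn [measurable]:
  assumes [measurable]: "\<And>i. f i \<in> borel_measurable borel"
  shows "(\<lambda>x. \<Prod>i<N. f i (x i) :: ennreal) \<in> borel_measurable (Rn_lborel N)"
  by (intro borel_measurable_prod_ennreal measurable_compose[OF measurable_Rn_component]) auto

lemma measurable_square_sum_density [measurable]:
  assumes [measurable]: "\<And>i. f i \<in> borel_measurable borel"
  shows "square_sum_density N f \<in> borel_measurable borel"
  unfolding square_sum_density_def[abs_def] by measurable

lemma square_sum_density_1:
  assumes [measurable]: "\<And>i. f i \<in> borel_measurable borel"
  shows "square_sum_density 1 f = square_density (f 0)"
proof
  fix u :: real
  show "square_sum_density 1 f u = square_density (f 0) u"
  proof (cases "u > 0")
    case True
    then have "real 1 / 2 * u powr (real 1 / 2 - 1) = 1 / (2 * sqrt u)"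
      by (simp add: powr_minus_divide powr_half_sqrt)
    then show ?thesis
      using cone_integral_dim_1[of "f 0"]
      by (simp only: square_sum_density_def square_density_def) (simp add: ac_simps)
  qed (simp add: square_sum_density_def square_density_def)
qed

text \<open>
  Slicing by the hyperplanes on which the last coordinate is \<open>z\<close>. A slice of the ball is itself a ball,
  on which polar coordinates apply.
\<close>

lemma cone_integral_Suc:
  assumes "N > 0" and [measurable]: "\<And>i. f i \<in> borel_measurable borel"
  shows "cone_integral (Suc N) (\<lambda>x. \<Prod>i<Suc N. f i (x i)) r =
    (\<integral>\<^sup>+z. \<integral>\<^sup>+s. indicator {0<..} s * ennreal (real N / 2 * s powr (real N / 2 - 1)) *
       (indicator {..1} (s + z\<^sup>2) * f N (r * z / sqrt (s + z\<^sup>2)) *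
        cone_integral N (\<lambda>x. \<Prod>i<N. f i (x i)) (r * sqrt s / sqrt (s + z\<^sup>2))) \<partial>lborel \<partial>lborel)"
proof -
  define G where "G z x = indicator {..1} ((Rn_norm N x)\<^sup>2 + z\<^sup>2) *
    (f N (r * z / sqrt ((Rn_norm N x)\<^sup>2 + z\<^sup>2)) *
     (\<Prod>i<N. f i (r * x i / sqrt ((Rn_norm N x)\<^sup>2 + z\<^sup>2))))" for z :: real and x
  have G [measurable]: "G z \<in> borel_measurable (Rn_lborel N)" for z
  proof -
    have [measurable]: "(\<lambda>x. \<Prod>i<N. f i (r * x i / sqrt ((Rn_norm N x)\<^sup>2 + z\<^sup>2))) \<in> borel_measurable (Rn_lborel N)"
    proof (rule borel_measurable_prod_ennreal)
      fix i assume "i \<in> {..<N}"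
      then have [measurable]: "(\<lambda>x. x i) \<in> borel_measurable (Rn_lborel N)"
        by (intro measurable_Rn_component) simp
      have "(\<lambda>x. r * x i / sqrt ((Rn_norm N x)\<^sup>2 + z\<^sup>2)) \<in> borel_measurable (Rn_lborel N)"
        by measurable
      then show "(\<lambda>x. f i (r * x i / sqrt ((Rn_norm N x)\<^sup>2 + z\<^sup>2))) \<in> borel_measurable (Rn_lborel N)"
        by (rule measurable_compose[OF _ assms(2)])
    qed
    show ?thesis
      unfolding G_def[abs_def] by measurable
  qed
  have "cone_integral (Suc N) (\<lambda>x. \<Prod>i<Suc N. f i (x i)) r =
     (\<integral>\<^sup>+z. \<integral>\<^sup>+x. G z x \<partial>Rn_lborel N \<partial>lborel)"
    unfolding cone_integral_def
  proof (subst nn_integral_Rn_Suc, measurable, intro nn_integral_cong)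
    fix z :: real and x assume x: "x \<in> space (Rn_lborel N)"
    have sp: "x(N := z) \<in> space (Rn_lborel (Suc N))"
      using x by (auto simp: Rn_lborel_def space_PiM PiE_iff extensional_def)
    have "x(N := z) \<in> Rn_unit_ball (Suc N) \<longleftrightarrow> (Rn_norm N x)\<^sup>2 + z\<^sup>2 \<le> 1"
      using sp by (simp add: Rn_unit_ball_def Rn_norm_Suc)
    moreover have "(\<Prod>i<Suc N. f i (radial_proj (Suc N) r (x(N := z)) i)) =
       f N (r * z / sqrt ((Rn_norm N x)\<^sup>2 + z\<^sup>2)) *
       (\<Prod>i<N. f i (r * x i / sqrt ((Rn_norm N x)\<^sup>2 + z\<^sup>2)))"
      by (simp add: radial_proj_def Rn_norm_Suc mult.commute)
    ultimately show "indicator (Rn_unit_ball (Suc N)) (x(N := z)) *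
         (\<Prod>i<Suc N. f i (radial_proj (Suc N) r (x(N := z)) i)) = G z x"
      by (simp add: G_def split: split_indicator)
  qed
  also have "\<dots> = (\<integral>\<^sup>+z. \<integral>\<^sup>+s. indicator {0<..} s * ennreal (real N / 2 * s powr (real N / 2 - 1)) *
       cone_integral N (G z) (sqrt s) \<partial>lborel \<partial>lborel)"
    by (intro nn_integral_cong nn_integral_polar assms(1)) measurable
  also have "\<dots> = (\<integral>\<^sup>+z. \<integral>\<^sup>+s. indicator {0<..} s * ennreal (real N / 2 * s powr (real N / 2 - 1)) *
       (indicator {..1} (s + z\<^sup>2) * f N (r * z / sqrt (s + z\<^sup>2)) *
        cone_integral N (\<lambda>x. \<Prod>i<N. f i (x i)) (r * sqrt s / sqrt (s + z\<^sup>2))) \<partial>lborel \<partial>lborel)"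
  proof (intro nn_integral_cong)
    fix z s :: real
    show "indicator {0<..} s * ennreal (real N / 2 * s powr (real N / 2 - 1)) *
       cone_integral N (G z) (sqrt s) = indicator {0<..} s * ennreal (real N / 2 * s powr (real N / 2 - 1)) *
       (indicator {..1} (s + z\<^sup>2) * f N (r * z / sqrt (s + z\<^sup>2)) *
        cone_integral N (\<lambda>x. \<Prod>i<N. f i (x i)) (r * sqrt s / sqrt (s + z\<^sup>2)))"
    proof (cases "s > 0")
      case True
      have "cone_integral N (G z) (sqrt s) =
        (\<integral>\<^sup>+x. (indicator {..1} (s + z\<^sup>2) * f N (r * z / sqrt (s + z\<^sup>2))) *
          (indicator (Rn_unit_ball N) x *
           (\<Prod>i<N. f i (radial_proj N (r * sqrt s / sqrt (s + z\<^sup>2)) x i))) \<partial>Rn_lborel N)"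
        unfolding cone_integral_def
      proof (rule nn_integral_cong_AE, use AE_Rn_norm_pos[OF assms(1)] in eventually_elim)
        case (elim x)
        have n: "(Rn_norm N (radial_proj N (sqrt s) x))\<^sup>2 = s"
          using elim True by (simp add: Rn_norm_radial_proj)
        show ?case
          by (simp only: G_def n) (simp add: radial_proj_def ac_simps)
      qed
      also have "\<dots> = (indicator {..1} (s + z\<^sup>2) * f N (r * z / sqrt (s + z\<^sup>2))) *
         cone_integral N (\<lambda>x. \<Prod>i<N. f i (x i)) (r * sqrt s / sqrt (s + z\<^sup>2))"
        unfolding cone_integral_def by (rule nn_integral_cmult) measurable
      finally show ?thesis by simp
    qed simp
  qed
  finally show ?thesis .
qed

text \<open>
  The convolution equation for \<open>square_sum_density\<close>, at every point rather than almost everywhere. In the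
  slicing formula let \<open>w = z\<^sup>2\<close> and \<open>m = s + w\<close>; the arguments \<open>u s / m\<close> and \<open>u w / m\<close> of the two
  factors add up to \<open>u\<close>, and rescaling \<open>s\<close> separates off the integral of a power of \<open>m\<close>.
\<close>

theorem square_sum_density_Suc:
  assumes N: "N > 0" and [measurable]: "\<And>i. f i \<in> borel_measurable borel" and u: "u > 0"
  shows "square_sum_density (Suc N) f u =
    (\<integral>\<^sup>+s. square_sum_density N f s * square_density (f N) (u - s) \<partial>lborel)"
proof -
  define C where "C = cone_integral N (\<lambda>x. \<Prod>i<N. f i (x i))"
  define H where "H = square_sum_density N f"
  define h where "h = square_density (f N)"
  define a where "a = (real N - 3) / 2"
  have [measurable]: "C \<in> borel_measurable borel" "H \<in> borel_measurable borel" "h \<in> borel_measurable borel"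
    by (simp_all add: C_def H_def h_def)
  define K where "K z s = indicator {0<..} s * ennreal (real N / 2 * s powr (real N / 2 - 1)) *
       (indicator {..1} (s + z\<^sup>2) * f N (sqrt u * z / sqrt (s + z\<^sup>2)) * C (sqrt u * sqrt s / sqrt (s + z\<^sup>2)))"
    for z s :: real
  (* The integrand in the new variable m = s + z^2; the condition m > 0 excludes that both s and
     m - s are negative, in which case the ratio s / m would be positive. *)
  define J where "J m s = indicator {0<..1} m * ennreal ((m / u) powr a) * (H (u * s / m) * h (u - u * s / m))"
    for m s :: real
  have K [measurable]: "(\<lambda>(z, s). K z s) \<in> borel_measurable (borel \<Otimes>\<^sub>M borel)"
    unfolding K_def by measurable
  have J [measurable]: "(\<lambda>(m, s). J m s) \<in> borel_measurable (borel \<Otimes>\<^sub>M borel)"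
    unfolding J_def by measurable
  have "cone_integral (Suc N) (\<lambda>x. \<Prod>i<Suc N. f i (x i)) (sqrt u) = (\<integral>\<^sup>+z. \<integral>\<^sup>+s. K z s \<partial>lborel \<partial>lborel)"
    unfolding K_def C_def by (rule cone_integral_Suc) (use N in auto)
  also have "\<dots> = (\<integral>\<^sup>+w. square_density (\<lambda>z. \<integral>\<^sup>+s. K z s \<partial>lborel) w \<partial>lborel)"
    by (rule nn_integral_square_density[symmetric]) measurable
  also have "\<dots> = (\<integral>\<^sup>+w. \<integral>\<^sup>+s. J (s + w) s \<partial>lborel \<partial>lborel)"
  proof (rule nn_integral_cong)
    fix w :: real
    show "square_density (\<lambda>z. \<integral>\<^sup>+s. K z s \<partial>lborel) w = (\<integral>\<^sup>+s. J (s + w) s \<partial>lborel)"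
    proof (cases "w > 0")
      case True
      have "square_density (\<lambda>z. \<integral>\<^sup>+s. K z s \<partial>lborel) w =
          (\<integral>\<^sup>+s. (K (sqrt w) s + K (- sqrt w) s) * ennreal (1 / (2 * sqrt w)) \<partial>lborel)"
        using True by (simp add: square_density_def nn_integral_add nn_integral_multc)
      also have "\<dots> = (\<integral>\<^sup>+s. J (s + w) s \<partial>lborel)"
      proof (rule nn_integral_cong)
        fix s :: real
        show "(K (sqrt w) s + K (- sqrt w) s) * ennreal (1 / (2 * sqrt w)) = J (s + w) s"
        proof (cases "s > 0")
          case s: True
          define m where "m = s + w"
          have m: "m > 0" using s True by (simp add: m_def)
          have w_eq: "u - u * s / m = u * w / m"
            using m by (simp add: m_def field_simps)
          have h: "h (u - u * s / m) = (f N (sqrt u * sqrt w / sqrt m) + f N (- (sqrt u * sqrt w / sqrt m))) *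
              ennreal (1 / (2 * sqrt u * sqrt w / sqrt m))"
            using m u True unfolding w_eq
            by (simp add: h_def square_density_def real_sqrt_mult real_sqrt_divide mult.assoc)
          have H: "H (u * s / m) = ennreal (real N / 2 * (u * s / m) powr (real N / 2 - 1)) *
              C (sqrt u * sqrt s / sqrt m)"
            using m u s by (simp add: H_def C_def square_sum_density_def real_sqrt_mult real_sqrt_divide)
          have coeff: "real N / 2 * s powr (real N / 2 - 1) * (1 / (2 * sqrt w)) =
              (m / u) powr a * (real N / 2 * (u * s / m) powr (real N / 2 - 1)) * (1 / (2 * sqrt u * sqrt w / sqrt m))"
          proof -
            have "(u / m) powr (real N / 2 - 1) = (m / u) powr (1 - real N / 2)"
              using m u powr_minus_divide[of "m / u" "real N / 2 - 1"] by (simp add: powr_divide)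
            then have "(m / u) powr a * (u / m) powr (real N / 2 - 1) = (m / u) powr a * (m / u) powr (1 - real N / 2)"
              by simp
            also have "\<dots> = (m / u) powr (- (1 / 2))"
              using m u by (simp add: powr_add[symmetric] a_def field_simps)
            also have "\<dots> = sqrt u / sqrt m"
              using m u by (simp add: powr_minus_divide powr_half_sqrt real_sqrt_divide)
            finally have e: "(m / u) powr a * (u / m) powr (real N / 2 - 1) = sqrt u / sqrt m" .
            have "(u * s / m) powr (real N / 2 - 1) = (u / m) powr (real N / 2 - 1) * s powr (real N / 2 - 1)"
              using m u s by (subst powr_mult[symmetric]) (auto simp: field_simps)
            then have "(m / u) powr a * (u * s / m) powr (real N / 2 - 1) =
                sqrt u / sqrt m * s powr (real N / 2 - 1)"
              by (simp add: e[symmetric])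
            then have "(m / u) powr a * (real N / 2 * (u * s / m) powr (real N / 2 - 1)) * (1 / (2 * sqrt u * sqrt w / sqrt m))
               = real N / 2 * (sqrt u / sqrt m * s powr (real N / 2 - 1)) * (1 / (2 * sqrt u * sqrt w / sqrt m))"
              by (metis mult.left_commute)
            also have "\<dots> = real N / 2 * s powr (real N / 2 - 1) * (1 / (2 * sqrt w))"
              using m u True by (simp add: field_simps)
            finally show ?thesis ..
          qed
          define c where "c = ennreal (real N / 2 * s powr (real N / 2 - 1)) * ennreal (1 / (2 * sqrt w))"
          have c: "c = ennreal ((m / u) powr a) * (ennreal (real N / 2 * (u * s / m) powr (real N / 2 - 1)) *
               ennreal (1 / (2 * sqrt u * sqrt w / sqrt m)))"
            unfolding c_def
            by (rule ennreal_mult_eqI[symmetric]) (use coeff m u True in auto)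
          have "(K (sqrt w) s + K (- sqrt w) s) * ennreal (1 / (2 * sqrt w)) =
            indicator {..1} m * c * ((f N (sqrt u * sqrt w / sqrt m) + f N (- (sqrt u * sqrt w / sqrt m))) *
              C (sqrt u * sqrt s / sqrt m))"
            using s True by (simp add: K_def c_def m_def algebra_simps)
          also have "\<dots> = J m s"
            using m by (simp only: J_def h H c) (simp add: ac_simps split: split_indicator)
          finally show ?thesis by (simp add: m_def)
        next
          case False
          then have "K z s = 0" for z by (simp add: K_def)
          moreover have "J (s + w) s = 0"
          proof (cases "s + w > 0")
            case True
            then have "u * s / (s + w) \<le> 0" using False u by (simp add: divide_nonpos_pos mult_nonneg_nonpos)
            then show ?thesis by (simp add: J_def H_def square_sum_density_def)
          qed (simp add: J_def)
          ultimately show ?thesis by simp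
        qed
      qed
      finally show ?thesis .
    next
      case False
      have "J (s + w) s = 0" for s
      proof (cases "s + w > 0")
        case True
        then have "u - u * s / (s + w) = u * w / (s + w)" by (simp add: field_simps)
        also have "\<dots> \<le> 0" using False u True by (simp add: divide_nonpos_pos mult_nonneg_nonpos)
        finally show ?thesis by (simp add: J_def h_def square_density_def)
      qed (simp add: J_def)
      then show ?thesis using False by (simp add: square_density_def)
    qed
  qed
  also have "\<dots> = (\<integral>\<^sup>+s. \<integral>\<^sup>+w. J (s + w) s \<partial>lborel \<partial>lborel)"
    by (rule lborel_pair.Fubini') measurable
  also have "\<dots> = (\<integral>\<^sup>+s. \<integral>\<^sup>+m. J m s \<partial>lborel \<partial>lborel)"
  proof (rule nn_integral_cong)
    fix s :: real
    show "(\<integral>\<^sup>+w. J (s + w) s \<partial>lborel) = (\<integral>\<^sup>+m. J m s \<partial>lborel)"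
      using nn_integral_real_affine[of "\<lambda>m. J m s" 1 s] by simp
  qed
  also have "\<dots> = (\<integral>\<^sup>+m. \<integral>\<^sup>+s. J m s \<partial>lborel \<partial>lborel)"
    by (rule lborel_pair.Fubini') measurable
  also have "\<dots> = (\<integral>\<^sup>+m. indicator {0<..1} m * ennreal ((m / u) powr (a + 1)) *
      (\<integral>\<^sup>+s. H s * h (u - s) \<partial>lborel) \<partial>lborel)"
  proof (rule nn_integral_cong)
    fix m :: real
    show "(\<integral>\<^sup>+s. J m s \<partial>lborel) = indicator {0<..1} m * ennreal ((m / u) powr (a + 1)) *
      (\<integral>\<^sup>+s. H s * h (u - s) \<partial>lborel)"
    proof (cases "m > 0")
      case True
      have "(\<integral>\<^sup>+s. J m s \<partial>lborel) = ennreal (m / u) * (\<integral>\<^sup>+s. J m (m / u * s) \<partial>lborel)"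
        using nn_integral_real_affine[of "\<lambda>s. J m s" "m / u" 0] True u by simp
      also have "\<dots> = ennreal (m / u) * (\<integral>\<^sup>+s. indicator {0<..1} m * ennreal ((m / u) powr a) * (H s * h (u - s)) \<partial>lborel)"
        using True u by (simp add: J_def)
      also have "\<dots> = ennreal (m / u) * (indicator {0<..1} m * ennreal ((m / u) powr a) * (\<integral>\<^sup>+s. H s * h (u - s) \<partial>lborel))"
        by (subst nn_integral_cmult) auto
      also have "\<dots> = indicator {0<..1} m * (ennreal (m / u) * ennreal ((m / u) powr a)) * (\<integral>\<^sup>+s. H s * h (u - s) \<partial>lborel)"
        by (simp add: ac_simps)
      also have "ennreal (m / u) * ennreal ((m / u) powr a) = ennreal ((m / u) powr (a + 1))"
        using True u by (simp add: ennreal_mult[symmetric] powr_add mult.commute)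
      finally show ?thesis .
    qed (simp add: J_def)
  qed
  also have "\<dots> = (\<integral>\<^sup>+m. indicator {0<..1} m * ennreal ((m / u) powr (a + 1)) \<partial>lborel) *
      (\<integral>\<^sup>+s. H s * h (u - s) \<partial>lborel)"
    by (rule nn_integral_multc) measurable
  also have "(\<integral>\<^sup>+m. indicator {0<..1} m * ennreal ((m / u) powr (a + 1)) \<partial>lborel) =
      ennreal (2 / (real N + 1) * u powr (- (real N - 1) / 2))"
  proof -
    have b: "a + 1 = (real N - 1) / 2" by (simp add: a_def field_simps)
    have "(\<integral>\<^sup>+m. indicator {0<..1} m * ennreal ((m / u) powr (a + 1)) \<partial>lborel) =
      (\<integral>\<^sup>+m. ennreal (u powr (- (a + 1))) * (ennreal (m powr (a + 1)) * indicator {0..1} m) \<partial>lborel)"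
    proof (rule nn_integral_cong_AE)
      show "AE m in lborel. indicator {0<..1} m * ennreal ((m / u) powr (a + 1)) =
        ennreal (u powr (- (a + 1))) * (ennreal (m powr (a + 1)) * indicator {0..1} m)"
        using AE_lborel_singleton[of "0::real"]
      proof eventually_elim
        case (elim m)
        have "(m / u) powr (a + 1) = u powr (- (a + 1)) * m powr (a + 1)" if "m > 0"
          using that u by (subst powr_minus_divide) (simp add: powr_divide)
        then have "ennreal ((m / u) powr (a + 1)) = ennreal (u powr (- (a + 1))) * ennreal (m powr (a + 1))" if "m > 0"
          using that by (simp only: ennreal_mult'[OF powr_ge_zero])
        then show ?case using elim by (auto split: split_indicator)
      qed
    qed
    also have "\<dots> = ennreal (u powr (- (a + 1))) * (\<integral>\<^sup>+m. ennreal (m powr (a + 1)) * indicator {0..1} m \<partial>lborel)"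
      by (rule nn_integral_cmult) measurable
    also have "(\<integral>\<^sup>+m. ennreal (m powr (a + 1)) * indicator {0..1::real} m \<partial>lborel) = ennreal (2 / (real N + 1))"
    proof (rule nn_integral_has_integral_lebesgue')
      have "((\<lambda>m. m powr (a + 1)) has_integral 1 powr (a + 1 + 1) / (a + 1 + 1)) {0..1}"
        by (rule has_integral_powr_from_0) (use N in \<open>auto simp: a_def field_simps\<close>)
      moreover have "1 powr (a + 1 + 1) / (a + 1 + 1) = 2 / (real N + 1)"
        by (simp add: a_def field_simps)
      ultimately show "((\<lambda>m. m powr (a + 1)) has_integral 2 / (real N + 1)) {0..1}"
        by (simp only:)
    qed simp
    also have "ennreal (u powr (- (a + 1))) * ennreal (2 / (real N + 1)) = ennreal (2 / (real N + 1) * u powr (- (real N - 1) / 2))"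
      unfolding b minus_divide_left by (simp add: ennreal_mult[symmetric] mult.commute)
    finally show ?thesis .
  qed
  finally have cone: "cone_integral (Suc N) (\<lambda>x. \<Prod>i<Suc N. f i (x i)) (sqrt u) =
     ennreal (2 / (real N + 1) * u powr (- (real N - 1) / 2)) * (\<integral>\<^sup>+s. H s * h (u - s) \<partial>lborel)" .
  have "real (Suc N) / 2 * u powr (real (Suc N) / 2 - 1) * (2 / (real N + 1) * u powr (- (real N - 1) / 2)) = 1"
  proof -
    have "u powr (real (Suc N) / 2 - 1) * u powr (- (real N - 1) / 2) = 1"
      using u by (simp add: powr_add[symmetric] field_simps)
    then show ?thesis by (simp add: field_simps)
  qed
  then have "ennreal (real (Suc N) / 2 * u powr (real (Suc N) / 2 - 1)) *
      ennreal (2 / (real N + 1) * u powr (- (real N - 1) / 2)) = 1"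
    by (subst ennreal_mult[symmetric]) auto
  then have "ennreal (real (Suc N) / 2 * u powr (real (Suc N) / 2 - 1)) *
      (ennreal (2 / (real N + 1) * u powr (- (real N - 1) / 2)) * (\<integral>\<^sup>+s. H s * h (u - s) \<partial>lborel)) =
      (\<integral>\<^sup>+s. H s * h (u - s) \<partial>lborel)"
    by (simp only: mult.assoc[symmetric] mult_1)
  then show ?thesis
    using u by (simp only: square_sum_density_def[of "Suc N"] cone H_def h_def) simp
qed

section \<open>Sphere integrals of tensor products\<close>

text \<open>
  A convolution vanishes everywhere as soon as one factor vanishes almost everywhere; this is what upgrades
  null sets of the line to null sets of each individual sphere.
\<close>

lemma square_sum_density_Suc_eq_0:
  assumes [measurable]: "\<And>i. f i \<in> borel_measurable borel" and "N \<ge> 1"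
    and null: "(AE s in lborel. square_sum_density N f s = 0) \<or> (AE v in lborel. f N v = 0)"
  shows "square_sum_density (Suc N) f u = 0"
proof (cases "u > 0")
  case True
  have "AE s in lborel. square_sum_density N f s * square_density (f N) (u - s) = 0"
    using null
  proof
    assume "AE v in lborel. f N v = 0"
    then have "(\<integral>\<^sup>+w. square_density (f N) w \<partial>lborel) = 0"
      by (subst nn_integral_square_density) (auto simp: nn_integral_0_iff_AE)
    then have "AE w in lborel. square_density (f N) w = 0"
      by (simp add: nn_integral_0_iff_AE)
    then have "AE s in lborel. square_density (f N) (u + (- 1) * s) = 0"
      by (intro AE_borel_affine) auto
    then show ?thesis by eventually_elim simp
  qed auto
  then show ?thesis
    using assms(2) True by (subst square_sum_density_Suc) (auto simp: nn_integral_0_iff_AE)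
qed (simp add: square_sum_density_def)

lemma AE_square_sum_density_eq_0:
  assumes [measurable]: "\<And>i. f i \<in> borel_measurable borel"
    and "N \<ge> 1" "j < N" "AE v in lborel. f j v = 0"
  shows "AE u in lborel. square_sum_density N f u = 0"
  using assms(2-)
proof (induction N rule: dec_induct)
  case base
  then have "(\<integral>\<^sup>+u. square_density (f 0) u \<partial>lborel) = 0"
    by (subst nn_integral_square_density) (auto simp: nn_integral_0_iff_AE)
  then show ?case
    by (simp add: square_sum_density_1[unfolded One_nat_def] nn_integral_0_iff_AE)
next
  case (step N)
  have "(AE s in lborel. square_sum_density N f s = 0) \<or> (AE v in lborel. f N v = 0)"
  proof (cases "j = N")
    case False
    then have "j < N" using step.prems by simp
    then show ?thesis using step.IH step.prems by simp
  qed (use step.prems in simp)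
  then show ?case
    by (intro AE_I2 square_sum_density_Suc_eq_0) (use step in auto)
qed

definition unit_ball_volume :: "nat \<Rightarrow> real" where
  "unit_ball_volume N = measure (Rn_lborel N) (Rn_unit_ball N)"

lemma unit_ball_volume:
  "unit_ball_volume N > 0" "emeasure (Rn_lborel N) (Rn_unit_ball N) = ennreal (unit_ball_volume N)"
proof -
  show e: "emeasure (Rn_lborel N) (Rn_unit_ball N) = ennreal (unit_ball_volume N)"
    unfolding unit_ball_volume_def using emeasure_Rn_unit_ball(2)[of N]
    by (intro emeasure_eq_ennreal_measure) auto
  show "unit_ball_volume N > 0"
    using emeasure_Rn_unit_ball(1)[of N] by (simp add: e ennreal_eq_0_iff not_le)
qed

definition sphere_borel_measure :: "nat \<Rightarrow> real \<Rightarrow> (nat \<Rightarrow> real) measure" where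
  "sphere_borel_measure N r =
     distr (uniform_measure (Rn_lborel N) (Rn_unit_ball N)) (Rn_lborel N) (radial_proj N r)"

lemma sets_sphere_borel_measure [measurable_cong]: "sets (sphere_borel_measure N r) = sets (Rn_lborel N)"
  by (simp add: sphere_borel_measure_def)

lemma nn_integral_sphere_borel_measure:
  assumes [measurable]: "F \<in> borel_measurable (Rn_lborel N)"
  shows "(\<integral>\<^sup>+x. F x \<partial>sphere_borel_measure N r) = cone_integral N F r / ennreal (unit_ball_volume N)"
proof -
  have "(\<integral>\<^sup>+x. F x \<partial>sphere_borel_measure N r) =
      (\<integral>\<^sup>+x. F (radial_proj N r x) \<partial>uniform_measure (Rn_lborel N) (Rn_unit_ball N))"
    unfolding sphere_borel_measure_def by (rule nn_integral_distr) auto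
  also have "\<dots> = (\<integral>\<^sup>+x. F (radial_proj N r x) * indicator (Rn_unit_ball N) x \<partial>Rn_lborel N) / emeasure (Rn_lborel N) (Rn_unit_ball N)"
    by (rule nn_integral_uniform_measure) measurable
  finally show ?thesis
    by (simp add: cone_integral_def unit_ball_volume(2) mult.commute)
qed

text \<open>
  The density of \<open>|x|\<^sup>2\<close> under Lebesgue measure on \<open>\<real>\<^sup>N\<close>, that is, the area of the sphere of radius \<open>\<surd>u\<close>
  divided by \<open>2 \<surd>u\<close>.
\<close>

definition square_norm_density :: "nat \<Rightarrow> real \<Rightarrow> real" where
  "square_norm_density N u = real N / 2 * u powr (real N / 2 - 1) * unit_ball_volume N"

lemma square_norm_density_pos: "N > 0 \<Longrightarrow> u > 0 \<Longrightarrow> square_norm_density N u > 0"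
  using unit_ball_volume(1)[of N] by (simp add: square_norm_density_def)

lemma nn_integral_prod_sphere:
  assumes [measurable]: "\<And>i. f i \<in> borel_measurable borel" and "N > 0" "r > 0"
  shows "ennreal (square_norm_density N (r\<^sup>2)) * (\<integral>\<^sup>+x. (\<Prod>i<N. f i (x i)) \<partial>sphere_borel_measure N r) = square_sum_density N f (r\<^sup>2)"
proof -
  let ?V = "unit_ball_volume N" and ?c = "real N / 2 * (r\<^sup>2) powr (real N / 2 - 1)"
  let ?C = "cone_integral N (\<lambda>x. \<Prod>i<N. f i (x i)) r"
  have "ennreal ?V * (?C / ennreal ?V) = ?C"
    using unit_ball_volume(1)[of N] unfolding ennreal_times_divide mult.commute[of "ennreal ?V"]
    by (intro ennreal_mult_divide_eq) (auto simp: ennreal_eq_0_iff)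
  then have "ennreal ?c * (ennreal ?V * (?C / ennreal ?V)) = ennreal ?c * ?C"
    by simp
  moreover have "ennreal (square_norm_density N (r\<^sup>2)) = ennreal ?c * ennreal ?V"
    unfolding square_norm_density_def using unit_ball_volume(1)[of N] by (intro ennreal_mult) auto
  ultimately show ?thesis
    using assms(2,3)
    by (simp add: nn_integral_sphere_borel_measure square_sum_density_def mult.assoc)
qed

text \<open>
  The marginals of the uniform distribution on the sphere are absolutely continuous. In dimension one this
  fails, the sphere being two points.
\<close>

lemma AE_sphere_coordinate_notin:
  assumes N: "N \<ge> 2" and r: "r > 0" and i: "i < N" and A: "A \<in> null_sets lborel"
  shows "AE x in sphere_borel_measure N r. x i \<notin> A"
proof -
  have [measurable]: "A \<in> sets borel" using A by (auto simp: null_sets_def)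
  (* The product of these functions is the indicator of the event in question. *)
  define f :: "nat \<Rightarrow> real \<Rightarrow> ennreal" where "f j = (if j = i then indicator A else (\<lambda>_. 1))" for j
  have f [measurable]: "f j \<in> borel_measurable borel" for j by (simp add: f_def)
  obtain M where M: "N = Suc M" "M \<ge> 1" using N by (cases N) auto
  have nullf: "AE v in lborel. f i v = 0"
    using AE_not_in[OF A] by eventually_elim (simp add: f_def)
  have "square_sum_density N f (r\<^sup>2) = 0"
  proof (cases "i = M")
    case True
    then show ?thesis unfolding M(1) using nullf M by (intro square_sum_density_Suc_eq_0) auto
  next
    case False
    then show ?thesis unfolding M(1)
      using nullf M i by (intro square_sum_density_Suc_eq_0 disjI1 AE_square_sum_density_eq_0[of _ _ i]) auto
  qed
  then have "(\<integral>\<^sup>+x. (\<Prod>j<N. f j (x j)) \<partial>sphere_borel_measure N r) = 0"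
    using nn_integral_prod_sphere[of f N r] square_norm_density_pos[of N "r\<^sup>2"] r N
    by (auto simp: ennreal_eq_0_iff)
  then have "AE x in sphere_borel_measure N r. (\<Prod>j<N. f j (x j)) = 0"
    by (subst (asm) nn_integral_0_iff_AE) measurable
  then show ?thesis
  proof eventually_elim
    case (elim x)
    show ?case
    proof
      assume "x i \<in> A"
      then have "(\<Prod>j<N. f j (x j)) = 1" by (intro prod.neutral) (auto simp: f_def)
      with elim show False by simp
    qed
  qed
qed

lemma measurable_completion_AE_eq:
  assumes f: "f \<in> borel_measurable M" and eq: "AE x in M. g x = f x"
  shows "g \<in> borel_measurable (completion M)"
proof (rule measurableI)
  fix S :: "'b set" assume "S \<in> sets borel"
  then have "Measurable.pred (completion M) (\<lambda>x. f x \<in> S)"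
    using measurable_completion[OF f] by simp
  moreover have "Measurable.pred (completion M) (\<lambda>x. (f x \<in> S) \<noteq> (g x \<in> S))"
    by (rule sets_completion_AE) (use eq in eventually_elim, simp)
  ultimately have "Measurable.pred (completion M) (\<lambda>x. (f x \<in> S) \<noteq> ((f x \<in> S) \<noteq> (g x \<in> S)))"
    by measurable
  moreover have "(\<lambda>x. (f x \<in> S) \<noteq> ((f x \<in> S) \<noteq> (g x \<in> S))) = (\<lambda>x. g x \<in> S)" by auto
  ultimately have "Measurable.pred (completion M) (\<lambda>x. g x \<in> S)" by simp
  then show "g -` S \<inter> space (completion M) \<in> sets (completion M)"
    by (simp add: pred_def vimage_def Int_def conj_commute)
qed simp

text \<open>
  Any finite value of \<open>square_sum_density\<close> for a Borel representative \<open>f0\<close> determines the sphere integral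
  of every modification \<open>g\<close> of it: the products differ only at points with a coordinate in a null set.
\<close>

lemma tensor_power_sphere:
  assumes N: "N \<ge> 2" and r: "r > 0" and f0 [measurable]: "f0 \<in> borel_measurable borel" and f0_nonneg: "\<And>v. 0 \<le> f0 v"
    and d: "square_sum_density N (\<lambda>_ v. ennreal (f0 v)) (r\<^sup>2) = ennreal d" "0 \<le> d"
    and g: "AE v in lebesgue. g v = f0 v"
  shows "integrable (sphere_measure N r) (tensor_power N g)" "Z N g r = d / square_norm_density N (r\<^sup>2)"
proof -
  let ?S = "sphere_borel_measure N r" and ?a = "square_norm_density N (r\<^sup>2)"
  have S: "sphere_measure N r = completion ?S"
    by (simp add: sphere_measure_def sphere_borel_measure_def)
  have a: "?a > 0" using square_norm_density_pos N r by simp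
  have m [measurable]: "tensor_power N f0 \<in> borel_measurable (Rn_lborel N)"
    unfolding tensor_power_def[abs_def]
    by (intro borel_measurable_prod measurable_compose[OF measurable_Rn_component f0]) auto
  have t0: "0 \<le> tensor_power N f0 x" for x
    unfolding tensor_power_def by (intro prod_nonneg) (simp add: f0_nonneg)
  have "ennreal ?a * (\<integral>\<^sup>+x. ennreal (tensor_power N f0 x) \<partial>?S) = ennreal d"
    using nn_integral_prod_sphere[of "\<lambda>_ v. ennreal (f0 v)" N r] N r d
    by (simp add: tensor_power_def prod_ennreal f0_nonneg)
  moreover have "ennreal ?a * ennreal (d / ?a) = ennreal d"
    using a d by (simp add: ennreal_mult[symmetric])
  ultimately have "ennreal ?a * (\<integral>\<^sup>+x. ennreal (tensor_power N f0 x) \<partial>?S) = ennreal ?a * ennreal (d / ?a)"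
    by simp
  then have nn: "(\<integral>\<^sup>+x. ennreal (tensor_power N f0 x) \<partial>?S) = ennreal (d / ?a)"
    using a by (subst (asm) ennreal_mult_cancel_left) (auto simp: ennreal_eq_0_iff)
  have int: "integrable ?S (tensor_power N f0)"
    by (rule integrableI_nonneg) (use t0 nn in auto)
  have val: "(\<integral>x. tensor_power N f0 x \<partial>?S) = d / ?a"
    using t0 nn a d by (intro integral_eq_nn_integral[THEN trans]) auto
  have "AE v in lborel. g v = f0 v" using g by (simp add: AE_completion_iff)
  then obtain A where A: "A \<in> null_sets lborel" "{v \<in> space lborel. \<not> g v = f0 v} \<subseteq> A"
    by (auto elim!: AE_E simp: null_sets_def)
  have "AE x in ?S. \<forall>i<N. x i \<notin> A"
    using AE_sphere_coordinate_notin[OF N r _ A(1)] by (simp add: AE_all_countable)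
  then have eq: "AE x in ?S. tensor_power N g x = tensor_power N f0 x"
  proof eventually_elim
    case (elim x)
    then show ?case unfolding tensor_power_def using A(2) by (intro prod.cong) auto
  qed
  have meas: "tensor_power N g \<in> borel_measurable (completion ?S)"
    by (rule measurable_completion_AE_eq[OF _ eq]) measurable
  have m': "tensor_power N f0 \<in> borel_measurable ?S" by measurable
  have "integrable (completion ?S) (tensor_power N g) \<longleftrightarrow> integrable (completion ?S) (tensor_power N f0)"
    using meas measurable_completion[OF m'] AE_completion[OF eq] by (intro integrable_cong_AE)
  then show "integrable (sphere_measure N r) (tensor_power N g)"
    using int by (simp add: S integrable_completion[OF m'])
  have "Z N g r = (\<integral>x. tensor_power N f0 x \<partial>completion ?S)"
    unfolding Z_def S using meas measurable_completion[OF m'] AE_completion[OF eq] by (intro integral_cong_AE)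
  then show "Z N g r = d / ?a" by (simp add: integral_completion[OF m'] val)
qed

section \<open>Fourier transforms\<close>

text \<open>
  The unnormalised transform with the sign convention of characteristic functions. The kernel is
  symmetric in its two variables, which gives the multiplication formula its simple form.
\<close>

definition fourier :: "(real \<Rightarrow> complex) \<Rightarrow> real \<Rightarrow> complex" where
  "fourier k t = (\<integral>x. k x * iexp (t * x) \<partial>lborel)"

lemma integrable_mult_iexp:
  assumes "integrable lborel k"
  shows "integrable lborel (\<lambda>x. k x * iexp (t * x))"
proof (rule Bochner_Integration.integrable_bound[OF assms])
  show "(\<lambda>x. k x * iexp (t * x)) \<in> borel_measurable lborel"
    using borel_measurable_integrable[OF assms] by measurable
qed (simp add: norm_mult)

lemma norm_fourier_le:
  assumes "integrable lborel k"
  shows "norm (fourier k t) \<le> (\<integral>x. norm (k x) \<partial>lborel)"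
proof -
  have "norm (fourier k t) \<le> (\<integral>x. norm (k x * iexp (t * x)) \<partial>lborel)"
    unfolding fourier_def by (rule integral_norm_bound)
  then show ?thesis by (simp add: norm_mult)
qed

lemma measurable_fourier [measurable]:
  assumes [measurable]: "k \<in> borel_measurable borel"
  shows "fourier k \<in> borel_measurable borel"
proof -
  have "(\<lambda>t. \<integral>x. (case (t, x) of (t, x) \<Rightarrow> k x * iexp (t * x)) \<partial>lborel) \<in> borel_measurable borel"
    by (rule lborel.borel_measurable_lebesgue_integral) measurable
  then show ?thesis by (simp add: fourier_def[abs_def])
qed

lemma fourier_diff:
  assumes "integrable lborel k" "integrable lborel l"
  shows "fourier (\<lambda>x. k x - l x) t = fourier k t - fourier l t"
  unfolding fourier_def left_diff_distrib
  by (intro Bochner_Integration.integral_diff integrable_mult_iexp assms)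

lemma fourier_modulate: "fourier (\<lambda>x. k x * iexp (s * x)) t = fourier k (s + t)"
  by (simp add: fourier_def mult.assoc exp_add[symmetric] ring_distribs)

lemma fourier_reflect: "fourier (\<lambda>x. k (- x)) t = fourier k (- t)"
  unfolding fourier_def
  by (subst lborel_integral_real_affine[where c = "-1" and t = 0]) auto

lemma measurable_cnj [measurable]: "cnj \<in> borel_measurable borel"
  by (intro borel_measurable_continuous_onI continuous_intros)

lemma cnj_fourier: "cnj (fourier (\<lambda>x. complex_of_real (k x)) t) = fourier (\<lambda>x. of_real (k x)) (- t)"
proof -
  have "cnj (complex_of_real (k x) * iexp (t * x)) = of_real (k x) * iexp (- t * x)" for x
    by (simp add: exp_cnj)
  then show ?thesis
    unfolding fourier_def by (simp only: Bochner_Integration.integral_cnj[symmetric])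
qed

lemma fourier_multiplication_formula:
  assumes a: "integrable lborel a" and k: "integrable lborel k"
  shows "(\<integral>t. a t * fourier k t \<partial>lborel) = (\<integral>x. fourier a x * k x \<partial>lborel)"
proof -
  note [measurable] = borel_measurable_integrable[OF a] borel_measurable_integrable[OF k]
  have int: "integrable (lborel \<Otimes>\<^sub>M lborel) (\<lambda>(t, x). a t * (k x * iexp (t * x)))"
  proof (rule lborel_pair.Fubini_integrable)
    have "(\<integral>x. norm (a t * (k x * iexp (t * x))) \<partial>lborel) = norm (a t) * (\<integral>x. norm (k x) \<partial>lborel)" for t
      by (simp add: norm_mult)
    then show "integrable lborel (\<lambda>t. \<integral>x. norm (case (t, x) of (t, x) \<Rightarrow> a t * (k x * iexp (t * x))) \<partial>lborel)"
      using integrable_norm[OF a] by simp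
    show "AE t in lborel. integrable lborel (\<lambda>x. case (t, x) of (t, x) \<Rightarrow> a t * (k x * iexp (t * x)))"
      using integrable_mult_iexp[OF k] by auto
  qed measurable
  have "(\<integral>t. a t * fourier k t \<partial>lborel) = (\<integral>t. \<integral>x. a t * (k x * iexp (t * x)) \<partial>lborel \<partial>lborel)"
    by (simp add: fourier_def)
  also have "\<dots> = (\<integral>x. \<integral>t. a t * (k x * iexp (t * x)) \<partial>lborel \<partial>lborel)"
    by (rule lborel_pair.Fubini_integral[symmetric]) (rule int)
  also have "\<dots> = (\<integral>x. fourier a x * k x \<partial>lborel)"
  proof (rule Bochner_Integration.integral_cong[OF refl])
    fix x
    have "(\<integral>t. a t * (k x * iexp (t * x)) \<partial>lborel) = (\<integral>t. (a t * iexp (x * t)) * k x \<partial>lborel)"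
      by (intro Bochner_Integration.integral_cong) (auto simp: ac_simps)
    then show "(\<integral>t. a t * (k x * iexp (t * x)) \<partial>lborel) = fourier a x * k x"
      by (simp add: fourier_def)
  qed
  finally show ?thesis .
qed

definition gauss_weight :: "real \<Rightarrow> real \<Rightarrow> real" where
  "gauss_weight c t = exp (- (t / c)\<^sup>2 / 2)"

lemma gauss_weight_eq_density:
  "gauss_weight c t = sqrt (2 * pi) * std_normal_density (t / c)"
  by (simp add: gauss_weight_def std_normal_density_def real_sqrt_mult)

lemma measurable_gauss_weight [measurable]: "gauss_weight c \<in> borel_measurable borel"
  unfolding gauss_weight_def[abs_def] by measurable

lemma gauss_weight_tendsto_1: "(\<lambda>n. gauss_weight (real (Suc n)) t) \<longlonglongrightarrow> 1"
proof -
  have "(\<lambda>n. exp (- (t / real (Suc n))\<^sup>2 / 2)) \<longlonglongrightarrow> exp (- 0\<^sup>2 / 2)"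
    by (intro tendsto_intros LIMSEQ_Suc[OF lim_const_over_n]) simp
  then show ?thesis by (simp add: gauss_weight_def)
qed

lemma integrable_gauss_weight:
  assumes "c > 0"
  shows "integrable lborel (gauss_weight c)"
proof -
  have "integrable lborel (\<lambda>t. std_normal_density (0 + (1 / c) * t))"
    by (rule lborel_integrable_real_affine) (use assms in auto)
  then show ?thesis by (simp add: gauss_weight_eq_density[abs_def])
qed

lemma fourier_gauss_weight:
  assumes c: "c > 0"
  shows "fourier (\<lambda>t. of_real (gauss_weight c t)) x = of_real (2 * pi * normal_density 0 (1 / c) x)"
proof -
  have "fourier (\<lambda>t. of_real (gauss_weight c t)) x =
     c *\<^sub>R (\<integral>s. of_real (gauss_weight c (c * s)) * iexp (x * (c * s)) \<partial>lborel)"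
    unfolding fourier_def using c
    by (subst lborel_integral_real_affine[where c = c and t = 0]) auto
  also have "(\<integral>s. of_real (gauss_weight c (c * s)) * iexp (x * (c * s)) \<partial>lborel) =
     (\<integral>s. of_real (sqrt (2 * pi)) * (std_normal_density s *\<^sub>R iexp ((x * c) * s)) \<partial>lborel)"
    using c by (intro Bochner_Integration.integral_cong)
      (auto simp: gauss_weight_eq_density scaleR_conv_of_real mult.assoc)
  also have "\<dots> = of_real (sqrt (2 * pi)) * (\<integral>s. std_normal_density s *\<^sub>R iexp ((x * c) * s) \<partial>lborel)"
    by (rule integral_mult_right_zero)
  also have "\<dots> = of_real (sqrt (2 * pi)) * char std_normal_distribution (x * c)"
    unfolding char_def by (subst integral_density) auto
  also have "\<dots> = of_real (sqrt (2 * pi) * exp (- (x * c)\<^sup>2 / 2))"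
    by (simp add: char_std_normal_distribution)
  also have "c *\<^sub>R \<dots> = of_real (2 * pi * normal_density 0 (1 / c) x)"
  proof -
    have "2 * pi * normal_density 0 (1 / c) x = 2 * pi * (c / sqrt (2 * pi) * exp (- (x * c)\<^sup>2 / 2))"
      using c by (simp add: normal_density_def real_sqrt_divide power_divide power_mult_distrib)
    also have "\<dots> = c * (sqrt (2 * pi) * exp (- (x * c)\<^sup>2 / 2))"
      using real_div_sqrt[of "2 * pi"] by (simp add: field_simps)
    finally show ?thesis by (simp add: scaleR_conv_of_real)
  qed
  finally show ?thesis .
qed

text \<open>
  Damping the transform by a wide Gaussian amounts to convolving with a narrow one; both the Plancherel
  bound and the inversion formula are obtained by letting \<open>c\<close> tend to infinity.
\<close>

lemma smoothing_identity:
  assumes c: "c > 0" and k: "integrable lborel (k :: real \<Rightarrow> complex)"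
  shows "(\<integral>t. of_real (gauss_weight c t) * iexp (- x * t) * fourier k t \<partial>lborel) =
     (\<integral>y. of_real (2 * pi * normal_density 0 (1 / c) (y - x)) * k y \<partial>lborel)"
proof -
  have w: "integrable lborel (\<lambda>t. complex_of_real (gauss_weight c t))"
    using integrable_gauss_weight[OF c] by simp
  have "(\<integral>t. of_real (gauss_weight c t) * iexp (- x * t) * fourier k t \<partial>lborel) =
     (\<integral>y. fourier (\<lambda>t. of_real (gauss_weight c t) * iexp (- x * t)) y * k y \<partial>lborel)"
    by (rule fourier_multiplication_formula[OF integrable_mult_iexp[OF w] k])
  also have "\<dots> = (\<integral>y. of_real (2 * pi * normal_density 0 (1 / c) (y - x)) * k y \<partial>lborel)"
    unfolding fourier_modulate fourier_gauss_weight[OF c] by simp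
  finally show ?thesis .
qed

lemma norm_smoothing_le:
  assumes c: "c > 0" and k: "integrable lborel k" and k0: "\<And>x. 0 \<le> k x" and B: "\<And>x. k x \<le> B"
  shows "norm (\<integral>y. complex_of_real (2 * pi * normal_density 0 (1 / c) (y - x)) * of_real (k y) \<partial>lborel) \<le> 2 * pi * B"
proof -
  have nd: "integrable lborel (\<lambda>y. normal_density 0 (1 / c) (y - x))"
    using lborel_integrable_real_affine[of "normal_density 0 (1 / c)" 1 "- x"] c by simp
  have "0 \<le> B" using k0 B order_trans by blast
  have "norm (\<integral>y. complex_of_real (2 * pi * normal_density 0 (1 / c) (y - x)) * of_real (k y) \<partial>lborel)
     \<le> (\<integral>y. 2 * pi * normal_density 0 (1 / c) (y - x) * B \<partial>lborel)"
  proof (rule Bochner_Integration.integral_norm_bound_integral)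
    show "integrable lborel (\<lambda>y. 2 * pi * normal_density 0 (1 / c) (y - x) * B)"
      using nd by simp
    then show "integrable lborel (\<lambda>y. complex_of_real (2 * pi * normal_density 0 (1 / c) (y - x)) * of_real (k y))"
      by (rule Bochner_Integration.integrable_bound)
        (use borel_measurable_integrable[OF k] c k0 B \<open>0 \<le> B\<close> in \<open>auto simp: norm_mult abs_mult intro!: mult_left_mono\<close>)
    show "norm (complex_of_real (2 * pi * normal_density 0 (1 / c) (y - x)) * of_real (k y)) \<le> 2 * pi * normal_density 0 (1 / c) (y - x) * B" for y
      using c k0 B by (auto simp: norm_mult abs_mult intro!: mult_left_mono)
  qed
  also have "\<dots> = 2 * pi * B * (\<integral>y. normal_density 0 (1 / c) (y - x) \<partial>lborel)"
    by simp
  also have "(\<integral>y. normal_density 0 (1 / c) (y - x) \<partial>lborel) = 1"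
    using lborel_integral_real_affine[of 1 "normal_density 0 (1 / c)" "- x"] c by simp
  finally show ?thesis by simp
qed

text \<open>
  For a bounded subprobability density, Plancherel's inequality. Against a Gaussian weight, \<open>|\<phi>|\<^sup>2\<close> integrates
  to the pairing of \<open>k\<close> with a smoothed version of \<open>k\<close>, and smoothing preserves the upper bound \<open>B\<close>.
\<close>

lemma plancherel_bound:
  assumes k: "integrable lborel k" and k0: "\<And>x. 0 \<le> k x" and B: "\<And>x. k x \<le> B"
    and k1: "(\<integral>x. k x \<partial>lborel) \<le> 1"
  shows "(\<integral>\<^sup>+t. ennreal ((norm (fourier (\<lambda>x. of_real (k x)) t))\<^sup>2) \<partial>lborel) \<le> ennreal (2 * pi * B)"
proof -
  define K where "K = (\<lambda>x. complex_of_real (k x))"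
  (* The weights exhaust the line, so that the bound passes to the limit by Fatou's lemma. *)
  define W where "W n = gauss_weight (real (Suc n))" for n
  note [measurable] = borel_measurable_integrable[OF k]
  have K: "integrable lborel K" using k by (simp add: K_def)
  have B0: "0 \<le> B" using k0 B order_trans by blast
  have le1: "norm (fourier K t) \<le> 1" for t
    using norm_fourier_le[OF K, of t] k1 k0 by (simp add: K_def)
  have W0: "0 \<le> W n t" for n t by (simp add: W_def gauss_weight_def)
  have bound: "(\<integral>\<^sup>+t. ennreal (W n t * (norm (fourier K t))\<^sup>2) \<partial>lborel) \<le> ennreal (2 * pi * B)" for n
  proof -
    define c where "c = real (Suc n)"
    have c: "c > 0" by (simp add: c_def)
    have Wi: "integrable lborel (W n)" using integrable_gauss_weight[OF c] by (simp add: W_def c_def)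
    define a where "a t = of_real (W n t) * cnj (fourier K t)" for t
    have a: "integrable lborel a"
    proof (rule Bochner_Integration.integrable_bound[OF Wi])
      show "a \<in> borel_measurable lborel" unfolding a_def[abs_def] W_def K_def by measurable
      show "AE t in lborel. norm (a t) \<le> norm (W n t)"
        using le1 W0 by (auto simp: a_def norm_mult intro!: mult_left_le)
    qed
    have fa: "norm (fourier a x) \<le> 2 * pi * B" for x
    proof -
      have refl: "a (- t) = of_real (gauss_weight c t) * fourier K t" for t
        by (simp add: a_def K_def cnj_fourier W_def c_def gauss_weight_def)
      have "fourier a x = fourier (\<lambda>t. a (- t)) (- x)"
        by (simp add: fourier_reflect)
      also have "\<dots> = (\<integral>t. of_real (gauss_weight c t) * iexp (- x * t) * fourier K t \<partial>lborel)"
        unfolding refl fourier_def[of _ "- x"]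
        by (intro Bochner_Integration.integral_cong) (auto simp: ac_simps)
      also have "\<dots> = (\<integral>y. of_real (2 * pi * normal_density 0 (1 / c) (y - x)) * K y \<partial>lborel)"
        by (rule smoothing_identity[OF c K])
      finally show ?thesis
        using norm_smoothing_le[OF c k k0 B, of x] by (simp add: K_def)
    qed
    have int: "integrable lborel (\<lambda>t. W n t * (norm (fourier K t))\<^sup>2)"
    proof (rule Bochner_Integration.integrable_bound[OF Wi])
      show "(\<lambda>t. W n t * (norm (fourier K t))\<^sup>2) \<in> borel_measurable lborel"
        unfolding W_def K_def by measurable
      show "AE t in lborel. norm (W n t * (norm (fourier K t))\<^sup>2) \<le> norm (W n t)"
        using le1 W0 by (auto simp: abs_mult intro!: mult_left_le power_le_one)
    qed
    have "of_real (W n t * (norm (fourier K t))\<^sup>2) = a t * fourier K t" for t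
      by (simp add: a_def complex_norm_square mult.commute del: of_real_power)
    then have "complex_of_real (\<integral>t. W n t * (norm (fourier K t))\<^sup>2 \<partial>lborel) = (\<integral>t. a t * fourier K t \<partial>lborel)"
      by (simp only: integral_complex_of_real[symmetric])
    also have "\<dots> = (\<integral>x. fourier a x * K x \<partial>lborel)"
      by (rule fourier_multiplication_formula[OF a K])
    finally have "\<bar>\<integral>t. W n t * (norm (fourier K t))\<^sup>2 \<partial>lborel\<bar> = norm (\<integral>x. fourier a x * K x \<partial>lborel)"
      by (metis norm_of_real)
    also have "\<dots> \<le> (\<integral>x. 2 * pi * B * k x \<partial>lborel)"
    proof (rule Bochner_Integration.integral_norm_bound_integral)
      show i: "integrable lborel (\<lambda>x. 2 * pi * B * k x)" using k by simp
      show n: "norm (fourier a x * K x) \<le> 2 * pi * B * k x" for x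
        using fa[of x] k0[of x] by (auto simp: K_def norm_mult intro!: mult_right_mono)
      show "integrable lborel (\<lambda>x. fourier a x * K x)"
        by (rule Bochner_Integration.integrable_bound[OF i])
          (use n borel_measurable_integrable[OF a] B0 k0 in \<open>auto simp: K_def\<close>)
    qed
    also have "\<dots> = 2 * pi * B * (\<integral>x. k x \<partial>lborel)" by simp
    also have "\<dots> \<le> 2 * pi * B" using k1 B0 by (simp add: mult_left_le)
    finally show ?thesis
      using int W0 by (subst nn_integral_eq_integral) (auto intro: ennreal_leI)
  qed
  have lim: "(\<lambda>n. W n t) \<longlonglongrightarrow> 1" for t
    unfolding W_def by (rule gauss_weight_tendsto_1)
  have "(\<integral>\<^sup>+t. ennreal ((norm (fourier K t))\<^sup>2) \<partial>lborel) =
      (\<integral>\<^sup>+t. liminf (\<lambda>n. ennreal (W n t * (norm (fourier K t))\<^sup>2)) \<partial>lborel)"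
  proof (rule nn_integral_cong)
    fix t
    have "(\<lambda>n. ennreal (W n t * (norm (fourier K t))\<^sup>2)) \<longlonglongrightarrow> ennreal (1 * (norm (fourier K t))\<^sup>2)"
      by (intro tendsto_intros lim)
    then show "ennreal ((norm (fourier K t))\<^sup>2) = liminf (\<lambda>n. ennreal (W n t * (norm (fourier K t))\<^sup>2))"
      using lim_imp_Liminf[OF sequentially_bot] by fastforce
  qed
  also have "\<dots> \<le> liminf (\<lambda>n. \<integral>\<^sup>+t. ennreal (W n t * (norm (fourier K t))\<^sup>2) \<partial>lborel)"
    by (rule nn_integral_liminf) (auto simp: W_def K_def)
  also have "\<dots> \<le> ennreal (2 * pi * B)"
    by (rule Liminf_le) (use bound in auto)
  finally show ?thesis by (simp add: K_def)
qed

section \<open>Fourier inversion\<close>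

lemma real_distribution_density:
  assumes h: "integrable lborel h" and h0: "\<And>x. 0 \<le> h x" and h1: "(\<integral>x. h x \<partial>lborel) = 1"
  shows "real_distribution (density lborel h)"
proof -
  note [measurable] = borel_measurable_integrable[OF h]
  have "emeasure (density lborel h) (space (density lborel h)) = 1"
    using h h0 h1 by (simp add: emeasure_density nn_integral_eq_integral)
  then interpret prob_space "density lborel h" by (rule prob_spaceI)
  show ?thesis by unfold_locales simp_all
qed

lemma char_density:
  assumes "h \<in> borel_measurable borel" "\<And>x. 0 \<le> h x"
  shows "char (density lborel h) = fourier (\<lambda>x. of_real (h x))"
proof
  fix t
  show "char (density lborel h) t = fourier (\<lambda>x. of_real (h x)) t"
    unfolding char_def fourier_def using assms
    by (subst integral_density) (auto simp: scaleR_conv_of_real)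
qed

lemma fourier_indicator:
  assumes "c \<le> d" "t \<noteq> 0"
  shows "fourier (\<lambda>x. indicator {c..d} x) t = (iexp (t * d) - iexp (t * c)) / (\<i> * t)"
proof -
  have "fourier (\<lambda>x. indicator {c..d} x) t = (\<integral>x. indicator {c..d} x *\<^sub>R iexp (t * x) \<partial>lborel)"
    unfolding fourier_def by (intro Bochner_Integration.integral_cong) (auto split: split_indicator)
  also have "\<dots> = iexp (t * d) / (\<i> * t) - iexp (t * c) / (\<i> * t)"
  proof (rule integral_FTC_Icc)
    fix x
    show "((\<lambda>x. iexp (t * x) / (\<i> * t)) has_vector_derivative iexp (t * x)) (at x within {c..d})"
      using assms(2) by (auto simp: has_vector_derivative_complex_iff Re_exp Im_exp Re_divide Im_divide power2_eq_square intro!: derivative_eq_intros)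
  qed (use assms in \<open>auto intro!: continuous_intros\<close>)
  finally show ?thesis by (simp add: diff_divide_distrib)
qed

text \<open>
  The inverse transform is a pointwise limit of Gaussian smoothings of the nonnegative function \<open>h\<close>.
\<close>

lemma fourier_inversion_nonneg:
  assumes h: "integrable lborel h" and h0: "\<And>x. 0 \<le> h x"
    and \<phi>: "integrable lborel (fourier (\<lambda>x. of_real (h x)))" (is "integrable lborel ?\<phi>")
  shows "fourier ?\<phi> x \<in> \<real>\<^sub>\<ge>\<^sub>0"
proof -
  define W where "W n = gauss_weight (real (Suc n))" for n
  have [measurable]: "W n \<in> borel_measurable borel" for n by (simp add: W_def)
  note [measurable] = borel_measurable_integrable[OF \<phi>]
  have lim: "(\<lambda>n. W n t) \<longlonglongrightarrow> 1" for t
    unfolding W_def by (rule gauss_weight_tendsto_1)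
  have "(\<lambda>n. \<integral>t. of_real (W n t) * iexp (x * t) * ?\<phi> t \<partial>lborel) \<longlonglongrightarrow> (\<integral>t. of_real 1 * iexp (x * t) * ?\<phi> t \<partial>lborel)"
  proof (rule integral_dominated_convergence[where w = "\<lambda>t. norm (?\<phi> t)"])
    show "AE t in lborel. (\<lambda>n. of_real (W n t) * iexp (x * t) * ?\<phi> t) \<longlonglongrightarrow> of_real 1 * iexp (x * t) * ?\<phi> t"
      by (intro AE_I2 tendsto_intros lim)
    show "AE t in lborel. norm (of_real (W n t) * iexp (x * t) * ?\<phi> t) \<le> norm (?\<phi> t)" for n
      by (auto simp: norm_mult W_def gauss_weight_def intro!: mult_left_le_one_le)
  qed (use \<phi> in auto)
  then have L: "(\<lambda>n. \<integral>t. of_real (W n t) * iexp (x * t) * ?\<phi> t \<partial>lborel) \<longlonglongrightarrow> fourier ?\<phi> x"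
    by (simp add: fourier_def mult.commute)
  have "(\<integral>t. of_real (W n t) * iexp (x * t) * ?\<phi> t \<partial>lborel) \<in> \<real>\<^sub>\<ge>\<^sub>0" for n
  proof -
    have "(\<integral>t. of_real (W n t) * iexp (x * t) * ?\<phi> t \<partial>lborel) =
       (\<integral>y. of_real (2 * pi * normal_density 0 (1 / real (Suc n)) (y + x)) * of_real (h y) \<partial>lborel)"
      using smoothing_identity[of "real (Suc n)" "\<lambda>x. of_real (h x)" "- x"] h by (simp add: W_def)
    also have "\<dots> = of_real (\<integral>y. 2 * pi * normal_density 0 (1 / real (Suc n)) (y + x) * h y \<partial>lborel)"
      by (simp only: of_real_mult[symmetric] integral_complex_of_real)
    also have "\<dots> \<in> \<real>\<^sub>\<ge>\<^sub>0"
      using h0 by (subst nonneg_Reals_of_real_iff) (intro Bochner_Integration.integral_nonneg, simp)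
    finally show ?thesis .
  qed
  then show ?thesis
    by (rule closed_sequentially[OF closed_nonneg_Reals_complex _ L])
qed

text \<open>
  Levy's inversion formula gives the mass of every interval as a limit of truncated Fourier integrals.
  Since \<open>\<phi>\<close> is integrable, this limit is the integral of the inverse transform over the interval, so the
  two densities define the same measure.
\<close>

lemma fourier_inversion_AE:
  assumes h: "integrable lborel h" and h0: "\<And>x. 0 \<le> h x" and h1: "(\<integral>x. h x \<partial>lborel) = 1"
    and \<phi>: "integrable lborel (fourier (\<lambda>x. of_real (h x)))" (is "integrable lborel ?\<phi>")
  shows "AE x in lborel. of_real (h x) = fourier ?\<phi> (- x) / (2 * pi)"
proof -
  define g where "g x = Re (fourier ?\<phi> (- x)) / (2 * pi)" for x
  interpret M: real_distribution "density lborel h"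
    by (rule real_distribution_density[OF h h0 h1])
  note [measurable] = borel_measurable_integrable[OF h] borel_measurable_integrable[OF \<phi>]
  have [measurable]: "g \<in> borel_measurable borel" unfolding g_def[abs_def] by measurable
  have g: "fourier ?\<phi> (- x) / (2 * pi) = of_real (g x)" "0 \<le> g x" for x
    using fourier_inversion_nonneg[OF h h0 \<phi>, of "- x"]
    by (auto simp: g_def complex_nonneg_Reals_iff complex_eq_iff)
  have g_bound: "g x \<le> (\<integral>t. norm (?\<phi> t) \<partial>lborel) / (2 * pi)" for x
    unfolding g_def using norm_fourier_le[OF \<phi>, of "- x"] abs_Re_le_cmod[of "fourier ?\<phi> (- x)"]
    by (intro divide_right_mono) auto
  have Ioc: "measure (density lborel h) {a<..b} = (\<integral>x. indicator {a..b} x * g x \<partial>lborel)" if "a \<le> b" for a b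
  proof -
    define D where "D = fourier (\<lambda>x. indicator {-b..-a} x)"
    have "integrable lborel (\<lambda>x. complex_of_real (indicator {-b..-a} x))"
      by (intro integrable_of_real integrable_real_indicator) (auto simp: emeasure_lborel_Icc_eq)
    moreover have "(\<lambda>x. complex_of_real (indicator {-b..-a} x)) = indicator {-b..-a}"
      by (auto split: split_indicator)
    ultimately have I: "integrable lborel (\<lambda>x. indicator {-b..-a} x :: complex)"
      by simp
    have [measurable]: "D \<in> borel_measurable borel" unfolding D_def by measurable
    have Dle: "norm (D t) \<le> (\<integral>x. norm (indicator {-b..-a} x :: complex) \<partial>lborel)" (is "_ \<le> ?K") for t
      unfolding D_def by (rule norm_fourier_le[OF I])
    have point: "M.prob {c} = 0" for c
      by (simp add: measure_def emeasure_density nn_integral_indicator_singleton')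
    let ?L = "\<lambda>T::nat. CLBINT t=- real T..real T. (iexp (-(t * a)) - iexp (-(t * b))) / (\<i> * t) * char (density lborel h) t"
    let ?I = "\<lambda>T::nat. \<lambda>t. indicator {- real T<..<real T} t *\<^sub>R (?\<phi> t * D t)"
    have eq: "?L T
       = (\<integral>t. ?I T t \<partial>lborel)" for T
    proof -
      have "?L T
       = (\<integral>t. indicator {- real T<..<real T} t *\<^sub>R ((iexp (-(t * a)) - iexp (-(t * b))) / (\<i> * t) * ?\<phi> t) \<partial>lborel)"
        using h0 by (simp add: interval_lebesgue_integral_def set_lebesgue_integral_def char_density)
      also have "\<dots> = (\<integral>t. ?I T t \<partial>lborel)"
      proof (rule integral_cong_AE)
        show "AE t in lborel. indicator {- real T<..<real T} t *\<^sub>R ((iexp (-(t * a)) - iexp (-(t * b))) / (\<i> * t) * ?\<phi> t)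
          = ?I T t"
          using AE_lborel_singleton[of "0::real"]
        proof eventually_elim
          case (elim t)
          then show ?case
            using fourier_indicator[of "- b" "- a" t] that by (simp add: D_def)
        qed
      qed measurable
      finally show ?thesis .
    qed
    have "(\<lambda>T. \<integral>t. ?I T t \<partial>lborel) \<longlonglongrightarrow> (\<integral>t. ?\<phi> t * D t \<partial>lborel)"
    proof (rule integral_dominated_convergence[where w = "\<lambda>t. norm (?\<phi> t) * ?K"])
      show "AE t in lborel. (\<lambda>T. ?I T t) \<longlonglongrightarrow> ?\<phi> t * D t"
      proof (rule AE_I2)
        fix t :: real
        obtain T0 where "\<bar>t\<bar> < real T0" using reals_Archimedean2 by blast
        then have "eventually (\<lambda>T. ?I T t = ?\<phi> t * D t) sequentially"
          by (intro eventually_sequentiallyI[of T0]) (auto split: split_indicator)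
        then show "(\<lambda>T. ?I T t) \<longlonglongrightarrow> ?\<phi> t * D t"
          by (rule tendsto_eventually)
      qed
      show "AE t in lborel. norm (?I T t) \<le> norm (?\<phi> t) * ?K" for T
        using Dle by (intro AE_I2) (auto simp: norm_mult split: split_indicator intro!: mult_left_mono mult_nonneg_nonneg)
    qed (use \<phi> in auto)
    then have "(\<lambda>T. 1 / (2 * pi) * ?L T)
       \<longlonglongrightarrow> 1 / (2 * pi) * (\<integral>t. ?\<phi> t * D t \<partial>lborel)"
      unfolding eq by (intro tendsto_intros)
    moreover have "(\<lambda>T. 1 / (2 * pi) * ?L T)
       \<longlonglongrightarrow> M.prob {a<..b}"
      using M.Levy_Inversion[OF that point point] by simp
    ultimately have "complex_of_real (M.prob {a<..b}) = 1 / (2 * pi) * (\<integral>t. ?\<phi> t * D t \<partial>lborel)"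
      by (rule LIMSEQ_unique[rotated])
    also have "(\<integral>t. ?\<phi> t * D t \<partial>lborel) = (\<integral>x. fourier ?\<phi> x * indicator {-b..-a} x \<partial>lborel)"
      unfolding D_def by (rule fourier_multiplication_formula[OF \<phi> I])
    also have "\<dots> = (\<integral>x. fourier ?\<phi> (- x) * indicator {-b..-a} (- x) \<partial>lborel)"
      by (subst lborel_integral_real_affine[where c = "-1" and t = 0]) auto
    also have "\<dots> = (\<integral>x. of_real (2 * pi * (indicator {a..b} x * g x)) \<partial>lborel)"
    proof (rule Bochner_Integration.integral_cong[OF refl])
      fix x
      show "fourier ?\<phi> (- x) * indicator {-b..-a} (- x) = of_real (2 * pi * (indicator {a..b} x * g x))"
        using g(1)[of x] by (auto simp: field_simps split: split_indicator)
    qed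
    also have "\<dots> = of_real (2 * pi * (\<integral>x. indicator {a..b} x * g x \<partial>lborel))"
      by (simp only: integral_complex_of_real integral_mult_right_zero)
    finally have "complex_of_real (M.prob {a<..b}) = of_real (\<integral>x. indicator {a..b} x * g x \<partial>lborel)"
      by simp
    then show ?thesis by (simp only: of_real_eq_iff)
  qed
  have Ioc': "emeasure (density lborel h) {a<..b} = emeasure (density lborel g) {a<..b}" for a b
  proof (cases "a \<le> b")
    case True
    have int: "integrable lborel (\<lambda>x. indicator {a..b} x * g x)"
    proof (rule Bochner_Integration.integrable_bound)
      show "integrable lborel (\<lambda>x. indicator {a..b} x * ((\<integral>t. norm (?\<phi> t) \<partial>lborel) / (2 * pi)))"
        by (intro integrable_mult_left integrable_real_indicator) (auto simp: emeasure_lborel_Icc_eq)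
      show "AE x in lborel. norm (indicator {a..b} x * g x) \<le> norm (indicator {a..b} x * ((\<integral>t. norm (?\<phi> t) \<partial>lborel) / (2 * pi)))"
        using g_bound g(2) by (intro AE_I2) (auto simp: abs_mult split: split_indicator)
    qed measurable
    have "emeasure (density lborel g) {a<..b} = (\<integral>\<^sup>+x. ennreal (indicator {a..b} x * g x) \<partial>lborel)"
      unfolding emeasure_density[of "\<lambda>x. ennreal (g x)" lborel "{a<..b}", simplified]
    proof (rule nn_integral_cong_AE)
      show "AE x in lborel. ennreal (g x) * indicator {a<..b} x = ennreal (indicator {a..b} x * g x)"
        using AE_lborel_singleton[of a] by eventually_elim (auto split: split_indicator)
    qed
    also have "\<dots> = ennreal (\<integral>x. indicator {a..b} x * g x \<partial>lborel)"
      using int g(2) by (intro nn_integral_eq_integral) auto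
    finally show ?thesis
      using Ioc[OF True] by (simp add: M.emeasure_eq_measure)
  qed simp
  have "density lborel h = density lborel g"
  proof (rule measure_eqI_generator_eq)
    show "Int_stable (range (\<lambda>(a, b). {a<..b::real}))"
      by (auto simp: Int_stable_def image_iff)
    show "(\<Union>i. {- real i<..real i}) = UNIV"
    proof safe
      fix x :: real
      obtain i where "\<bar>x\<bar> < real i" using reals_Archimedean2 by blast
      then show "x \<in> (\<Union>i. {- real i<..real i})" by (auto intro!: exI[of _ i])
    qed simp
    show "emeasure (density lborel h) {- real i<..real i} \<noteq> \<infinity>" for i
      by simp
  qed (use Ioc' in \<open>auto simp: borel_sigma_sets_Ioc\<close>)
  then have "AE x in lborel. ennreal (h x) = ennreal (g x)"
    by (intro sigma_finite_measure.density_unique[OF lborel.sigma_finite_measure_axioms]) auto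
  then show ?thesis
    using h0 g by (auto simp: ennreal_inj)
qed

section \<open>Integrability of powers of a characteristic function\<close>

text \<open>
  A quantitative version of the statement that \<open>h\<close> is slightly better than integrable. Let \<open>\<psi>\<^sub>n\<close> be the
  transform of \<open>min h 4\<^sup>n\<close>; its squared norm in \<open>L\<^sup>2\<close> is at most \<open>2 \<pi> 4\<^sup>n\<close>, while \<open>|\<phi> - \<psi>\<^sub>n| \<le> C q\<^sup>n\<close>.
  Given \<open>t\<close>, choose \<open>n\<close> least such that \<open>C q\<^sup>n \<le> |\<phi> t| / 2\<close>. Then \<open>|\<psi>\<^sub>n t| \<ge> |\<phi> t| / 2\<close>, and \<open>8\<^sup>-\<^sup>n\<close> is
  bounded below by a power of \<open>|\<phi> t|\<close>, so some power of \<open>|\<phi>|\<close> is dominated by the sum of all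
  \<open>8\<^sup>-\<^sup>n |\<psi>\<^sub>n|\<^sup>2\<close>, whose integral is a geometric series.
\<close>

lemma integrable_power_fourier:
  fixes h :: "real \<Rightarrow> real"
  assumes h: "integrable lborel h" and h0: "\<And>x. 0 \<le> h x" and h1: "(\<integral>x. h x \<partial>lborel) = 1"
    and q: "0 < q" "q < 1"
    and tail: "\<And>n::nat. (\<integral>x. h x - min (h x) (4 ^ n) \<partial>lborel) \<le> C * q ^ n"
  shows "\<exists>m. integrable lborel (\<lambda>t. norm (fourier (\<lambda>x. of_real (h x)) t) ^ m)"
proof -
  define C' where "C' = max C 1"
  define k where "k n x = min (h x) (4 ^ n)" for n :: nat and x
  define \<phi> where "\<phi> = fourier (\<lambda>x. complex_of_real (h x))"
  define \<psi> where "\<psi> n = fourier (\<lambda>x. complex_of_real (k n x))" for n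
  note [measurable] = borel_measurable_integrable[OF h]
  have k: "integrable lborel (k n)" for n
    by (rule Bochner_Integration.integrable_bound[OF h]) (use h0 in \<open>auto simp: k_def[abs_def]\<close>)
  have k0: "0 \<le> k n x" for n x using h0 by (simp add: k_def)
  have [measurable]: "k n \<in> borel_measurable borel" for n using borel_measurable_integrable[OF k] by simp
  have [measurable]: "\<phi> \<in> borel_measurable borel" "\<psi> n \<in> borel_measurable borel" for n
    by (simp_all add: \<phi>_def \<psi>_def)
  have k1: "(\<integral>x. k n x \<partial>lborel) \<le> 1" for n
    unfolding h1[symmetric] by (rule integral_mono[OF k h]) (simp add: k_def)
  have \<phi>1: "norm (\<phi> t) \<le> 1" for t
    using norm_fourier_le[of "\<lambda>x. complex_of_real (h x)" t] h h0 h1 by (simp add: \<phi>_def)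
  have diff: "norm (\<phi> t) \<le> norm (\<psi> n t) + C' * q ^ n" for n t
  proof -
    have "\<phi> t - \<psi> n t = fourier (\<lambda>x. complex_of_real (h x) - complex_of_real (k n x)) t"
      unfolding \<phi>_def \<psi>_def by (rule fourier_diff[symmetric]) (use h k in auto)
    then have "norm (\<phi> t - \<psi> n t) \<le> (\<integral>x. norm (complex_of_real (h x) - complex_of_real (k n x)) \<partial>lborel)"
      by (simp only:) (intro norm_fourier_le Bochner_Integration.integrable_diff integrable_of_real h k)
    also have "\<dots> = (\<integral>x. h x - min (h x) (4 ^ n) \<partial>lborel)"
    proof (rule Bochner_Integration.integral_cong[OF refl])
      fix x
      have "norm (complex_of_real (h x) - complex_of_real (k n x)) = \<bar>h x - k n x\<bar>"
        by (simp only: of_real_diff[symmetric] norm_of_real)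
      then show "norm (complex_of_real (h x) - complex_of_real (k n x)) = h x - min (h x) (4 ^ n)"
        by (simp add: k_def)
    qed
    also have "\<dots> \<le> C' * q ^ n"
      by (rule order_trans[OF tail]) (use q in \<open>auto simp: C'_def intro!: mult_right_mono\<close>)
    finally show ?thesis
      using norm_triangle_sub[of "\<phi> t" "\<psi> n t"] by linarith
  qed
  (* This turns the decay rate 8^(-n) into a power of q^n. *)
  obtain j where j: "q ^ j < 1 / 8"
    using real_arch_pow_inv[of "1/8" q] q by auto
  define c where "c = (1 / 4) * (q / (2 * C')) ^ j"
  have C': "C' \<ge> 1" by (simp add: C'_def)
  have c: "c > 0" using q C' by (simp add: c_def)
  have key: "\<exists>n. c * norm (\<phi> t) ^ (j + 2) \<le> (1 / 8) ^ n * (norm (\<psi> n t))\<^sup>2" for t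
  proof (cases "\<phi> t = 0")
    case False
    define l where "l = norm (\<phi> t)"
    have l: "0 < l" "l \<le> 1" using False \<phi>1[of t] by (auto simp: l_def)
    define n where "n = (LEAST n. C' * q ^ n \<le> l / 2)"
    obtain n0 where "q ^ n0 < l / 2 / C'"
      using real_arch_pow_inv[of "l / 2 / C'" q] q l C' by auto
    then have "C' * q ^ n0 \<le> l / 2" using C' by (simp add: field_simps)
    then have n: "C' * q ^ n \<le> l / 2" unfolding n_def by (rule LeastI)
    have "n \<noteq> 0"
    proof
      assume "n = 0"
      with n C' l show False by simp
    qed
    then obtain n' where n': "n = Suc n'" by (cases n) auto
    have "\<not> C' * q ^ n' \<le> l / 2"
      using not_less_Least[of n' "\<lambda>n. C' * q ^ n \<le> l / 2"] n' by (simp add: n_def)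
    then have qn: "q * l / (2 * C') \<le> q ^ n"
      using q C' by (simp add: n' field_simps)
    have psi: "l / 2 \<le> norm (\<psi> n t)"
      using diff[of t n] n by (simp add: l_def)
    have "c * l ^ (j + 2) = (q * l / (2 * C')) ^ j * (l / 2)\<^sup>2"
      by (simp add: c_def power_add power_divide power_mult_distrib power2_eq_square ac_simps)
    also have "\<dots> \<le> (q ^ n) ^ j * (norm (\<psi> n t))\<^sup>2"
      using qn psi q C' l by (intro mult_mono power_mono) auto
    also have "(q ^ n) ^ j = (q ^ j) ^ n"
      by (simp add: power_mult[symmetric] mult.commute)
    also have "\<dots> * (norm (\<psi> n t))\<^sup>2 \<le> (1 / 8) ^ n * (norm (\<psi> n t))\<^sup>2"
      using j q by (intro mult_right_mono power_mono) auto
    finally show ?thesis unfolding l_def by blast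
  qed (auto intro: exI[of _ 0])
  let ?S = "\<lambda>n t. ennreal ((1 / 8) ^ n) * ennreal ((norm (\<psi> n t))\<^sup>2)"
  have "(\<integral>\<^sup>+t. ennreal (c * norm (\<phi> t) ^ (j + 2)) \<partial>lborel) \<le>
      (\<integral>\<^sup>+t. (\<Sum>n. ?S n t) \<partial>lborel)"
  proof (rule nn_integral_mono)
    fix t
    obtain n where n: "c * norm (\<phi> t) ^ (j + 2) \<le> (1 / 8) ^ n * (norm (\<psi> n t))\<^sup>2"
      using key by blast
    have "ennreal (c * norm (\<phi> t) ^ (j + 2)) \<le> ?S n t"
      using n by (subst ennreal_mult[symmetric]) (auto intro: ennreal_leI)
    also have "\<dots> \<le> (\<Sum>n. ?S n t)"
      using sum_le_suminf[of "\<lambda>n. ?S n t" "{n}"] by simp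
    finally show "ennreal (c * norm (\<phi> t) ^ (j + 2)) \<le> (\<Sum>n. ?S n t)" .
  qed
  also have "\<dots> = (\<Sum>n. \<integral>\<^sup>+t. ?S n t \<partial>lborel)"
    by (rule nn_integral_suminf) measurable
  also have "\<dots> = (\<Sum>n. ennreal ((1 / 8) ^ n) * (\<integral>\<^sup>+t. ennreal ((norm (\<psi> n t))\<^sup>2) \<partial>lborel))"
    by (intro suminf_cong nn_integral_cmult) measurable
  also have "\<dots> \<le> (\<Sum>n. ennreal ((1 / 8) ^ n) * ennreal (2 * pi * 4 ^ n))"
    unfolding \<psi>_def
    by (intro suminf_le mult_left_mono plancherel_bound k k0 k1 summableI) (auto simp: k_def)
  also have "\<dots> = (\<Sum>n. ennreal (2 * pi * (1 / 2) ^ n))"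
  proof (rule suminf_cong)
    fix n :: nat
    have "(1 / 8 :: real) ^ n * (2 * pi * 4 ^ n) = 2 * pi * ((1 / 8) * 4) ^ n"
      unfolding power_mult_distrib by simp
    then show "ennreal ((1 / 8) ^ n) * ennreal (2 * pi * 4 ^ n) = ennreal (2 * pi * (1 / 2) ^ n)"
      by (subst ennreal_mult[symmetric]) auto
  qed
  also have "\<dots> = ennreal (\<Sum>n. 2 * pi * (1 / 2) ^ n)"
    by (intro suminf_ennreal2 summable_mult summable_geometric) auto
  also have "\<dots> < \<infinity>" by simp
  finally have "(\<integral>\<^sup>+t. ennreal (c * norm (\<phi> t) ^ (j + 2)) \<partial>lborel) < \<infinity>" .
  then have "integrable lborel (\<lambda>t. c * norm (\<phi> t) ^ (j + 2))"
    using c by (intro integrableI_nonneg) auto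
  then have "integrable lborel (\<lambda>t. norm (\<phi> t) ^ (j + 2))"
    using c by simp
  then show ?thesis unfolding \<phi>_def by blast
qed

section \<open>The local limit theorem\<close>

lemma fourier_Lipschitz:
  assumes h: "integrable lborel h" and h0: "\<And>x. 0 \<le> h x" and m: "integrable lborel (\<lambda>x. x * h x)"
  shows "norm (fourier (\<lambda>x. of_real (h x)) s - fourier (\<lambda>x. of_real (h x)) t) \<le> (\<integral>x. \<bar>x\<bar> * h x \<partial>lborel) * \<bar>s - t\<bar>"
proof -
  note [measurable] = borel_measurable_integrable[OF h]
  have hc: "integrable lborel (\<lambda>x. complex_of_real (h x))" using h by simp
  have m': "integrable lborel (\<lambda>x. \<bar>x\<bar> * h x * \<bar>s - t\<bar>)"
    using integrable_norm[OF m] h0 by (simp add: abs_mult)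
  have bound: "norm (complex_of_real (h x) * iexp (s * x) - complex_of_real (h x) * iexp (t * x)) \<le> \<bar>x\<bar> * h x * \<bar>s - t\<bar>" for x
  proof -
    have "iexp (s * x) = iexp (t * x) * iexp ((s - t) * x)"
      by (simp add: exp_add[symmetric] algebra_simps)
    then have "iexp (s * x) - iexp (t * x) = iexp (t * x) * (iexp ((s - t) * x) - 1)"
      by (simp only: right_diff_distrib mult_1_right)
    then have "norm (iexp (s * x) - iexp (t * x)) = norm (iexp ((s - t) * x) - 1)"
      by (simp add: norm_mult)
    also have "\<dots> \<le> \<bar>(s - t) * x\<bar>"
      using iexp_approx1[of "(s - t) * x" 0] by simp
    finally have "norm (complex_of_real (h x) * (iexp (s * x) - iexp (t * x))) \<le> h x * \<bar>(s - t) * x\<bar>"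
      using h0[of x] by (auto simp: norm_mult intro!: mult_left_mono)
    moreover have "h x * \<bar>(s - t) * x\<bar> = \<bar>x\<bar> * h x * \<bar>s - t\<bar>"
      by (simp only: abs_mult ac_simps)
    ultimately show ?thesis by (simp only: right_diff_distrib[symmetric])
  qed
  have "fourier (\<lambda>x. of_real (h x)) s - fourier (\<lambda>x. of_real (h x)) t =
      (\<integral>x. complex_of_real (h x) * iexp (s * x) - complex_of_real (h x) * iexp (t * x) \<partial>lborel)"
    unfolding fourier_def
    by (rule Bochner_Integration.integral_diff[symmetric]) (intro integrable_mult_iexp hc)+
  also have "norm \<dots> \<le> (\<integral>x. \<bar>x\<bar> * h x * \<bar>s - t\<bar> \<partial>lborel)"
    using bound by (intro Bochner_Integration.integral_norm_bound_integral m'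
      Bochner_Integration.integrable_diff integrable_mult_iexp hc)
  finally show ?thesis by simp
qed

text \<open>
  Otherwise \<open>exp (i t x)\<close> would be constant almost everywhere with respect to \<open>h\<close>, which would then be
  carried by an arithmetic progression, a null set.
\<close>

lemma norm_fourier_less_1:
  assumes h: "integrable lborel h" and h0: "\<And>x. 0 \<le> h x" and h1: "(\<integral>x. h x \<partial>lborel) = 1" and t: "t \<noteq> 0"
  shows "norm (fourier (\<lambda>x. of_real (h x)) t) < 1"
proof (rule ccontr)
  define c where "c = fourier (\<lambda>x. of_real (h x)) t"
  note [measurable] = borel_measurable_integrable[OF h]
  have hc: "integrable lborel (\<lambda>x. complex_of_real (h x))" using h by simp
  assume "\<not> norm (fourier (\<lambda>x. of_real (h x)) t) < 1"
  then have c: "norm c = 1"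
    using norm_fourier_le[OF hc, of t] h0 h1 by (simp add: c_def)
  define \<theta> where "\<theta> = Arg c"
  have "c \<noteq> 0" using c by auto
  then have c_eq: "c = iexp \<theta>" using c Arg_eq[of c] by (simp add: \<theta>_def)
  define u where "u x = h x * (1 - cos (t * x - \<theta>))" for x
  have u_eq: "u x = h x - Re (cnj c * (complex_of_real (h x) * iexp (t * x)))" for x
    by (simp add: u_def c_eq Re_exp Im_exp cos_diff exp_cnj algebra_simps)
  have int: "integrable lborel (\<lambda>x. cnj c * (complex_of_real (h x) * iexp (t * x)))"
    by (intro integrable_mult_right integrable_mult_iexp hc)
  have u0: "0 \<le> u x" for x using h0 by (simp add: u_def)
  have ui: "integrable lborel u"
    unfolding u_eq[abs_def] by (intro Bochner_Integration.integrable_diff h integrable_Re int)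
  have "(\<integral>x. u x \<partial>lborel) = 1 - (\<integral>x. Re (cnj c * (complex_of_real (h x) * iexp (t * x))) \<partial>lborel)"
    unfolding u_eq h1[symmetric] by (intro Bochner_Integration.integral_diff h integrable_Re int)
  also have "(\<integral>x. Re (cnj c * (complex_of_real (h x) * iexp (t * x))) \<partial>lborel) =
      Re (\<integral>x. cnj c * (complex_of_real (h x) * iexp (t * x)) \<partial>lborel)"
    by (rule integral_Re[OF int])
  also have "(\<integral>x. cnj c * (complex_of_real (h x) * iexp (t * x)) \<partial>lborel) = cnj c * c"
    unfolding c_def fourier_def by (rule integral_mult_right_zero)
  also have "cnj c * c = 1"
    using complex_norm_square[of c] c by (simp add: mult.commute)
  finally have "(\<integral>x. u x \<partial>lborel) = 0"
    by simp
  then have "AE x in lborel. u x = 0"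
    using integral_nonneg_eq_0_iff_AE[OF ui] u0 by simp
  moreover have "AE x in lborel. x \<notin> range (\<lambda>k::int. (\<theta> + 2 * pi * k) / t)"
    by (intro AE_not_in countable_imp_null_set_lborel) auto
  ultimately have "AE x in lborel. h x = 0"
  proof eventually_elim
    case (elim x)
    have "cos (t * x - \<theta>) \<noteq> 1"
    proof
      assume "cos (t * x - \<theta>) = 1"
      then obtain k :: int where "t * x - \<theta> = k * 2 * pi" by (auto simp: cos_one_2pi_int)
      then have "x = (\<theta> + 2 * pi * k) / t" using t by (simp add: field_simps)
      with elim show False by blast
    qed
    then show ?case using elim by (simp add: u_def)
  qed
  then have "(\<integral>x. h x \<partial>lborel) = 0" by (subst integral_cong_AE[where g = "\<lambda>_. 0"]) auto
  with h1 show False by simp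
qed

text \<open>
  A Lipschitz function with an integrable power tends to \<open>0\<close> at infinity: a value above \<open>3/4\<close> far out
  would stay above \<open>1/2\<close> on an interval of fixed length and contradict the smallness of the tail of the
  integral. On the remaining compact set \<open>norm_fourier_less_1\<close> applies.
\<close>

lemma fourier_bounded_away:
  fixes h :: "real \<Rightarrow> real"
  defines "\<phi> \<equiv> fourier (\<lambda>x. of_real (h x))"
  assumes h: "integrable lborel h" and h0: "\<And>x. 0 \<le> h x" and h1: "(\<integral>x. h x \<partial>lborel) = 1"
    and m: "integrable lborel (\<lambda>x. x * h x)" and k: "integrable lborel (\<lambda>t. norm (\<phi> t) ^ k)" and \<delta>: "\<delta> > 0"
  shows "\<exists>\<eta><1. \<forall>t. \<delta> \<le> \<bar>t\<bar> \<longrightarrow> norm (\<phi> t) \<le> \<eta>"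
proof -
  define L where "L = 1 + (\<integral>x. \<bar>x\<bar> * h x \<partial>lborel)"
  have L: "L \<ge> 1" using h0 by (simp add: L_def)
  have Lip: "norm (\<phi> s - \<phi> t) \<le> L * \<bar>s - t\<bar>" for s t
  proof -
    have "norm (\<phi> s - \<phi> t) \<le> (\<integral>x. \<bar>x\<bar> * h x \<partial>lborel) * \<bar>s - t\<bar>"
      unfolding \<phi>_def by (rule fourier_Lipschitz[OF h h0 m])
    also have "\<dots> \<le> L * \<bar>s - t\<bar>" by (intro mult_right_mono) (auto simp: L_def)
    finally show ?thesis .
  qed
  have cont: "continuous_on S (\<lambda>t. norm (\<phi> t))" for S
  proof (rule continuous_on_norm, rule continuous_onI)
    fix t e :: real assume "e > 0"
    show "\<exists>d>0. \<forall>s\<in>S. dist s t < d \<longrightarrow> dist (\<phi> s) (\<phi> t) \<le> e"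
    proof (intro exI[of _ "e / L"] conjI ballI impI)
      fix s assume "dist s t < e / L"
      then have "L * \<bar>s - t\<bar> \<le> e" using L by (simp add: dist_real_def field_simps)
      with Lip[of s t] show "dist (\<phi> s) (\<phi> t) \<le> e" by (simp add: dist_norm)
    qed (use L \<open>e > 0\<close> in simp)
  qed
  (* On an interval of this length a function with Lipschitz constant L varies by at most 1/4. *)
  define \<epsilon> where "\<epsilon> = 1 / (4 * L)"
  have \<epsilon>: "\<epsilon> > 0" using L by (simp add: \<epsilon>_def)
  have "(\<lambda>n::nat. \<integral>t. norm (\<phi> t) ^ k * indicator {t. real n \<le> \<bar>t\<bar>} t \<partial>lborel) \<longlonglongrightarrow> (\<integral>(t::real). 0 \<partial>lborel)"
  proof (rule integral_dominated_convergence[where w = "\<lambda>t. norm (\<phi> t) ^ k"])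
    show "AE t in lborel. (\<lambda>n. norm (\<phi> t) ^ k * indicator {t. real n \<le> \<bar>t\<bar>} t) \<longlonglongrightarrow> 0"
    proof (rule AE_I2)
      fix t :: real
      obtain T0 where T0: "\<bar>t\<bar> < real T0" using reals_Archimedean2 by blast
      have "eventually (\<lambda>n. norm (\<phi> t) ^ k * indicator {t. real n \<le> \<bar>t\<bar>} t = 0) sequentially"
        using T0 by (intro eventually_sequentiallyI[of T0]) (auto split: split_indicator)
      then show "(\<lambda>n. norm (\<phi> t) ^ k * indicator {t. real n \<le> \<bar>t\<bar>} t) \<longlonglongrightarrow> 0"
        by (rule tendsto_eventually)
    qed
  qed (use k borel_measurable_integrable[OF k] in \<open>auto split: split_indicator\<close>)
  then have "eventually (\<lambda>n::nat. (\<integral>t. norm (\<phi> t) ^ k * indicator {t. real n \<le> \<bar>t\<bar>} t \<partial>lborel) < \<epsilon> * (1 / 2) ^ k) sequentially"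
    by (intro order_tendstoD) (use \<epsilon> in auto)
  then obtain n :: nat where n: "(\<integral>t. norm (\<phi> t) ^ k * indicator {t. real n \<le> \<bar>t\<bar>} t \<partial>lborel) < \<epsilon> * (1 / 2) ^ k"
    by (auto simp: eventually_sequentially)
  have far: "norm (\<phi> t) \<le> 3 / 4" if t: "real n \<le> \<bar>t\<bar>" for t
  proof (rule ccontr)
    assume "\<not> norm (\<phi> t) \<le> 3 / 4"
    define J where "J = (if t \<ge> 0 then {t..t + \<epsilon>} else {t - \<epsilon>..t})"
    have J: "\<bar>s - t\<bar> \<le> \<epsilon>" "real n \<le> \<bar>s\<bar>" if "s \<in> J" for s
      using that t by (auto simp: J_def split: if_splits)
    have half: "1 / 2 \<le> norm (\<phi> s)" if "s \<in> J" for s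
    proof -
      have "norm (\<phi> t - \<phi> s) \<le> L * \<epsilon>"
        using Lip[of t s] J(1)[OF that] L by (smt (verit) mult_left_mono abs_minus_commute)
      also have "L * \<epsilon> = 1 / 4" using L by (simp add: \<epsilon>_def)
      finally show ?thesis
        using \<open>\<not> norm (\<phi> t) \<le> 3 / 4\<close> norm_triangle_sub[of "\<phi> t" "\<phi> s"] by linarith
    qed
    have "\<epsilon> * (1 / 2) ^ k = (\<integral>s. (1 / 2) ^ k * indicator J s \<partial>lborel)"
      using \<epsilon> by (simp add: J_def)
    also have "\<dots> \<le> (\<integral>t. norm (\<phi> t) ^ k * indicator {t. real n \<le> \<bar>t\<bar>} t \<partial>lborel)"
    proof (rule integral_mono)
      show "integrable lborel (\<lambda>s. (1 / 2) ^ k * indicator J s :: real)"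
        by (auto simp: J_def emeasure_lborel_Icc_eq intro!: integrable_mult_right integrable_real_indicator)
      show "integrable lborel (\<lambda>t. norm (\<phi> t) ^ k * indicator {t. real n \<le> \<bar>t\<bar>} t)"
        by (rule Bochner_Integration.integrable_bound[OF k])
          (use borel_measurable_integrable[OF k] in \<open>auto split: split_indicator\<close>)
      show "(1 / 2) ^ k * indicator J s \<le> norm (\<phi> s) ^ k * indicator {t. real n \<le> \<bar>t\<bar>} s" for s
        using half[of s] J(2)[of s] by (auto intro!: power_mono split: split_indicator)
    qed
    finally show False using n by simp
  qed
  define S where "S = {\<delta>..real n} \<union> {- real n..- \<delta>}"
  show ?thesis
  proof (cases "S = {}")
    case True
    have "norm (\<phi> t) \<le> 3 / 4" if "\<delta> \<le> \<bar>t\<bar>" for t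
      using far[of t] that True by (auto simp: S_def)
    then show ?thesis by (intro exI[of _ "3/4"]) auto
  next
    case False
    have "compact S" unfolding S_def by (intro compact_Un) auto
    then obtain s where s: "s \<in> S" "\<And>t. t \<in> S \<Longrightarrow> norm (\<phi> t) \<le> norm (\<phi> s)"
      using continuous_attains_sup[OF _ False cont] by blast
    have "s \<noteq> 0" using s(1) \<delta> by (auto simp: S_def)
    then have "norm (\<phi> s) < 1" unfolding \<phi>_def by (rule norm_fourier_less_1[OF h h0 h1])
    moreover have "norm (\<phi> t) \<le> max (3 / 4) (norm (\<phi> s))" if "\<delta> \<le> \<bar>t\<bar>" for t
    proof (cases "real n \<le> \<bar>t\<bar>")
      case False
      then have "t \<in> S" using that by (auto simp: S_def abs_if split: if_splits)
      then show ?thesis using s(2) by (simp add: le_max_iff_disj)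
    qed (use far[of t] in \<open>simp add: le_max_iff_disj\<close>)
    ultimately show ?thesis by (intro exI[of _ "max (3 / 4) (norm (\<phi> s))"]) auto
  qed
qed

text \<open>
  Here \<open>\<xi>\<close> is the characteristic function of the standardised variable \<open>X = (x - m) / \<sigma>\<close>. With \<open>s = t / \<surd>N\<close>,
  for \<open>|s| \<le> \<delta>\<close> the second order Taylor bound gives \<open>|\<xi> s| \<le> exp (- s\<^sup>2 / 4)\<close>, so that \<open>|\<xi> s|\<^sup>N\<close> is
  dominated by \<open>exp (- t\<^sup>2 / 4)\<close> and the pointwise central limit theorem can be integrated. For \<open>|s| > \<delta>\<close>
  all but \<open>k\<close> factors are at most \<open>\<eta> < 1\<close>, and the exponential decay beats the factor \<open>\<surd>N\<close> from
  rescaling the integral of \<open>|\<xi>|\<^sup>k\<close>.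
\<close>

lemma charfun_power_L1_convergence:
  fixes h :: "real \<Rightarrow> real" and m \<sigma> :: real
  defines "\<phi> \<equiv> fourier (\<lambda>x. of_real (h x))"
  defines "\<xi> \<equiv> (\<lambda>t. iexp (- (t * m / \<sigma>)) * \<phi> (t / \<sigma>))"
  assumes h: "integrable lborel h" and h0: "\<And>x. 0 \<le> h x" and h1: "(\<integral>x. h x \<partial>lborel) = 1"
    and mean: "has_bochner_integral lborel (\<lambda>x. x * h x) m"
    and var: "has_bochner_integral lborel (\<lambda>x. (x - m)\<^sup>2 * h x) (\<sigma>\<^sup>2)" and \<sigma>: "\<sigma> > 0"
    and k: "integrable lborel (\<lambda>t. norm (\<phi> t) ^ k)"
  shows "(\<lambda>N. \<integral>t. norm (\<xi> (t / sqrt (real N)) ^ N - of_real (exp (- t\<^sup>2 / 2))) \<partial>lborel) \<longlonglongrightarrow> 0"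
    and "eventually (\<lambda>N. integrable lborel (\<lambda>t. \<xi> (t / sqrt (real N)) ^ N)) sequentially"
proof -
  note [measurable] = borel_measurable_integrable[OF h]
  interpret M: real_distribution "density lborel h"
    by (rule real_distribution_density[OF h h0 h1])
  define X where "X x = (x - m) / \<sigma>" for x
  define E where "E t = (\<integral>x. h x * min (6 * (X x)\<^sup>2) (\<bar>t\<bar> * \<bar>X x\<bar> ^ 3) \<partial>lborel)" for t
  have [measurable]: "X \<in> borel_measurable borel" unfolding X_def[abs_def] by measurable
  have [measurable]: "\<phi> \<in> borel_measurable borel" unfolding \<phi>_def by measurable
  have \<xi>_meas [measurable]: "\<xi> \<in> borel_measurable borel" unfolding \<xi>_def by measurable
  have mi: "integrable lborel (\<lambda>x. x * h x)" "(\<integral>x. x * h x \<partial>lborel) = m"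
    using mean by (auto simp: has_bochner_integral_iff)
  have X1: "integrable lborel (\<lambda>x. h x * X x)" "(\<integral>x. h x * X x \<partial>lborel) = 0"
  proof -
    have e: "h x * X x = (x * h x - m * h x) / \<sigma>" for x by (simp add: X_def algebra_simps)
    show "integrable lborel (\<lambda>x. h x * X x)" unfolding e using mi h by auto
    show "(\<integral>x. h x * X x \<partial>lborel) = 0" unfolding e using mi h h1 by simp
  qed
  have X2: "integrable lborel (\<lambda>x. h x * (X x)\<^sup>2)" "(\<integral>x. h x * (X x)\<^sup>2 \<partial>lborel) = 1"
  proof -
    have e: "h x * (X x)\<^sup>2 = (x - m)\<^sup>2 * h x / \<sigma>\<^sup>2" for x by (simp add: X_def power_divide)
    show "integrable lborel (\<lambda>x. h x * (X x)\<^sup>2)" "(\<integral>x. h x * (X x)\<^sup>2 \<partial>lborel) = 1"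
      unfolding e using var \<sigma> by (auto simp: has_bochner_integral_iff)
  qed
  have char: "char (distr (density lborel h) borel X) t = \<xi> t" for t
  proof -
    have "char (distr (density lborel h) borel X) t = (\<integral>x. of_real (h x) * iexp (t * X x) \<partial>lborel)"
      unfolding char_def using h0 by (simp add: integral_distr integral_density scaleR_conv_of_real)
    also have "\<dots> = (\<integral>x. iexp (- (t * m / \<sigma>)) * (of_real (h x) * iexp (t / \<sigma> * x)) \<partial>lborel)"
    proof (intro Bochner_Integration.integral_cong refl)
      fix x
      have "iexp (t * X x) = iexp (- (t * m / \<sigma>)) * iexp (t / \<sigma> * x)"
        using \<sigma> by (simp add: exp_add[symmetric] X_def field_simps)
      then show "of_real (h x) * iexp (t * X x) = iexp (- (t * m / \<sigma>)) * (of_real (h x) * iexp (t / \<sigma> * x))"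
        by (simp only: mult.left_commute)
    qed
    also have "\<dots> = \<xi> t" unfolding \<xi>_def \<phi>_def fourier_def by (rule integral_mult_right_zero)
    finally show ?thesis .
  qed
  interpret D: real_distribution "distr (density lborel h) borel X"
    by (rule M.real_distribution_distr) simp
  have \<xi>_le1: "norm (\<xi> t) \<le> 1" for t using D.cmod_char_le_1[of t] by (simp add: char)
  have taylor: "norm (\<xi> t - of_real (1 - t\<^sup>2 / 2)) \<le> t\<^sup>2 / 6 * E t" for t
  proof -
    have "norm (char (distr (density lborel h) borel X) t - (1 - t\<^sup>2 * 1 / 2)) \<le>
        t\<^sup>2 / 6 * M.expectation (\<lambda>x. min (6 * (X x)\<^sup>2) (\<bar>t\<bar> * \<bar>X x\<bar> ^ 3))"
      using X1 X2 h0
      by (intro M.char_approx3') (auto simp: integrable_density integral_density)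
    then show ?thesis using h0 by (simp add: char E_def integral_density)
  qed
  let ?m = "\<lambda>t x. h x * min (6 * (X x)\<^sup>2) (\<bar>t\<bar> * \<bar>X x\<bar> ^ 3)"
  have dominated: "norm (?m t x) \<le> 6 * (h x * (X x)\<^sup>2)" for t x
  proof -
    have "?m t x \<le> h x * (6 * (X x)\<^sup>2)"
      using h0 by (intro mult_left_mono) auto
    moreover have "0 \<le> ?m t x"
      using h0 by (intro mult_nonneg_nonneg) auto
    ultimately show ?thesis by simp
  qed
  have E_lim: "(\<lambda>n. E (s n)) \<longlonglongrightarrow> 0" if s: "s \<longlonglongrightarrow> 0" for s :: "nat \<Rightarrow> real"
  proof -
    have "(\<lambda>n. E (s n)) \<longlonglongrightarrow> (\<integral>(x::real). 0 \<partial>lborel)"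
      unfolding E_def
    proof (rule integral_dominated_convergence[where w = "\<lambda>x. 6 * (h x * (X x)\<^sup>2)"])
      show "AE x in lborel. (\<lambda>n. ?m (s n) x) \<longlonglongrightarrow> 0"
      proof (rule AE_I2)
        fix x
        have "(\<lambda>n. ?m (s n) x) \<longlonglongrightarrow> ?m 0 x"
          by (intro tendsto_intros s)
        moreover have "?m 0 x = 0"
          by (simp add: min_absorb2)
        ultimately show "(\<lambda>n. ?m (s n) x) \<longlonglongrightarrow> 0"
          by (simp only:)
      qed
      show "AE x in lborel. norm (?m (s n) x) \<le> 6 * (h x * (X x)\<^sup>2)" for n
        using dominated by (intro AE_I2)
    qed (use X2 in auto)
    then show ?thesis by simp
  qed
  have E_mono: "E s \<le> E t" if "\<bar>s\<bar> \<le> \<bar>t\<bar>" for s t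
  proof -
    have i: "integrable lborel (\<lambda>x. ?m t x)" for t
    proof (rule Bochner_Integration.integrable_bound)
      show "integrable lborel (\<lambda>x. 6 * (h x * (X x)\<^sup>2))" using X2 by simp
      show "AE x in lborel. norm (?m t x) \<le> norm (6 * (h x * (X x)\<^sup>2))"
        by (intro AE_I2 order_trans[OF dominated]) simp
    qed measurable
    show ?thesis
      unfolding E_def
      by (intro integral_mono i mult_left_mono h0 min.mono mult_right_mono that) auto
  qed
  obtain \<delta> where \<delta>: "0 < \<delta>" "\<delta> \<le> 1" "E \<delta> \<le> 3 / 2"
  proof -
    have "(\<lambda>n. E (1 / real (Suc n))) \<longlonglongrightarrow> 0"
      by (rule E_lim) (use LIMSEQ_Suc[OF lim_const_over_n] in auto)
    then have "eventually (\<lambda>n. E (1 / real (Suc n)) < 3 / 2) sequentially"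
      by (rule order_tendstoD) simp
    then obtain n where "E (1 / real (Suc n)) < 3 / 2" by (auto simp: eventually_sequentially)
    then show ?thesis by (intro that[of "1 / real (Suc n)"]) auto
  qed
  have near: "norm (\<xi> s) \<le> exp (- s\<^sup>2 / 4)" if "\<bar>s\<bar> \<le> \<delta>" for s
  proof -
    have s1: "s\<^sup>2 \<le> 1" using that \<delta> by (simp add: abs_square_le_1)
    have "norm (\<xi> s - of_real (1 - s\<^sup>2 / 2)) \<le> s\<^sup>2 / 6 * (3 / 2)"
    proof (rule order_trans[OF taylor])
      have "E s \<le> 3 / 2" using E_mono[of s \<delta>] that \<delta> by simp
      then show "s\<^sup>2 / 6 * E s \<le> s\<^sup>2 / 6 * (3 / 2)" by (rule mult_left_mono) simp
    qed
    moreover have "norm (complex_of_real (1 - s\<^sup>2 / 2)) = 1 - s\<^sup>2 / 2"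
      using s1 by (simp only: norm_of_real)
    ultimately have "norm (\<xi> s) \<le> 1 - s\<^sup>2 / 4"
      using norm_triangle_sub[of "\<xi> s" "of_real (1 - s\<^sup>2 / 2)"] by linarith
    also have "\<dots> \<le> exp (- s\<^sup>2 / 4)" using exp_ge_add_one_self[of "- s\<^sup>2 / 4"] by simp
    finally show ?thesis .
  qed
  let ?P = "\<lambda>N t. \<xi> (t / sqrt (real N)) ^ N" and ?G = "\<lambda>t. complex_of_real (exp (- t\<^sup>2 / 2))"
  have pointwise: "(\<lambda>N. ?P N t) \<longlonglongrightarrow> ?G t" for t
  proof -
    have main: "eventually (\<lambda>N. norm (?P N t - of_real ((1 + (- t\<^sup>2 / 2) / N) ^ N)) \<le> t\<^sup>2 / 6 * E (t / sqrt (real N))) sequentially"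
    proof (rule eventually_sequentiallyI)
      fix N :: nat assume "N \<ge> nat \<lceil>t\<^sup>2\<rceil> + 1"
      then have N: "real N \<ge> t\<^sup>2" "N > 0" by linarith+
      define s where "s = t / sqrt (real N)"
      have s2: "s\<^sup>2 = t\<^sup>2 / N" by (simp add: s_def power_divide)
      have "s\<^sup>2 \<le> 1" using N by (simp add: s2)
      then have "norm (complex_of_real (1 - s\<^sup>2 / 2)) \<le> 1"
        by (simp only: norm_of_real) (simp add: abs_le_iff)
      then have "norm (\<xi> s ^ N - of_real (1 - s\<^sup>2 / 2) ^ N) \<le> N * norm (\<xi> s - of_real (1 - s\<^sup>2 / 2))"
        by (intro norm_power_diff \<xi>_le1)
      also have "\<dots> \<le> N * (s\<^sup>2 / 6 * E s)" by (intro mult_left_mono taylor) simp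
      also have "\<dots> = t\<^sup>2 / 6 * E s" using N by (simp add: s2)
      finally have "norm (\<xi> s ^ N - of_real (1 - s\<^sup>2 / 2) ^ N) \<le> t\<^sup>2 / 6 * E s" .
      moreover have "1 - s\<^sup>2 / 2 = 1 + (- t\<^sup>2 / 2) / N" by (simp add: s2)
      ultimately show "norm (?P N t - of_real ((1 + (- t\<^sup>2 / 2) / N) ^ N)) \<le> t\<^sup>2 / 6 * E (t / sqrt (real N))"
        by (simp only: s_def of_real_power)
    qed
    have "(\<lambda>N. t / sqrt (real N)) \<longlonglongrightarrow> 0"
      by (intro tendsto_divide_0[OF tendsto_const] filterlim_at_top_imp_at_infinity
          filterlim_compose[OF sqrt_at_top filterlim_real_sequentially])
    then have "(\<lambda>N. t\<^sup>2 / 6 * E (t / sqrt (real N))) \<longlonglongrightarrow> t\<^sup>2 / 6 * 0"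
      by (intro tendsto_intros E_lim)
    then have "(\<lambda>N. ?P N t - of_real ((1 + (- t\<^sup>2 / 2) / N) ^ N)) \<longlonglongrightarrow> 0"
      using Lim_null_comparison[OF main] by simp
    moreover have "(\<lambda>N. complex_of_real ((1 + (- t\<^sup>2 / 2) / N) ^ N)) \<longlonglongrightarrow> ?G t"
      by (intro tendsto_of_real tendsto_exp_limit_sequentially)
    ultimately show ?thesis by (rule Lim_transform[rotated])
  qed
  have \<xi>k: "integrable lborel (\<lambda>t. norm (\<xi> t) ^ k)"
    using lborel_integrable_real_affine[OF k, of "1 / \<sigma>" 0] \<sigma> by (simp add: \<xi>_def norm_mult)
  have \<xi>k': "integrable lborel (\<lambda>t. norm (\<xi> (t / sqrt (real N))) ^ k)"
    "(\<integral>t. norm (\<xi> (t / sqrt (real N))) ^ k \<partial>lborel) = sqrt (real N) * (\<integral>t. norm (\<xi> t) ^ k \<partial>lborel)" if "N > 0" for N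
  proof -
    show "integrable lborel (\<lambda>t. norm (\<xi> (t / sqrt (real N))) ^ k)"
      using lborel_integrable_real_affine[OF \<xi>k, of "1 / sqrt (real N)" 0] that by simp
    show "(\<integral>t. norm (\<xi> (t / sqrt (real N))) ^ k \<partial>lborel) = sqrt (real N) * (\<integral>t. norm (\<xi> t) ^ k \<partial>lborel)"
      using that by (subst lborel_integral_real_affine[where c = "sqrt (real N)" and t = 0]) auto
  qed
  have int: "integrable lborel (\<lambda>t. ?P N t)" if "N \<ge> k" "N > 0" for N
  proof (rule Bochner_Integration.integrable_bound[OF \<xi>k'(1)[OF that(2)]])
    show "AE t in lborel. norm (?P N t) \<le> norm (norm (\<xi> (t / sqrt (real N))) ^ k)"
      using \<xi>_le1 that by (auto simp: norm_power intro!: power_decreasing)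
  qed measurable
  show "eventually (\<lambda>N. integrable lborel (\<lambda>t. ?P N t)) sequentially"
    by (rule eventually_sequentiallyI[of "max k 1"]) (auto intro!: int)

  define F where "F N t = indicator {t. \<bar>t\<bar> \<le> \<delta> * sqrt (real N)} t *\<^sub>R ?P N t - ?G t" for N t
  have F_meas [measurable]: "F N \<in> borel_measurable borel" for N unfolding F_def[abs_def] by measurable
  have G: "exp (- t\<^sup>2 / 4) = gauss_weight (sqrt 2) t" for t
    by (simp add: gauss_weight_def power_divide)
  have Gi: "integrable lborel (\<lambda>t::real. 2 * exp (- t\<^sup>2 / 4))"
    unfolding G by (intro integrable_mult_right integrable_gauss_weight) simp
  have F_le: "norm (F N t) \<le> 2 * exp (- t\<^sup>2 / 4)" if "N > 0" for N t
  proof -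
    have "norm (indicator {t. \<bar>t\<bar> \<le> \<delta> * sqrt (real N)} t *\<^sub>R ?P N t) \<le> exp (- t\<^sup>2 / 4)"
    proof (cases "\<bar>t\<bar> \<le> \<delta> * sqrt (real N)")
      case True
      then have "\<bar>t / sqrt (real N)\<bar> \<le> \<delta>" using that by (simp add: field_simps)
      then have "norm (?P N t) \<le> exp (- (t / sqrt (real N))\<^sup>2 / 4) ^ N"
        unfolding norm_power by (intro power_mono near) auto
      also have "\<dots> = exp (- t\<^sup>2 / 4)"
        using that by (simp add: exp_of_nat_mult[symmetric] power_divide)
      finally show ?thesis using True by simp
    qed simp
    moreover have "norm (?G t) \<le> exp (- t\<^sup>2 / 4)"
      by (simp add: norm_of_real)
    ultimately show ?thesis
      unfolding F_def mult_2 by (rule order_trans[OF norm_triangle_ineq4 add_mono])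
  qed
  have Fi: "integrable lborel (F N)" if "N > 0" for N
    by (rule Bochner_Integration.integrable_bound[OF Gi]) (use F_le[OF that] in auto)
  have "(\<lambda>N. \<integral>t. norm (F (Suc N) t) \<partial>lborel) \<longlonglongrightarrow> (\<integral>(t::real). 0 \<partial>lborel)"
  proof (rule integral_dominated_convergence[OF _ _ Gi])
    show "AE t in lborel. (\<lambda>N. norm (F (Suc N) t)) \<longlonglongrightarrow> 0"
    proof (rule AE_I2)
      fix t :: real
      have "filterlim (\<lambda>N. \<delta> * sqrt (real N)) at_top sequentially"
        by (intro filterlim_tendsto_pos_mult_at_top[OF tendsto_const \<delta>(1)]
            filterlim_compose[OF sqrt_at_top filterlim_real_sequentially])
      then have "eventually (\<lambda>N. \<bar>t\<bar> \<le> \<delta> * sqrt (real N)) sequentially"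
        by (simp add: filterlim_at_top)
      then have "eventually (\<lambda>N. norm (?P N t - ?G t) = norm (F N t)) sequentially"
        by eventually_elim (simp add: F_def)
      moreover have "(\<lambda>N. norm (?P N t - ?G t)) \<longlonglongrightarrow> 0"
        using tendsto_norm_zero[OF LIM_zero[OF pointwise]] .
      ultimately have "(\<lambda>N. norm (F N t)) \<longlonglongrightarrow> 0" by (rule Lim_transform_eventually[rotated])
      then show "(\<lambda>N. norm (F (Suc N) t)) \<longlonglongrightarrow> 0" by (rule LIMSEQ_Suc)
    qed
    show "AE t in lborel. norm (norm (F (Suc N) t)) \<le> 2 * exp (- t\<^sup>2 / 4)" for N
      using F_le[of "Suc N"] by auto
  qed measurable
  then have F_lim: "(\<lambda>N. \<integral>t. norm (F N t) \<partial>lborel) \<longlonglongrightarrow> 0"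
    using LIMSEQ_imp_Suc[of "\<lambda>N. \<integral>t. norm (F N t) \<partial>lborel" 0] by simp

  obtain \<eta>' where \<eta>': "\<eta>' < 1" "\<And>t. \<delta> / \<sigma> \<le> \<bar>t\<bar> \<Longrightarrow> norm (\<phi> t) \<le> \<eta>'"
    using fourier_bounded_away[OF h h0 h1 mi(1), of k "\<delta> / \<sigma>"] k \<delta>(1) \<sigma> unfolding \<phi>_def by auto
  (* A positive bound is needed, since the proof divides by its k-th power. *)
  define \<eta> where "\<eta> = max \<eta>' (1 / 2)"
  have \<eta>: "0 < \<eta>" "\<eta> < 1" using \<eta>' by (auto simp: \<eta>_def)
  have far: "norm (\<xi> t) \<le> \<eta>" if "\<delta> \<le> \<bar>t\<bar>" for t
  proof -
    have "\<delta> / \<sigma> \<le> \<bar>t / \<sigma>\<bar>" using that \<sigma> by (simp add: divide_right_mono)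
    then show ?thesis using \<eta>'(2) by (simp add: \<xi>_def norm_mult \<eta>_def le_max_iff_disj)
  qed
  define K where "K = (\<integral>t. norm (\<xi> t) ^ k \<partial>lborel)"
  have K0: "0 \<le> K" by (simp add: K_def)
  have main: "(\<integral>t. norm (?P N t - ?G t) \<partial>lborel) \<le>
      (\<integral>t. norm (F N t) \<partial>lborel) + real N * \<eta> ^ N * (K / \<eta> ^ k)" if N: "N \<ge> k" "N > 0" for N
  proof -
    have b: "norm (?P N t - ?G t) \<le> norm (F N t) + \<eta> ^ N / \<eta> ^ k * norm (\<xi> (t / sqrt (real N))) ^ k" for t
    proof (cases "\<bar>t\<bar> \<le> \<delta> * sqrt (real N)")
      case True
      then show ?thesis using \<eta> by (simp add: F_def)
    next
      case False
      then have "\<delta> \<le> \<bar>t / sqrt (real N)\<bar>" using N by (simp add: field_simps)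
      then have f: "norm (\<xi> (t / sqrt (real N))) \<le> \<eta>" by (rule far)
      have "norm (?P N t) = norm (\<xi> (t / sqrt (real N))) ^ (N - k) * norm (\<xi> (t / sqrt (real N))) ^ k"
        using N by (simp add: norm_power power_add[symmetric])
      also have "\<dots> \<le> \<eta> ^ (N - k) * norm (\<xi> (t / sqrt (real N))) ^ k"
        by (intro mult_right_mono power_mono f) auto
      also have "\<eta> ^ (N - k) = \<eta> ^ N / \<eta> ^ k" using \<eta> N by (simp add: power_diff)
      finally have "norm (?P N t) \<le> \<eta> ^ N / \<eta> ^ k * norm (\<xi> (t / sqrt (real N))) ^ k" .
      moreover have "norm (F N t) = norm (?G t)"
        using False by (simp add: F_def)
      ultimately show ?thesis
        using norm_triangle_ineq4[of "?P N t" "?G t"] by linarith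
    qed
    have i: "integrable lborel (\<lambda>t. norm (F N t) + \<eta> ^ N / \<eta> ^ k * norm (\<xi> (t / sqrt (real N))) ^ k)"
      by (intro Bochner_Integration.integrable_add integrable_norm Fi integrable_mult_right \<xi>k' N)
    have "(\<integral>t. norm (?P N t - ?G t) \<partial>lborel) \<le>
        (\<integral>t. norm (F N t) + \<eta> ^ N / \<eta> ^ k * norm (\<xi> (t / sqrt (real N))) ^ k \<partial>lborel)"
    proof (rule integral_mono[OF _ i b])
      show "integrable lborel (\<lambda>t. norm (?P N t - ?G t))"
        by (rule Bochner_Integration.integrable_bound[OF i]) (use b in \<open>auto intro: order_trans[OF _ abs_ge_self]\<close>)
    qed
    also have "\<dots> = (\<integral>t. norm (F N t) \<partial>lborel) + \<eta> ^ N / \<eta> ^ k * (sqrt (real N) * K)"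
      using Fi[OF N(2)] \<xi>k'[OF N(2)] by (simp add: K_def)
    also have "\<eta> ^ N / \<eta> ^ k * (sqrt (real N) * K) \<le> \<eta> ^ N / \<eta> ^ k * (real N * K)"
    proof (intro mult_left_mono mult_right_mono)
      show "sqrt (real N) \<le> real N" using N(2) by (intro real_le_lsqrt) (auto simp: power2_eq_square)
    qed (use \<eta> K0 in auto)
    finally show ?thesis by (simp add: field_simps)
  qed
  have "(\<lambda>N. real N * \<eta> ^ N) \<longlonglongrightarrow> 0"
    using powser_times_n_limit_0[of \<eta>] \<eta> by simp
  then have upper: "(\<lambda>N. (\<integral>t. norm (F N t) \<partial>lborel) + real N * \<eta> ^ N * (K / \<eta> ^ k)) \<longlonglongrightarrow> 0"
    using tendsto_add[OF F_lim tendsto_mult_left_zero[of "\<lambda>N. real N * \<eta> ^ N" sequentially "K / \<eta> ^ k"]] by simp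
  show "(\<lambda>N. \<integral>t. norm (?P N t - ?G t) \<partial>lborel) \<longlonglongrightarrow> 0"
  proof (rule Lim_null_comparison[OF _ upper], rule eventually_sequentiallyI)
    fix N assume "N \<ge> max k 1"
    then have "N \<ge> k" "N > 0" by auto
    note main[OF this]
    moreover have "0 \<le> (\<integral>t. norm (?P N t - ?G t) \<partial>lborel)"
      by (intro Bochner_Integration.integral_nonneg norm_ge_zero)
    ultimately show "norm (\<integral>t. norm (?P N t - ?G t) \<partial>lborel)
      \<le> (\<integral>t. norm (F N t) \<partial>lborel) + real N * \<eta> ^ N * (K / \<eta> ^ k)"
      by (simp only: real_norm_def abs_of_nonneg)
  qed
qed

text \<open>
  For large \<open>N\<close> the convolution power \<open>h\<^bsup>*N\<^esup>\<close> equals the inverse transform of \<open>\<phi>\<^sup>N\<close>; the statement is about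
  the latter. Both terms of the difference are inverse transforms, so the supremum over \<open>u\<close> is
  controlled by the \<open>L\<^sup>1\<close> norm of the difference of the transforms.
\<close>

theorem local_limit_theorem:
  fixes h :: "real \<Rightarrow> real" and m \<sigma> :: real
  defines "\<phi> \<equiv> fourier (\<lambda>x. of_real (h x))"
  assumes h: "integrable lborel h" and h0: "\<And>x. 0 \<le> h x" and h1: "(\<integral>x. h x \<partial>lborel) = 1"
    and mean: "has_bochner_integral lborel (\<lambda>x. x * h x) m"
    and var: "has_bochner_integral lborel (\<lambda>x. (x - m)\<^sup>2 * h x) (\<sigma>\<^sup>2)" and \<sigma>: "\<sigma> > 0"
    and k: "integrable lborel (\<lambda>t. norm (\<phi> t) ^ k)"
  shows "\<exists>e. e \<longlonglongrightarrow> 0 \<and> (\<forall>\<^sub>F N in sequentially. \<forall>u.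
    norm (of_real (\<sigma> * sqrt (real N)) * (fourier (\<lambda>t. \<phi> t ^ N) (- u) / (2 * pi)) -
      of_real (std_normal_density ((u - real N * m) / (\<sigma> * sqrt (real N))))) \<le> e N)"
proof -
  define \<xi> where "\<xi> t = iexp (- (t * m / \<sigma>)) * \<phi> (t / \<sigma>)" for t
  define P where "P N t = \<xi> (t / sqrt (real N)) ^ N" for N t
  define G where "G t = complex_of_real (exp (- t\<^sup>2 / 2))" for t :: real
  define e where "e N = (\<integral>t. norm (P N t - G t) \<partial>lborel) / (2 * pi)" for N
  have lim: "(\<lambda>N. \<integral>t. norm (P N t - G t) \<partial>lborel) \<longlonglongrightarrow> 0" and
    int: "eventually (\<lambda>N. integrable lborel (P N)) sequentially"
    using charfun_power_L1_convergence[OF h h0 h1 mean var \<sigma> k[unfolded \<phi>_def]]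
    by (simp_all add: P_def[abs_def] G_def \<xi>_def \<phi>_def)
  have G_eq: "G t = of_real (gauss_weight 1 t)" for t
    by (simp add: G_def gauss_weight_def)
  have Gi: "integrable lborel G"
    unfolding G_eq[abs_def] by (intro integrable_of_real integrable_gauss_weight) simp
  have "\<forall>\<^sub>F N in sequentially. \<forall>u.
    norm (of_real (\<sigma> * sqrt (real N)) * (fourier (\<lambda>t. \<phi> t ^ N) (- u) / (2 * pi)) -
      of_real (std_normal_density ((u - real N * m) / (\<sigma> * sqrt (real N))))) \<le> e N"
    using int eventually_gt_at_top[of 0]
  proof eventually_elim
    case (elim N)
    show ?case
    proof
      fix u :: real
      define c where "c = \<sigma> * sqrt (real N)"
      have c: "c > 0" using \<sigma> elim by (simp add: c_def)
      define x where "x = (u - real N * m) / c"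
      have point: "\<phi> (t / c) ^ N * iexp (- u * (t / c)) = P N t * iexp (- x * t)" for t
      proof -
        have "P N t = iexp (- (t / sqrt (real N) * m / \<sigma>)) ^ N * \<phi> (t / c) ^ N"
          by (simp add: P_def \<xi>_def power_mult_distrib c_def mult.commute)
        also have "iexp (- (t / sqrt (real N) * m / \<sigma>)) ^ N = iexp (- (real N * m * t / c))"
          by (simp add: exp_of_nat_mult[symmetric] c_def algebra_simps)
        finally have "P N t * iexp (- x * t) = \<phi> (t / c) ^ N * (iexp (- (real N * m * t / c)) * iexp (- x * t))"
          by simp
        also have "iexp (- (real N * m * t / c)) * iexp (- x * t) = iexp (- (real N * m * t / c) + - x * t)"
          by (simp add: exp_add[symmetric] ring_distribs)
        also have "- (real N * m * t / c) + - x * t = - u * (t / c)"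
          using c by (simp add: x_def field_simps)
        finally show ?thesis ..
      qed
      have "fourier (\<lambda>t. \<phi> t ^ N) (- u) = (1 / c) *\<^sub>R (\<integral>t. \<phi> (t / c) ^ N * iexp (- u * (t / c)) \<partial>lborel)"
        unfolding fourier_def using c
        by (subst lborel_integral_real_affine[where c = "1 / c" and t = 0]) auto
      also have "\<dots> = (1 / c) *\<^sub>R fourier (P N) (- x)"
        unfolding point fourier_def ..
      finally have "of_real c * fourier (\<lambda>t. \<phi> t ^ N) (- u) = fourier (P N) (- x)"
        using c by (simp add: scaleR_conv_of_real)
      moreover have "complex_of_real (std_normal_density x) = fourier G (- x) / (2 * pi)"
        unfolding G_eq[abs_def] by (subst fourier_gauss_weight) (auto simp: normal_density_def)
      ultimately have "of_real c * (fourier (\<lambda>t. \<phi> t ^ N) (- u) / (2 * pi)) - of_real (std_normal_density x)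
         = (fourier (P N) (- x) - fourier G (- x)) / (2 * pi)"
        by (simp add: diff_divide_distrib)
      also have "\<dots> = fourier (\<lambda>t. P N t - G t) (- x) / (2 * pi)"
        by (simp add: fourier_diff[OF elim(1) Gi])
      finally have "norm (of_real c * (fourier (\<lambda>t. \<phi> t ^ N) (- u) / (2 * pi)) - of_real (std_normal_density x))
         = norm (fourier (\<lambda>t. P N t - G t) (- x)) / (2 * pi)"
        by (simp add: norm_divide norm_mult)
      also have "\<dots> \<le> e N"
        unfolding e_def using norm_fourier_le[OF Bochner_Integration.integrable_diff[OF elim(1) Gi], of "- x"]
        by (intro divide_right_mono) auto
      finally show "norm (of_real (\<sigma> * sqrt (real N)) * (fourier (\<lambda>t. \<phi> t ^ N) (- u) / (2 * pi)) -
          of_real (std_normal_density ((u - real N * m) / (\<sigma> * sqrt (real N))))) \<le> e N"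
        by (simp add: c_def x_def)
    qed
  qed
  moreover have "e \<longlonglongrightarrow> 0"
    unfolding e_def using tendsto_divide[OF lim tendsto_const, of "2 * pi"] by simp
  ultimately show ?thesis by blast
qed

lemma char_convolution:
  assumes "real_distribution M" "real_distribution N"
  shows "char (M \<star> N) t = char M t * char N t"
proof -
  interpret M: real_distribution M by fact
  interpret N: real_distribution N by fact
  interpret P: pair_prob_space M N ..
  have [simp]: "sets M = sets borel" "sets N = sets borel" by auto
  have int: "integrable (M \<Otimes>\<^sub>M N) (\<lambda>p. iexp (t * (fst p + snd p)))"
    by (rule P.integrable_const_bound[where B = 1]) auto
  have "char (M \<star> N) t = (\<integral>p. iexp (t * (fst p + snd p)) \<partial>(M \<Otimes>\<^sub>M N))"
    unfolding char_def convolution_def by (subst integral_distr) (auto simp: split_beta)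
  also have "\<dots> = (\<integral>x. \<integral>y. iexp (t * (x + y)) \<partial>N \<partial>M)"
    using P.integral_fst'[OF int] by simp
  also have "\<dots> = (\<integral>x. iexp (t * x) * char N t \<partial>M)"
    unfolding char_def by (simp add: ring_distribs exp_add)
  also have "\<dots> = char M t * char N t"
    unfolding char_def by simp
  finally show ?thesis .
qed

lemma fourier_shift: "fourier (\<lambda>x. k (u + x)) t = iexp (- u * t) * fourier k t"
proof -
  have "fourier k t = (\<integral>x. k (u + x) * iexp (t * (u + x)) \<partial>lborel)"
    unfolding fourier_def by (subst lborel_integral_real_affine[where c = 1 and t = u]) auto
  also have "\<dots> = (\<integral>x. iexp (t * u) * (k (u + x) * iexp (t * x)) \<partial>lborel)"
    by (intro Bochner_Integration.integral_cong) (auto simp: ring_distribs exp_add)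
  also have "\<dots> = iexp (t * u) * fourier (\<lambda>x. k (u + x)) t"
    unfolding fourier_def by (rule integral_mult_right_zero)
  finally have "iexp (- u * t) * fourier k t = (iexp (- u * t) * iexp (t * u)) * fourier (\<lambda>x. k (u + x)) t"
    by (simp only: mult.assoc)
  also have "iexp (- u * t) * iexp (t * u) = iexp (- u * t + t * u)"
    by (simp only: exp_add of_real_add ring_distribs)
  finally show ?thesis by simp
qed

text \<open>
  Convolution powers as functions, not classes modulo null sets: the recursion for \<open>H\<close> is assumed at
  every point.
\<close>

context
  fixes h :: "real \<Rightarrow> real" and H :: "nat \<Rightarrow> real \<Rightarrow> ennreal" and \<phi> :: "real \<Rightarrow> complex" and k :: nat
  assumes h: "integrable lborel h" and h0: "\<And>x. 0 \<le> h x" and h1: "(\<integral>x. h x \<partial>lborel) = 1"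
    and H_meas [measurable]: "\<And>N. H N \<in> borel_measurable borel"
    and H_1: "H 1 = (\<lambda>u. ennreal (h u))"
    and H_Suc: "\<And>N u. N \<ge> 1 \<Longrightarrow> H (Suc N) u = (\<integral>\<^sup>+s. H N s * ennreal (h (u - s)) \<partial>lborel)"
    and \<phi>_def: "\<phi> = fourier (\<lambda>x. of_real (h x))"
    and k: "integrable lborel (\<lambda>t. norm (\<phi> t) ^ k)"
begin

lemma real_distribution_convolution_power:
  assumes "N \<ge> 1"
  shows "real_distribution (density lborel (H N)) \<and> char (density lborel (H N)) = (\<lambda>t. \<phi> t ^ N)"
  using assms
proof (induction N rule: dec_induct)
  case base
  then show ?case
    using real_distribution_density[OF h h0 h1] char_density[of h] borel_measurable_integrable[OF h] h0
    by (simp add: H_1[unfolded One_nat_def] \<phi>_def)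
next
  case (step N)
  note [measurable] = borel_measurable_integrable[OF h]
  interpret N: real_distribution "density lborel (H N)" using step by simp
  interpret h: real_distribution "density lborel h" by (rule real_distribution_density[OF h h0 h1])
  have eq: "density lborel (\<lambda>x. ennreal (h x)) \<star> density lborel (H N) = density lborel (H (Suc N))"
  proof -
    have "density lborel (\<lambda>x. ennreal (h x)) \<star> density lborel (H N) =
        density lborel (\<lambda>x. \<integral>\<^sup>+y. ennreal (h (x - y)) * H N y \<partial>lborel)"
      by (rule convolution_density) (auto intro: N.finite_measure_axioms h.finite_measure_axioms)
    also have "(\<lambda>x. \<integral>\<^sup>+y. ennreal (h (x - y)) * H N y \<partial>lborel) = H (Suc N)"
      using H_Suc[OF step(1)] by (simp add: mult.commute[of "ennreal _"] fun_eq_iff)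
    finally show ?thesis .
  qed
  have "prob_space (density lborel (\<lambda>x. ennreal (h x)) \<star> density lborel (H N))"
  proof -
    interpret P: pair_prob_space "density lborel h" "density lborel (H N)" ..
    show ?thesis unfolding convolution_def by (intro P.prob_space_distr) auto
  qed
  then have "real_distribution (density lborel (H (Suc N)))"
    unfolding eq by (simp add: real_distribution_def real_distribution_axioms_def)
  moreover have "char (density lborel (H (Suc N))) t = \<phi> t ^ Suc N" for t
    unfolding eq[symmetric] using step char_density[of h] h0
    by (subst char_convolution) (auto simp: \<phi>_def h.real_distribution_axioms)
  ultimately show ?case by auto
qed

text \<open>
  Inversion for \<open>H N\<close> holds only almost everywhere, but the convolution \<open>H (Suc N)\<close> at a point \<open>u\<close> depends
  only on the class of \<open>H N\<close> modulo null sets. The multiplication formula moves the convolution with \<open>h\<close> to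
  the Fourier side, where it supplies the missing factor \<open>\<phi>\<close>.
\<close>

lemma convolution_power_eq_fourier:
  assumes N: "N \<ge> 1" "N \<ge> k"
  shows "0 \<le> Re (fourier (\<lambda>t. \<phi> t ^ Suc N) (- u))"
    and "Im (fourier (\<lambda>t. \<phi> t ^ Suc N) (- u)) = 0"
    and "H (Suc N) u = ennreal (Re (fourier (\<lambda>t. \<phi> t ^ Suc N) (- u)) / (2 * pi))"
proof -
  note [measurable] = borel_measurable_integrable[OF h]
  have hc: "integrable lborel (\<lambda>x. complex_of_real (h x))" using h by simp
  have [measurable]: "\<phi> \<in> borel_measurable borel" unfolding \<phi>_def by measurable
  interpret N: real_distribution "density lborel (H N)"
    using real_distribution_convolution_power[OF N(1)] by simp
  define hN where "hN x = enn2real (H N x)" for x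
  have [measurable]: "hN \<in> borel_measurable borel" unfolding hN_def[abs_def] by measurable
  have tot: "(\<integral>\<^sup>+x. H N x \<partial>lborel) = 1"
    using N.emeasure_space_1 by (simp add: emeasure_density)
  have fin: "AE x in lborel. ennreal (hN x) = H N x"
    using nn_integral_noteq_infinite[of "H N" lborel] tot
    by (auto simp: hN_def less_top ennreal_enn2real)
  have hN0: "0 \<le> hN x" for x by (simp add: hN_def)
  have tot': "(\<integral>\<^sup>+x. ennreal (hN x) \<partial>lborel) = 1"
    using nn_integral_cong_AE[OF fin] tot by simp
  have hNi: "integrable lborel hN"
    by (rule integrableI_nonneg) (use hN0 tot' in auto)
  have hN1: "(\<integral>x. hN x \<partial>lborel) = 1"
    using integral_eq_nn_integral[of hN lborel] hN0 tot' by auto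
  have "density lborel hN = density lborel (H N)"
    by (rule density_cong) (use fin in auto)
  then have fN: "fourier (\<lambda>x. of_real (hN x)) = (\<lambda>t. \<phi> t ^ N)"
    using real_distribution_convolution_power[OF N(1)] char_density[of hN] hN0 by simp
  have \<phi>1: "norm (\<phi> t) \<le> 1" for t
    using norm_fourier_le[OF hc, of t] h0 h1 by (simp add: \<phi>_def)
  have \<phi>N: "integrable lborel (\<lambda>t. \<phi> t ^ N)"
    by (rule Bochner_Integration.integrable_bound[OF k])
      (use \<phi>1 N in \<open>auto simp: norm_power intro!: power_decreasing\<close>)
  define g where "g s = Re (fourier (\<lambda>t. \<phi> t ^ N) (- s)) / (2 * pi)" for s
  have g: "fourier (\<lambda>t. \<phi> t ^ N) (- s) / (2 * pi) = of_real (g s)" "0 \<le> g s" for s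
    using fourier_inversion_nonneg[OF hNi hN0, of "- s"] \<phi>N
    by (auto simp: fN g_def complex_nonneg_Reals_iff complex_eq_iff)
  have "AE x in lborel. complex_of_real (hN x) = of_real (g x)"
    using fourier_inversion_AE[OF hNi hN0 hN1, unfolded fN, OF \<phi>N, unfolded g(1)] .
  then have Hg: "AE x in lborel. H N x = ennreal (g x)"
    using fin by eventually_elim (simp only: of_real_eq_iff)
  have [measurable]: "g \<in> borel_measurable borel" unfolding g_def[abs_def] by measurable
  have g_bound: "\<bar>g s\<bar> \<le> (\<integral>t. norm (\<phi> t ^ N) \<partial>lborel)" for s
  proof -
    have "norm (fourier (\<lambda>t. \<phi> t ^ N) (- s) / (2 * pi)) \<le> norm (fourier (\<lambda>t. \<phi> t ^ N) (- s)) / 1"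
      unfolding norm_divide by (intro divide_left_mono) (use pi_gt3 in \<open>auto simp: norm_mult\<close>)
    then have "\<bar>g s\<bar> \<le> norm (fourier (\<lambda>t. \<phi> t ^ N) (- s))"
      unfolding g(1) by simp
    then show ?thesis using norm_fourier_le[OF \<phi>N, of "- s"] by simp
  qed
  have shift: "integrable lborel (\<lambda>s. h (u - s))"
    using lborel_integrable_real_affine[OF h, of "-1" u] by simp
  have gh: "integrable lborel (\<lambda>s. g s * h (u - s))"
  proof (rule Bochner_Integration.integrable_bound)
    show "integrable lborel (\<lambda>s. (\<integral>t. norm (\<phi> t ^ N) \<partial>lborel) * h (u - s))" using shift by simp
    show "AE s in lborel. norm (g s * h (u - s)) \<le> norm ((\<integral>t. norm (\<phi> t ^ N) \<partial>lborel) * h (u - s))"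
      using g_bound h0 by (auto simp: abs_mult intro!: mult_right_mono)
  qed measurable
  define r where "r = (\<integral>s. g s * h (u - s) \<partial>lborel)"
  have r0: "0 \<le> r" unfolding r_def using g h0 by (intro Bochner_Integration.integral_nonneg) auto
  have "H (Suc N) u = (\<integral>\<^sup>+s. ennreal (g s * h (u - s)) \<partial>lborel)"
    unfolding H_Suc[OF N(1)]
  proof (rule nn_integral_cong_AE)
    show "AE s in lborel. H N s * ennreal (h (u - s)) = ennreal (g s * h (u - s))"
      using Hg by eventually_elim (simp add: ennreal_mult g h0)
  qed
  also have "\<dots> = ennreal r"
    unfolding r_def using gh g h0 by (intro nn_integral_eq_integral) auto
  finally have Hr: "H (Suc N) u = ennreal r" .
  have "complex_of_real r = (\<integral>s. of_real (g s) * of_real (h (u - s)) \<partial>lborel)"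
    unfolding r_def by (simp only: of_real_mult[symmetric] integral_complex_of_real)
  also have "\<dots> = (\<integral>s. of_real (g (- s)) * of_real (h (u + s)) \<partial>lborel)"
    by (subst lborel_integral_real_affine[where c = "-1" and t = 0]) auto
  also have "\<dots> = (\<integral>s. (1 / (2 * pi)) * (fourier (\<lambda>t. \<phi> t ^ N) s * of_real (h (u + s))) \<partial>lborel)"
  proof (intro Bochner_Integration.integral_cong refl)
    fix s
    show "of_real (g (- s)) * of_real (h (u + s)) = (1 / (2 * pi)) * (fourier (\<lambda>t. \<phi> t ^ N) s * of_real (h (u + s)))"
      using g(1)[of "- s"] by (simp add: field_simps)
  qed
  also have "\<dots> = (1 / (2 * pi)) * (\<integral>s. fourier (\<lambda>t. \<phi> t ^ N) s * of_real (h (u + s)) \<partial>lborel)"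
    by (rule integral_mult_right_zero)
  also have "(\<integral>s. fourier (\<lambda>t. \<phi> t ^ N) s * of_real (h (u + s)) \<partial>lborel) =
      (\<integral>t. \<phi> t ^ N * fourier (\<lambda>s. of_real (h (u + s))) t \<partial>lborel)"
  proof (rule fourier_multiplication_formula[OF \<phi>N, symmetric])
    show "integrable lborel (\<lambda>s. complex_of_real (h (u + s)))"
      using lborel_integrable_real_affine[OF hc, of 1 u] by simp
  qed
  also have "\<dots> = fourier (\<lambda>t. \<phi> t ^ Suc N) (- u)"
    unfolding fourier_shift[of "\<lambda>x. of_real (h x)"] \<phi>_def[symmetric] fourier_def[of _ "- u"]
    by (intro Bochner_Integration.integral_cong) (auto simp: ac_simps)
  finally have r: "fourier (\<lambda>t. \<phi> t ^ Suc N) (- u) = of_real (2 * pi * r)"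
    by (simp add: field_simps)
  show "0 \<le> Re (fourier (\<lambda>t. \<phi> t ^ Suc N) (- u))" "Im (fourier (\<lambda>t. \<phi> t ^ Suc N) (- u)) = 0"
    "H (Suc N) u = ennreal (Re (fourier (\<lambda>t. \<phi> t ^ Suc N) (- u)) / (2 * pi))"
    unfolding r Hr using r0 by auto
qed

end

section \<open>The density of a sum of squares\<close>

text \<open>
  The real-valued counterpart of \<open>square_density\<close>, needed for Bochner integrals.
\<close>

definition square_density_real :: "(real \<Rightarrow> real) \<Rightarrow> real \<Rightarrow> real" where
  "square_density_real f u = (if u > 0 then (f (sqrt u) + f (- sqrt u)) / (2 * sqrt u) else 0)"

lemma measurable_square_density_real [measurable]:
  assumes [measurable]: "f \<in> borel_measurable borel"
  shows "square_density_real f \<in> borel_measurable borel"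
  unfolding square_density_real_def[abs_def] by measurable

lemma square_density_real_nonneg: "(\<And>v. 0 \<le> f v) \<Longrightarrow> 0 \<le> square_density_real f u"
  by (simp add: square_density_real_def)

lemma square_density_ennreal:
  assumes "\<And>v. 0 \<le> f v"
  shows "square_density (\<lambda>v. ennreal (f v)) u = ennreal (square_density_real f u)"
proof (cases "u > 0")
  case True
  have "(f (sqrt u) + f (- sqrt u)) / (2 * sqrt u) = (f (sqrt u) + f (- sqrt u)) * (1 / (2 * sqrt u))"
    by simp
  then show ?thesis
    using True assms
    by (simp only: square_density_def square_density_real_def if_True) 
      (simp add: ennreal_plus[symmetric] ennreal_mult[symmetric] del: ennreal_plus)
qed (simp add: square_density_def square_density_real_def)

lemma has_bochner_integral_square_density:
  assumes f [measurable]: "f \<in> borel_measurable borel" and f0: "\<And>v. 0 \<le> f v"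
    and w [measurable]: "w \<in> borel_measurable borel" and w0: "\<And>v. 0 \<le> w (v\<^sup>2)"
    and int: "has_bochner_integral lborel (\<lambda>v. w (v\<^sup>2) * f v) c"
  shows "has_bochner_integral lborel (\<lambda>u. w u * square_density_real f u) c"
proof -
  have eq: "w u * square_density_real f u = square_density_real (\<lambda>v. w (v\<^sup>2) * f v) u" for u
    by (simp add: square_density_real_def ring_distribs)
  have c: "0 \<le> c" and i: "integrable lborel (\<lambda>v. w (v\<^sup>2) * f v)" "(\<integral>v. w (v\<^sup>2) * f v \<partial>lborel) = c"
    using int f0 w0 by (auto simp: has_bochner_integral_iff)
  have "(\<integral>\<^sup>+u. ennreal (square_density_real (\<lambda>v. w (v\<^sup>2) * f v) u) \<partial>lborel) =
      (\<integral>\<^sup>+u. square_density (\<lambda>v. ennreal (w (v\<^sup>2) * f v)) u \<partial>lborel)"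
    using f0 w0 by (simp add: square_density_ennreal)
  also have "\<dots> = (\<integral>\<^sup>+v. ennreal (w (v\<^sup>2) * f v) \<partial>lborel)"
    by (rule nn_integral_square_density) measurable
  also have "\<dots> = ennreal c"
    unfolding i(2)[symmetric] using i(1) f0 w0 by (intro nn_integral_eq_integral) auto
  finally show ?thesis
    unfolding eq using c f0 w0
    by (intro has_bochner_integral_nn_integral) (auto intro!: square_density_real_nonneg)
qed

text \<open>
  Where \<open>|v| \<ge> 1 / M\<close> and \<open>f \<le> M\<close>, the weight \<open>1 / (2 |v|)\<close> is at most \<open>M / 2\<close>, so this part of \<open>f\<close>
  contributes at most \<open>M\<^sup>2\<close> to the density of the square. The rest of \<open>f\<close>, called \<open>b\<close>, has small mass: it is
  bounded by \<open>f\<close> where \<open>f > \<surd>M\<close>, which the integral of \<open>f\<^sup>p\<close> controls, and by \<open>\<surd>M\<close> on the interval of length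
  \<open>2 / M\<close> around \<open>0\<close>.
\<close>

lemma square_density_tail:
  assumes f [measurable]: "f \<in> borel_measurable borel" and f0: "\<And>v. 0 \<le> f v"
    and f1: "integrable lborel f" and M: "M \<ge> 1"
    and p: "p > 1" and fp: "integrable lborel (\<lambda>v. f v powr p)"
  shows "(\<integral>u. square_density_real f u - min (square_density_real f u) (M\<^sup>2) \<partial>lborel)
    \<le> (\<integral>v. f v powr p \<partial>lborel) * sqrt M powr (1 - p) + 2 / sqrt M"
proof -
  define b where "b v = f v - min (f v) M * indicator {v. 1 / M \<le> \<bar>v\<bar>} v" for v
  define s where "s = sqrt M"
  have s: "s \<ge> 1" "s * s = M" using M by (auto simp: s_def)
  have [measurable]: "b \<in> borel_measurable borel" unfolding b_def[abs_def] by measurable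
  have b0: "0 \<le> b v" for v using f0[of v] M by (simp add: b_def split: split_indicator)
  have b_le: "b v \<le> f v powr p * s powr (1 - p) + s * indicator {- (1 / M)..1 / M} v" for v
  proof -
    have large: "f v \<le> f v powr p * s powr (1 - p)" if "f v > s"
    proof -
      have "f v powr (1 - p) \<le> s powr (1 - p)"
        using that s p by (intro powr_mono2') auto
      then have "f v powr p * f v powr (1 - p) \<le> f v powr p * s powr (1 - p)"
        by (intro mult_left_mono) auto
      then show ?thesis using that s by (simp add: powr_add[symmetric])
    qed
    have nn: "0 \<le> f v powr p * s powr (1 - p)" by simp
    have sM: "s \<le> M" using s mult_left_mono[of 1 s s] by simp
    show ?thesis
    proof (cases "1 / M \<le> \<bar>v\<bar>")
      case True
      then have "b v = max (f v - M) 0" by (simp add: b_def)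
      also have "\<dots> \<le> f v powr p * s powr (1 - p)"
        using large nn f0[of v] sM M by (cases "f v > s") auto
      also have "\<dots> \<le> f v powr p * s powr (1 - p) + s * indicator {- (1 / M)..1 / M} v"
        using s by simp
      finally show ?thesis .
    next
      case False
      then have "b v = f v" "v \<in> {- (1 / M)..1 / M}" by (auto simp: b_def)
      moreover have "f v \<le> f v powr p * s powr (1 - p) + s"
      proof (cases "f v > s")
        case True
        with large[OF this] s show ?thesis by linarith
      qed (use nn in linarith)
      ultimately show ?thesis by simp
    qed
  qed
  have point: "square_density_real f u - min (square_density_real f u) (M\<^sup>2) \<le> square_density_real b u" for u
  proof (cases "u > 0")
    case True
    define g where "g v = min (f v) M * indicator {v. 1 / M \<le> \<bar>v\<bar>} v" for v
    have "square_density_real f u = square_density_real b u + square_density_real g u"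
      using True by (simp add: square_density_real_def b_def g_def add_divide_distrib diff_divide_distrib)
    moreover have "square_density_real g u \<le> M\<^sup>2"
    proof (cases "1 / M \<le> sqrt u")
      case True
      have "g (sqrt u) + g (- sqrt u) \<le> 2 * M"
        using M by (auto simp: g_def split: split_indicator)
      also have "\<dots> \<le> M\<^sup>2 * (2 * sqrt u)"
      proof -
        have "1 \<le> M * sqrt u" using True M by (simp add: field_simps)
        then have "2 * M * 1 \<le> 2 * M * (M * sqrt u)" using M by (intro mult_left_mono) auto
        then show ?thesis by (simp add: power2_eq_square algebra_simps)
      qed
      finally show ?thesis using \<open>u > 0\<close> by (simp add: square_density_real_def divide_le_eq)
    next
      case False
      then have "g (sqrt u) = 0" "g (- sqrt u) = 0" using \<open>u > 0\<close> by (auto simp: g_def)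
      then show ?thesis by (simp add: square_density_real_def)
    qed
    moreover have "0 \<le> square_density_real b u" by (intro square_density_real_nonneg b0)
    ultimately show ?thesis by (simp add: min_def)
  qed (simp add: square_density_real_def)
  have ind: "integrable lborel (\<lambda>v. indicator {- (1 / M)..1 / M} v :: real)"
    by (intro integrable_real_indicator) (auto simp: emeasure_lborel_Icc_eq)
  have i: "integrable lborel (\<lambda>v. f v powr p * s powr (1 - p) + s * indicator {- (1 / M)..1 / M} v)"
    using fp ind by (intro Bochner_Integration.integrable_add integrable_mult_left integrable_mult_right) auto
  have bi: "integrable lborel b"
    by (rule Bochner_Integration.integrable_bound[OF i]) (use b0 b_le in \<open>auto intro: order_trans[OF _ abs_ge_self]\<close>)
  have sb: "has_bochner_integral lborel (\<lambda>u. 1 * square_density_real b u) (\<integral>v. b v \<partial>lborel)"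
    by (rule has_bochner_integral_square_density) (use b0 bi in \<open>auto simp: has_bochner_integral_integrable\<close>)
  have sf: "integrable lborel (square_density_real f)"
    using has_bochner_integral_square_density[of f "\<lambda>_. 1" "\<integral>v. f v \<partial>lborel"] f0 f1
    by (auto simp: has_bochner_integral_iff)
  have "(\<integral>u. square_density_real f u - min (square_density_real f u) (M\<^sup>2) \<partial>lborel) \<le> (\<integral>u. square_density_real b u \<partial>lborel)"
  proof (rule integral_mono[OF _ _ point])
    show "integrable lborel (\<lambda>u. square_density_real f u - min (square_density_real f u) (M\<^sup>2))"
    proof (rule Bochner_Integration.integrable_bound[OF sf])
      show "AE u in lborel. norm (square_density_real f u - min (square_density_real f u) (M\<^sup>2)) \<le> norm (square_density_real f u)"
        using square_density_real_nonneg[of f] f0 by (intro AE_I2) (auto simp: min_def)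
    qed measurable
  qed (use sb in \<open>auto simp: has_bochner_integral_iff\<close>)
  also have "\<dots> = (\<integral>v. b v \<partial>lborel)" using sb by (auto simp: has_bochner_integral_iff)
  also have "\<dots> \<le> (\<integral>v. f v powr p * s powr (1 - p) + s * indicator {- (1 / M)..1 / M} v \<partial>lborel)"
    by (rule integral_mono[OF bi i b_le])
  also have "\<dots> = (\<integral>v. f v powr p \<partial>lborel) * s powr (1 - p) + s * (2 / M)"
    using fp ind M by (subst Bochner_Integration.integral_add) auto
  also have "s * (2 / M) = 2 / s" using s by (simp add: s(2)[symmetric] field_simps)
  finally show ?thesis by (simp add: s_def)
qed

theorem square_sum_density_asymptotics:
  fixes f :: "real \<Rightarrow> real"
  assumes f [measurable]: "f \<in> borel_measurable borel" and f0: "\<And>v. 0 \<le> f v"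
    and f1: "has_bochner_integral lborel f 1"
    and f2: "has_bochner_integral lborel (\<lambda>v. v\<^sup>2 * f v) 1"
    and f4: "has_bochner_integral lborel (\<lambda>v. (v\<^sup>2 - 1)\<^sup>2 * f v) (\<sigma>\<^sup>2)" and \<sigma>: "\<sigma> > 0"
    and p: "p > 1" and fp: "integrable lborel (\<lambda>v. f v powr p)"
  shows "\<exists>D e. e \<longlonglongrightarrow> 0 \<and> (\<forall>\<^sub>F N in sequentially. \<forall>u>0.
    square_sum_density N (\<lambda>_ v. ennreal (f v)) u = ennreal (D N u) \<and> 0 \<le> D N u \<and>
    \<bar>\<sigma> * sqrt (real N) * D N u - std_normal_density ((u - real N) / (\<sigma> * sqrt (real N)))\<bar> \<le> e N)"
proof -
  define h where "h = square_density_real f"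
  define \<phi> where "\<phi> = fourier (\<lambda>x. of_real (h x))"
  define H where "H N = square_sum_density N (\<lambda>_ v. ennreal (f v))" for N
  have h0: "0 \<le> h u" for u unfolding h_def by (rule square_density_real_nonneg) (rule f0)
  have hh: "has_bochner_integral lborel (\<lambda>u. 1 * h u) 1"
    unfolding h_def by (rule has_bochner_integral_square_density) (use f1 f0 in auto)
  have h: "integrable lborel h" and h1: "(\<integral>u. h u \<partial>lborel) = 1"
    using hh by (auto simp: has_bochner_integral_iff)
  have mean: "has_bochner_integral lborel (\<lambda>u. u * h u) 1"
    unfolding h_def by (rule has_bochner_integral_square_density) (use f2 f0 in auto)
  have var: "has_bochner_integral lborel (\<lambda>u. (u - 1)\<^sup>2 * h u) (\<sigma>\<^sup>2)"
    unfolding h_def by (rule has_bochner_integral_square_density[where w = "\<lambda>u. (u - 1)\<^sup>2"]) (use f4 f0 in auto)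
  define a where "a = sqrt 2 powr (1 - p)"
  define A where "A = (\<integral>v. f v powr p \<partial>lborel)"
  (* With M = 2^n the two terms of the tail bound are geometric, with ratios a and 1 / sqrt 2. *)
  define q where "q = max a (1 / sqrt 2)"
  have A0: "0 \<le> A" unfolding A_def by (intro Bochner_Integration.integral_nonneg) simp
  have a: "0 < a" "a < 1" using p by (auto simp: a_def powr_less_one)
  have q: "0 < q" "q < 1" using a by (auto simp: q_def)
  have tail: "(\<integral>u. h u - min (h u) (4 ^ n) \<partial>lborel) \<le> (A + 2) * q ^ n" for n :: nat
  proof -
    have sq: "((2::real) ^ n)\<^sup>2 = 4 ^ n" by (simp add: power2_eq_square power_mult_distrib[symmetric])
    have rt: "sqrt (2 ^ n) = sqrt 2 ^ n" by (simp add: real_sqrt_power)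
    have "(sqrt 2 ^ n) powr (1 - p) = a ^ n"
      by (simp add: a_def powr_power powr_powr powr_realpow[symmetric] mult.commute)
    then have "(\<integral>u. h u - min (h u) (4 ^ n) \<partial>lborel) \<le> A * a ^ n + 2 / sqrt 2 ^ n"
      using square_density_tail[OF f f0 _ _ p fp, of "2 ^ n"] f1
      by (simp add: h_def A_def sq rt has_bochner_integral_iff)
    also have "2 / sqrt 2 ^ n = 2 * (1 / sqrt 2) ^ n" by (simp add: power_divide)
    also have "A * a ^ n + 2 * (1 / sqrt 2) ^ n \<le> A * q ^ n + 2 * q ^ n"
      using A0 a by (intro add_mono mult_left_mono power_mono) (auto simp: q_def)
    finally show ?thesis by (simp add: ring_distribs)
  qed
  obtain k where k: "integrable lborel (\<lambda>t. norm (\<phi> t) ^ k)"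
    using integrable_power_fourier[OF h h0 h1 q tail] unfolding \<phi>_def by blast
  have H_meas: "H N \<in> borel_measurable borel" for N unfolding H_def by measurable
  have H_1: "H 1 = (\<lambda>u. ennreal (h u))"
    unfolding H_def h_def using f0 by (subst square_sum_density_1) (auto simp: square_density_ennreal)
  have H_Suc: "H (Suc N) u = (\<integral>\<^sup>+s. H N s * ennreal (h (u - s)) \<partial>lborel)" if "N \<ge> 1" for N u
  proof (cases "u > 0")
    case True
    then show ?thesis
      unfolding H_def h_def using that f0 by (subst square_sum_density_Suc) (auto simp: square_density_ennreal)
  next
    case False
    then have zero: "H N s * ennreal (h (u - s)) = 0" for s
      by (cases "s > 0") (auto simp: H_def h_def square_sum_density_def square_density_real_def)
    have "(\<integral>\<^sup>+s. H N s * ennreal (h (u - s)) \<partial>lborel) = 0"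
      unfolding zero by simp
    moreover have "H (Suc N) u = 0" using False by (simp add: H_def square_sum_density_def)
    ultimately show ?thesis by simp
  qed
  define D where "D N u = Re (fourier (\<lambda>t. \<phi> t ^ N) (- u)) / (2 * pi)" for N u
  obtain e where e: "e \<longlonglongrightarrow> 0" and lim: "\<forall>\<^sub>F N in sequentially. \<forall>u.
    norm (of_real (\<sigma> * sqrt (real N)) * (fourier (\<lambda>t. \<phi> t ^ N) (- u) / (2 * pi)) -
      of_real (std_normal_density ((u - real N * 1) / (\<sigma> * sqrt (real N))))) \<le> e N"
    using local_limit_theorem[OF h h0 h1 mean var \<sigma> k[unfolded \<phi>_def]] unfolding \<phi>_def by blast
  have "\<forall>\<^sub>F N in sequentially. \<forall>u>0.
    H N u = ennreal (D N u) \<and> 0 \<le> D N u \<and>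
    \<bar>\<sigma> * sqrt (real N) * D N u - std_normal_density ((u - real N) / (\<sigma> * sqrt (real N)))\<bar> \<le> e N"
    using lim eventually_ge_at_top[of "k + 2"]
  proof eventually_elim
    case (elim N)
    then obtain M where M: "N = Suc M" "M \<ge> 1" "M \<ge> k" by (cases N) auto
    show ?case
    proof (intro allI impI)
      fix u :: real
      note * = convolution_power_eq_fourier[OF h h0 h1 H_meas H_1 H_Suc \<phi>_def k M(2,3), of u, folded M(1)]
      have fD: "fourier (\<lambda>t. \<phi> t ^ N) (- u) / (2 * pi) = of_real (D N u)"
        using *(2) by (simp add: D_def complex_eq_iff Re_divide_of_real Im_divide_of_real)
      have "norm (complex_of_real (\<sigma> * sqrt (real N) * D N u - std_normal_density ((u - real N) / (\<sigma> * sqrt (real N))))) \<le> e N"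
        using elim(1)[rule_format, of u] unfolding fD by (simp only: of_real_mult of_real_diff mult_1_right)
      then have "\<bar>\<sigma> * sqrt (real N) * D N u - std_normal_density ((u - real N) / (\<sigma> * sqrt (real N)))\<bar> \<le> e N"
        by (simp only: norm_of_real)
      then show "H N u = ennreal (D N u) \<and> 0 \<le> D N u \<and>
          \<bar>\<sigma> * sqrt (real N) * D N u - std_normal_density ((u - real N) / (\<sigma> * sqrt (real N)))\<bar> \<le> e N"
        using * by (simp add: D_def)
    qed
  qed
  then show ?thesis using e unfolding H_def by blast
qed

section \<open>Comparison with the Gaussian density\<close>

lemma std_normal_density_le_1: "std_normal_density v \<le> 1"
proof -
  have "1 \<le> sqrt (2 * pi)" using pi_gt3 by (simp add: real_le_rsqrt)
  then show ?thesis unfolding std_normal_density_def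
    by (intro mult_le_one) (auto simp: divide_le_eq)
qed

lemma std_normal_density_moments:
  "has_bochner_integral lborel (\<lambda>v. v\<^sup>2 * std_normal_density v) 1"
  "has_bochner_integral lborel (\<lambda>v. (v\<^sup>2 - 1)\<^sup>2 * std_normal_density v) ((sqrt 2)\<^sup>2)"
proof -
  have m0: "has_bochner_integral lborel std_normal_density 1"
    using std_normal_moment_even[of 0] by simp
  have m2: "has_bochner_integral lborel (\<lambda>v. std_normal_density v * v\<^sup>2) 1"
    using std_normal_moment_even[of 1] by (simp add: numeral_2_eq_2)
  have m4: "has_bochner_integral lborel (\<lambda>v. std_normal_density v * v ^ 4) 3"
    using std_normal_moment_even[of 2] by (simp add: fact_numeral)
  show "has_bochner_integral lborel (\<lambda>v. v\<^sup>2 * std_normal_density v) 1"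
    using m2 by (simp add: mult.commute)
  have "has_bochner_integral lborel (\<lambda>v. std_normal_density v * v ^ 4 - 2 * (std_normal_density v * v\<^sup>2) + std_normal_density v) (3 - 2 * 1 + 1)"
    by (intro has_bochner_integral_add has_bochner_integral_diff has_bochner_integral_mult_right m0 m2 m4)
  then show "has_bochner_integral lborel (\<lambda>v. (v\<^sup>2 - 1)\<^sup>2 * std_normal_density v) ((sqrt 2)\<^sup>2)"
    by (simp add: power2_diff algebra_simps power_mult[symmetric])
qed

lemma integrable_std_normal_density_powr:
  assumes "p > 1"
  shows "integrable lborel (\<lambda>v. std_normal_density v powr p)"
proof (rule Bochner_Integration.integrable_bound)
  show "integrable lborel std_normal_density" by simp
  have "std_normal_density v powr p \<le> std_normal_density v" for v
  proof -
    have "std_normal_density v \<le> 1" by (rule std_normal_density_le_1)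
    then have "std_normal_density v powr p \<le> std_normal_density v powr 1"
      using assms by (intro powr_mono') auto
    then show ?thesis by simp
  qed
  then show "AE v in lborel. norm (std_normal_density v powr p) \<le> norm (std_normal_density v)"
    by simp
qed measurable

lemma Z_std_normal_density:
  assumes "N > 0" "r > 0"
  shows "Z N std_normal_density r = gamma_N N r"
proof -
  interpret prob_space "sphere_measure N r" by (rule prob_space_sphere_measure)
  have "AE x in sphere_measure N r. tensor_power N std_normal_density x = gamma_N N r"
    using AE_sphere_measure_in_sphere[OF assms] by eventually_elim (rule tensor_power_gaussian_on_sphere)
  moreover have "tensor_power N std_normal_density \<in> borel_measurable (sphere_measure N r)"
  proof -
    have "tensor_power N std_normal_density \<in> borel_measurable (sphere_borel_measure N r)"
      unfolding tensor_power_def[abs_def] measurable_cong_sets[OF sets_sphere_borel_measure refl]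
      by (intro borel_measurable_prod measurable_compose[OF measurable_Rn_component]) auto
    then show ?thesis
      unfolding sphere_measure_def sphere_borel_measure_def[symmetric] by (rule measurable_completion)
  qed
  ultimately have "Z N std_normal_density r = (\<integral>x. gamma_N N r \<partial>sphere_measure N r)"
    unfolding Z_def by (intro integral_cong_AE) auto
  then show ?thesis by (simp add: prob_space)
qed

text \<open>
  For the Gaussian the sphere integral is known, and the limit theorem at \<open>u = N\<close> then describes the growth of
  the volume factor. It takes the place of Stirling's formula for \<open>\<Gamma>(N / 2)\<close>.
\<close>

lemma gaussian_normalisation:
  "(\<lambda>N. sqrt 2 * sqrt (real N) * gamma_N N (sqrt (real N)) * square_norm_density N (real N)) \<longlonglongrightarrow> 1 / sqrt (2 * pi)"
proof -
  have g1: "has_bochner_integral lborel std_normal_density 1"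
    using std_normal_moment_even[of 0] by simp
  obtain D e where e: "e \<longlonglongrightarrow> 0" and D: "\<forall>\<^sub>F N in sequentially. \<forall>u>0.
    square_sum_density N (\<lambda>_ v. ennreal (std_normal_density v)) u = ennreal (D N u) \<and> 0 \<le> D N u \<and>
    \<bar>sqrt 2 * sqrt (real N) * D N u - std_normal_density ((u - real N) / (sqrt 2 * sqrt (real N)))\<bar> \<le> e N"
    using square_sum_density_asymptotics[OF _ _ g1 std_normal_density_moments _ _ integrable_std_normal_density_powr, of 2]
    by auto
  have "\<forall>\<^sub>F N in sequentially. norm (sqrt 2 * sqrt (real N) * gamma_N N (sqrt (real N)) * square_norm_density N (real N) - 1 / sqrt (2 * pi)) \<le> e N"
    using D eventually_ge_at_top[of 2]
  proof eventually_elim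
    case (elim N)
    define r where "r = sqrt (real N)"
    have r: "r > 0" "r\<^sup>2 = real N" using elim by (auto simp: r_def)
    have d: "square_sum_density N (\<lambda>_ v. ennreal (std_normal_density v)) (r\<^sup>2) = ennreal (D N (real N))" "0 \<le> D N (real N)"
      and le: "\<bar>sqrt 2 * sqrt (real N) * D N (real N) - std_normal_density 0\<bar> \<le> e N"
      using elim(1)[rule_format, of "real N"] elim(2) r by auto
    have "gamma_N N r = D N (real N) / square_norm_density N (r\<^sup>2)"
      using tensor_power_sphere(2)[OF elim(2) r(1) _ _ d] Z_std_normal_density[of N r] elim(2) r(1) by simp
    then have "D N (real N) = gamma_N N r * square_norm_density N (real N)"
      using square_norm_density_pos[of N "real N"] elim(2) r by (simp add: field_simps)
    then show ?case using le by (simp add: r_def std_normal_density_def mult.assoc)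
  qed
  then have "(\<lambda>N. sqrt 2 * sqrt (real N) * gamma_N N (sqrt (real N)) * square_norm_density N (real N) - 1 / sqrt (2 * pi)) \<longlonglongrightarrow> 0"
    using e by (rule Lim_null_comparison)
  then show ?thesis by (rule LIM_zero_cancel)
qed

text \<open>
  The factor in the theorem is the Gaussian one, transported from radius \<open>\<surd>N\<close> to radius \<open>r\<close>; the volume of
  the ball cancels.
\<close>

lemma gaussian_factor_eq:
  assumes "N > 0" "r > 0" "\<sigma> > 0"
  shows "gamma_N N r * (sqrt 2 / \<sigma>) * (alpha N (real N) / alpha N (r\<^sup>2)) =
    sqrt 2 * sqrt (real N) * gamma_N N (sqrt (real N)) * square_norm_density N (real N) / (\<sigma> * sqrt (real N) * square_norm_density N (r\<^sup>2))"
proof -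
  define V where "V = unit_ball_volume N"
  define c where "c = real N / 2 * V"
  define A where "A = real N powr (real N / 2 - 1)"
  define B where "B = (r\<^sup>2) powr (real N / 2 - 1)"
  define P where "P = (2 * pi) powr (real N / 2)"
  define E1 where "E1 = exp (- real N / 2)"
  define E2 where "E2 = exp (- r\<^sup>2 / 2)"
  define s where "s = sqrt (real N)"
  have pos: "c > 0" "A > 0" "B > 0" "P > 0" "E1 > 0" "E2 > 0" "s > 0"
    using assms unit_ball_volume(1)[of N]
    by (auto simp: c_def V_def A_def B_def P_def E1_def E2_def s_def)
  have gamma: "gamma_N N r = E2 / P" "gamma_N N (sqrt (real N)) = E1 / P"
    by (simp_all add: gamma_N_def E1_def E2_def P_def)
  have alpha: "alpha N (real N) = A * E1" "alpha N (r\<^sup>2) = B * E2"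
    by (simp_all add: alpha_def A_def B_def E1_def E2_def)
  have area: "square_norm_density N (real N) = c * A" "square_norm_density N (r\<^sup>2) = c * B"
    by (simp_all add: square_norm_density_def c_def V_def A_def B_def)
  show ?thesis
    unfolding gamma alpha area unfolding s_def[symmetric] using pos assms(3) by (simp add: field_simps)
qed

theorem theorem4:
  fixes f :: "real \<Rightarrow> real" and p :: real
  assumes "prob_density f"
    and "has_bochner_integral lebesgue (\<lambda>v. v * f v) 0"
    and "has_bochner_integral lebesgue (\<lambda>v. v\<^sup>2 * f v) 1"
    and "integrable lebesgue (\<lambda>v. v ^ 4 * f v)"
    and "p > 1" and "integrable lebesgue (\<lambda>v. f v powr p)"
  shows "\<exists>\<epsilon> :: nat \<Rightarrow> real \<Rightarrow> real.
    (\<forall>\<^sub>F N in sequentially. \<forall>r>0.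
       Z_well_defined N f r \<and>
       Z N f r = gamma_N N r * (sqrt 2 / Sigma_f f) * (alpha N (real N) / alpha N (r\<^sup>2)) *
         (exp (- ((r\<^sup>2 - real N)\<^sup>2 / (2 * real N * (Sigma_f f)\<^sup>2))) + \<epsilon> N r)) \<and>
    uniform_limit {0<..} \<epsilon> (\<lambda>r. 0) sequentially"
proof -
  have f_nonneg: "AE v in lebesgue. 0 \<le> f v" and f_int: "has_bochner_integral lebesgue f 1"
    using assms(1) by (auto simp: prob_density_def)
  have "f \<in> borel_measurable lebesgue"
    using f_int by (auto simp: has_bochner_integral_iff)
  then obtain f1 where f1 [measurable]: "f1 \<in> borel_measurable lborel" and f1_eq: "AE v in lborel. f v = f1 v"
    using completion_ex_borel_measurable_real by blast
  define f0 where "f0 v = max 0 (f1 v)" for v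
  have f0 [measurable]: "f0 \<in> borel_measurable borel" using f1 by (simp add: f0_def[abs_def])
  have f0_nonneg: "0 \<le> f0 v" for v by (simp add: f0_def)
  have f_eq: "AE v in lebesgue. f v = f0 v"
    using AE_completion[OF f1_eq] f_nonneg by eventually_elim (simp add: f0_def)
  have transfer: "has_bochner_integral lborel (\<lambda>v. w v * f0 v) c"
    if "has_bochner_integral lebesgue (\<lambda>v. w v * f v) c" and [measurable]: "w \<in> borel_measurable borel" for w :: "real \<Rightarrow> real" and c
  proof -
    have m: "(\<lambda>v. w v * f0 v) \<in> borel_measurable lborel" by measurable
    have "has_bochner_integral lebesgue (\<lambda>v. w v * f0 v) c \<longleftrightarrow> has_bochner_integral lebesgue (\<lambda>v. w v * f v) c"
    proof (rule has_bochner_integral_cong_AE)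
      show "(\<lambda>v. w v * f v) \<in> borel_measurable lebesgue"
        using that(1) by (auto simp: has_bochner_integral_iff)
      show "AE v in lebesgue. w v * f0 v = w v * f v"
        using f_eq by eventually_elim simp
    qed (rule measurable_completion[OF m])
    then show ?thesis
      using that(1) by (simp add: has_bochner_integral_iff integrable_completion[OF m] integral_completion[OF m])
  qed
  have i1: "has_bochner_integral lborel f0 1"
    using transfer[of "\<lambda>_. 1" 1] f_int by simp
  have i2: "has_bochner_integral lborel (\<lambda>v. v\<^sup>2 * f0 v) 1"
    using transfer[of "\<lambda>v. v\<^sup>2" 1] assms(3) by simp
  define \<sigma> where "\<sigma> = Sigma_f f"
  define I where "I = (\<integral>v. (v\<^sup>2 - 1)\<^sup>2 * f v \<partial>lebesgue)"
  have "integrable lebesgue (\<lambda>v. v ^ 4 * f v - 2 * (v\<^sup>2 * f v) + f v)"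
    using assms(3,4) f_int
    by (intro Bochner_Integration.integrable_add Bochner_Integration.integrable_diff integrable_mult_right)
      (auto simp: has_bochner_integral_iff)
  moreover have "v ^ 4 * f v - 2 * (v\<^sup>2 * f v) + f v = (v\<^sup>2 - 1)\<^sup>2 * f v" for v
    by (simp add: power2_diff algebra_simps power_mult[symmetric])
  ultimately have "has_bochner_integral lebesgue (\<lambda>v. (v\<^sup>2 - 1)\<^sup>2 * f v) I"
    by (simp add: has_bochner_integral_iff I_def)
  then have i4: "has_bochner_integral lborel (\<lambda>v. (v\<^sup>2 - 1)\<^sup>2 * f0 v) I"
    by (rule transfer) measurable
  have I0: "0 \<le> I"
    using i4 f0_nonneg by (auto simp: has_bochner_integral_iff)
  have "I \<noteq> 0"
  proof
    assume "I = 0"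
    then have "AE v in lborel. (v\<^sup>2 - 1)\<^sup>2 * f0 v = 0"
      using i4 f0_nonneg integral_nonneg_eq_0_iff_AE[of lborel "\<lambda>v. (v\<^sup>2 - 1)\<^sup>2 * f0 v"]
      by (auto simp: has_bochner_integral_iff)
    then have "AE v in lborel. f0 v = 0"
      using AE_lborel_singleton[of "1::real"] AE_lborel_singleton[of "-1::real"]
      by eventually_elim (auto simp: power2_eq_1_iff)
    then have "(\<integral>v. f0 v \<partial>lborel) = (\<integral>(v::real). 0 \<partial>lborel)"
      by (intro integral_cong_AE) auto
    then show False using i1 by (simp add: has_bochner_integral_iff)
  qed
  then have \<sigma>: "\<sigma> > 0" "\<sigma>\<^sup>2 = I"
    using I0 by (auto simp: \<sigma>_def Sigma_f_def I_def[symmetric])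
  have fp: "integrable lborel (\<lambda>v. f0 v powr p)"
  proof -
    have m: "(\<lambda>v. f0 v powr p) \<in> borel_measurable lborel" by measurable
    have "integrable lebesgue (\<lambda>v. f0 v powr p) \<longleftrightarrow> integrable lebesgue (\<lambda>v. f v powr p)"
    proof (rule integrable_cong_AE)
      show "AE v in lebesgue. f0 v powr p = f v powr p" using f_eq by eventually_elim simp
    qed (use assms(6) measurable_completion[OF m] in auto)
    then show ?thesis using assms(6) by (simp add: integrable_completion[OF m])
  qed
  obtain D e where e: "e \<longlonglongrightarrow> 0" and D: "\<forall>\<^sub>F N in sequentially. \<forall>u>0.
    square_sum_density N (\<lambda>_ v. ennreal (f0 v)) u = ennreal (D N u) \<and> 0 \<le> D N u \<and>
    \<bar>\<sigma> * sqrt (real N) * D N u - std_normal_density ((u - real N) / (\<sigma> * sqrt (real N)))\<bar> \<le> e N"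
    using square_sum_density_asymptotics[OF f0 f0_nonneg i1 i2 i4[folded \<sigma>(2)] \<sigma>(1) assms(5) fp] by blast
  define q where "q N = sqrt 2 * sqrt (real N) * gamma_N N (sqrt (real N)) * square_norm_density N (real N)" for N
  have q: "q \<longlonglongrightarrow> 1 / sqrt (2 * pi)"
    unfolding q_def by (rule gaussian_normalisation)
  have q_pos: "q N > 0" if "N > 0" for N
    using that square_norm_density_pos[of N "real N"] by (simp add: q_def gamma_N_def)
  let ?X = "\<lambda>N r. exp (- ((r\<^sup>2 - real N)\<^sup>2 / (2 * real N * \<sigma>\<^sup>2)))"
  (* Here q tends to 1 / sqrt (2 pi), the value at 0 of the standard normal density, so the first term is
     the normalised density of the sum of squares, rescaled so that its main term is the exponential. *)
  define \<epsilon> where "\<epsilon> N r = \<sigma> * sqrt (real N) * D N (r\<^sup>2) / q N -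
      ?X N r" for N r
  have well_def: "\<forall>\<^sub>F N in sequentially. \<forall>r>0. Z_well_defined N f r \<and>
       Z N f r = gamma_N N r * (sqrt 2 / \<sigma>) * (alpha N (real N) / alpha N (r\<^sup>2)) *
         (?X N r + \<epsilon> N r)"
    using D eventually_ge_at_top[of 2]
  proof eventually_elim
    case (elim N)
    show ?case
    proof (intro allI impI conjI)
      fix r :: real assume r: "r > 0"
      have d: "square_sum_density N (\<lambda>_ v. ennreal (f0 v)) (r\<^sup>2) = ennreal (D N (r\<^sup>2))" "0 \<le> D N (r\<^sup>2)"
        using elim(1) r by auto
      note sphere = tensor_power_sphere[OF elim(2) r f0 f0_nonneg d]
      show "Z_well_defined N f r"
        unfolding Z_well_defined_def
      proof (intro allI impI)
        fix g :: "real \<Rightarrow> real" assume "AE v in lebesgue. g v = f v"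
        then have "AE v in lebesgue. g v = f0 v" using f_eq by eventually_elim simp
        then show "integrable (sphere_measure N r) (tensor_power N g) \<and> Z N g r = Z N f r"
          using sphere f_eq by simp
      qed
      have N: "N > 0" using elim(2) by simp
      have "Z N f r = D N (r\<^sup>2) / square_norm_density N (r\<^sup>2)"
        using sphere(2) f_eq by simp
      also have "\<dots> = q N / (\<sigma> * sqrt (real N) * square_norm_density N (r\<^sup>2)) * (\<sigma> * sqrt (real N) * D N (r\<^sup>2) / q N)"
        using q_pos[OF N] \<sigma>(1) N square_norm_density_pos[of N "r\<^sup>2"] r by (simp add: field_simps)
      also have "q N / (\<sigma> * sqrt (real N) * square_norm_density N (r\<^sup>2)) =
          gamma_N N r * (sqrt 2 / \<sigma>) * (alpha N (real N) / alpha N (r\<^sup>2))"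
        unfolding q_def by (rule gaussian_factor_eq[OF N r \<sigma>(1), symmetric])
      also have "\<sigma> * sqrt (real N) * D N (r\<^sup>2) / q N = ?X N r + \<epsilon> N r"
        by (simp add: \<epsilon>_def)
      finally show "Z N f r = gamma_N N r * (sqrt 2 / \<sigma>) * (alpha N (real N) / alpha N (r\<^sup>2)) *
         (?X N r + \<epsilon> N r)" .
    qed
  qed
  define b where "b N = e N / q N + \<bar>1 / q N - sqrt (2 * pi)\<bar>" for N
  have "(\<lambda>N. e N / q N + \<bar>1 / q N - sqrt (2 * pi)\<bar>) \<longlonglongrightarrow> 0 / (1 / sqrt (2 * pi)) + \<bar>1 / (1 / sqrt (2 * pi)) - sqrt (2 * pi)\<bar>"
    by (intro tendsto_intros e q) auto
  then have b: "b \<longlonglongrightarrow> 0" by (simp add: b_def[abs_def])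
  have \<epsilon>_le: "\<forall>\<^sub>F N in sequentially. \<forall>r>0. \<bar>\<epsilon> N r\<bar> \<le> b N"
    using D eventually_gt_at_top[of 0]
  proof eventually_elim
    case (elim N)
    show ?case
    proof (intro allI impI)
      fix r :: real assume r: "r > 0"
      define x where "x = (r\<^sup>2 - real N) / (\<sigma> * sqrt (real N))"
      have le: "\<bar>\<sigma> * sqrt (real N) * D N (r\<^sup>2) - std_normal_density x\<bar> \<le> e N"
        using elim(1) r by (simp add: x_def)
      have "x\<^sup>2 / 2 = (r\<^sup>2 - real N)\<^sup>2 / (2 * real N * \<sigma>\<^sup>2)"
        using elim(2) by (simp add: x_def power_divide power_mult_distrib field_simps)
      then have exp_eq: "?X N r = sqrt (2 * pi) * std_normal_density x"
        by (simp add: std_normal_density_def)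
      have snd: "0 \<le> std_normal_density x" "std_normal_density x \<le> 1"
        by (simp_all add: std_normal_density_le_1)
      have "\<epsilon> N r = (\<sigma> * sqrt (real N) * D N (r\<^sup>2) - std_normal_density x) / q N +
          std_normal_density x * (1 / q N - sqrt (2 * pi))"
        unfolding \<epsilon>_def exp_eq by (simp add: diff_divide_distrib algebra_simps)
      also have "\<bar>\<dots>\<bar> \<le> \<bar>\<sigma> * sqrt (real N) * D N (r\<^sup>2) - std_normal_density x\<bar> / q N +
          std_normal_density x * \<bar>1 / q N - sqrt (2 * pi)\<bar>"
        using q_pos[OF elim(2)] snd by (intro order_trans[OF abs_triangle_ineq]) (simp add: abs_mult)
      also have "\<dots> \<le> b N"
        unfolding b_def using q_pos[OF elim(2)] snd le
        by (intro add_mono divide_right_mono mult_left_le_one_le) auto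
      finally show "\<bar>\<epsilon> N r\<bar> \<le> b N" .
    qed
  qed
  have "uniform_limit {0<..} \<epsilon> (\<lambda>r. 0) sequentially"
  proof (rule uniform_limitI)
    fix \<delta> :: real assume "\<delta> > 0"
    then have "\<forall>\<^sub>F N in sequentially. b N < \<delta>" using b by (intro order_tendstoD)
    then show "\<forall>\<^sub>F N in sequentially. \<forall>r\<in>{0<..}. dist (\<epsilon> N r) 0 < \<delta>"
      using \<epsilon>_le by eventually_elim (auto intro: le_less_trans)
  qed
  with well_def show ?thesis unfolding \<sigma>_def by blast
qed

end
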